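(* Let $d \geq 3$ and let $v = f(x,y)\frac{\partial}{\partial x} + g(x,y)\frac{\partial}{\partial y}$ be a complex planar algebraic vector field of degree $d$ with $\mathbb{Q}$-algebraically independent coefficients. Then the set of solutions of the differential equation $(\mathbb{A}^2, v)$ in a differentially closed field (of characteristic $0$, containing the coefficients of $v$ as constants) is strongly minimal and disintegrated.
   Context: A complex planar vector field of degree $d$ is $v = f\frac{\partial}{\partial x} + g\frac{\partial}{\partial y}$ with $f,g \in \mathbb{C}[x,y]$ of degree $\le d$. Writing $f = \sum_{i+j\le d} f_{i,j}x^iy^j$ and $g = \sum_{i+j\le d} g_{i,j}x^iy^j$, $v$ has $\mathbb{Q}$-algebraically independent coefficients if the complex numbers $f_{i,j}, g_{i,j}$ ($i+j\le d$) are all distinct, nonzero and algebraically independent over $\mathbb{Q}$. In a differential field $(\mathcal{U},\delta)$ whose field of constants contains these coefficients, the set of solutions of $(\mathbb{A}^2,v)$ is $\{(x,y)\in \mathcal{U}^2 : \delta(x) = f(x,y),\ \delta(y) = g(x,y)\}$, a definable set in the theory $\mathbf{DCF}_0$ of differentially closed fields of characteristic $0$ (language of differential rings). Strongly minimal: every definable subset (with parameters, in every elementary extension) is finite or cofinite. A strongly minimal set $D$ defined over $F$ is disintegrated (trivial forking geometry) if for every $B \supseteq F$ and every $A \subseteq D$, $\mathrm{acl}(A \cup B)\cap D = \bigcup_{a\in A}\mathrm{acl}(\{a\}\cup B)\cap D$. *)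

theory Defs
  imports Complex_Main "HOL-Library.Poly_Mapping"
begin

section \<open>Polynomials\<close>

text \<open>Polynomials over \<open>'a\<close> in variables \<open>'v\<close>: finitely supported maps from
  monomials (finitely supported exponent vectors) to coefficients.\<close>

type_synonym ('v, 'a) mpoly = "('v \<Rightarrow>\<^sub>0 nat) \<Rightarrow>\<^sub>0 'a"

definition mpoly_vars :: "('v, 'a::zero) mpoly \<Rightarrow> 'v set" where
  "mpoly_vars p = (\<Union>m\<in>Poly_Mapping.keys p. Poly_Mapping.keys m)"

text \<open>The value at \<open>x\<close> of the polynomial obtained from \<open>p\<close> by applying \<open>h\<close> to its coefficients.\<close>

definition mpoly_eval ::
    "('a::zero \<Rightarrow> 'b::comm_semiring_1) \<Rightarrow> ('v \<Rightarrow> 'b) \<Rightarrow> ('v, 'a) mpoly \<Rightarrow> 'b" where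
  "mpoly_eval h x p =
     (\<Sum>m\<in>Poly_Mapping.keys p. h (Poly_Mapping.lookup p m) *
        (\<Prod>i\<in>Poly_Mapping.keys m. x i ^ Poly_Mapping.lookup m i))"

definition algebraically_independent_over_Q :: "'i set \<Rightarrow> ('i \<Rightarrow> complex) \<Rightarrow> bool" where
  "algebraically_independent_over_Q I x \<longleftrightarrow>
     (\<forall>p :: ('i, rat) mpoly. mpoly_vars p \<subseteq> I \<and> mpoly_eval of_rat x p = 0 \<longrightarrow> p = 0)"


section \<open>Planar vector fields\<close>

text \<open>The vector field \<open>f \<partial>/\<partial>x + g \<partial>/\<partial>y\<close> is the pair \<open>f\<close>, \<open>g\<close> of polynomials in the
  variables \<open>0\<close> (for \<open>x\<close>) and \<open>1\<close> (for \<open>y\<close>).\<close>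

definition bivariate_of_degree_le :: "nat \<Rightarrow> (nat, complex) mpoly \<Rightarrow> bool" where
  "bivariate_of_degree_le d p \<longleftrightarrow>
     mpoly_vars p \<subseteq> {0, 1} \<and>
     (\<forall>m\<in>Poly_Mapping.keys p. Poly_Mapping.lookup m 0 + Poly_Mapping.lookup m 1 \<le> d)"

definition planar_vector_field ::
    "nat \<Rightarrow> (nat, complex) mpoly \<Rightarrow> (nat, complex) mpoly \<Rightarrow> bool" where
  "planar_vector_field d f g \<longleftrightarrow> bivariate_of_degree_le d f \<and> bivariate_of_degree_le d g"

definition coeff_xy :: "(nat, complex) mpoly \<Rightarrow> nat \<Rightarrow> nat \<Rightarrow> complex" where
  "coeff_xy p i j = Poly_Mapping.lookup p (Poly_Mapping.single 0 i + Poly_Mapping.single 1 j)"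

text \<open>The coefficients of both components as a single family: the tag \<open>False\<close> selects \<open>f\<close>,
  the tag \<open>True\<close> selects \<open>g\<close>.\<close>

definition vf_index :: "nat \<Rightarrow> (bool \<times> nat \<times> nat) set" where
  "vf_index d = {(c, i, j). i + j \<le> d}"

fun vf_coeff ::
    "(nat, complex) mpoly \<Rightarrow> (nat, complex) mpoly \<Rightarrow> bool \<times> nat \<times> nat \<Rightarrow> complex" where
  "vf_coeff f g (c, i, j) = coeff_xy (if c then g else f) i j"

definition Q_independent_coefficients ::
    "nat \<Rightarrow> (nat, complex) mpoly \<Rightarrow> (nat, complex) mpoly \<Rightarrow> bool" where
  "Q_independent_coefficients d f g \<longleftrightarrow>
     inj_on (vf_coeff f g) (vf_index d) \<and>
     (\<forall>k\<in>vf_index d. vf_coeff f g k \<noteq> 0) \<and>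
     algebraically_independent_over_Q (vf_index d) (vf_coeff f g)"


section \<open>Differentially closed fields\<close>

definition derivation :: "('u::field \<Rightarrow> 'u) \<Rightarrow> bool" where
  "derivation \<delta> \<longleftrightarrow>
     (\<forall>x y. \<delta> (x + y) = \<delta> x + \<delta> y) \<and> (\<forall>x y. \<delta> (x * y) = \<delta> x * y + x * \<delta> y)"

text \<open>A differential polynomial in one indeterminate \<open>X\<close> is a polynomial in the variables
  \<open>X, \<delta> X, \<delta>\<^sup>2 X, \<dots>\<close>, numbered by \<open>nat\<close>.\<close>

definition diff_eval :: "('u::field \<Rightarrow> 'u) \<Rightarrow> (nat, 'u) mpoly \<Rightarrow> 'u \<Rightarrow> 'u" where
  "diff_eval \<delta> p x = mpoly_eval id (\<lambda>i. (\<delta> ^^ i) x) p"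

text \<open>Blum's axioms: if \<open>p\<close> has order \<open>n\<close> and \<open>q \<noteq> 0\<close> has order less than \<open>n\<close>, then
  \<open>p = 0 \<noteq> q\<close> has a solution. Elements of the field count as having order \<open>-1\<close>, so the case
  \<open>n = 0\<close> says that the field is algebraically closed.\<close>

definition differentially_closed :: "('u::field_char_0 \<Rightarrow> 'u) \<Rightarrow> bool" where
  "differentially_closed \<delta> \<longleftrightarrow>
     derivation \<delta> \<and>
     (\<forall>n p q. n \<in> mpoly_vars p \<and> mpoly_vars p \<subseteq> {..n} \<and> q \<noteq> 0 \<and> mpoly_vars q \<subseteq> {..<n} \<longrightarrow>
        (\<exists>x. diff_eval \<delta> p x = 0 \<and> diff_eval \<delta> q x \<noteq> 0))"

definition is_subfield :: "'a::field set \<Rightarrow> bool" where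
  "is_subfield K \<longleftrightarrow>
     0 \<in> K \<and> 1 \<in> K \<and>
     (\<forall>x\<in>K. \<forall>y\<in>K. x + y \<in> K \<and> x * y \<in> K) \<and> (\<forall>x\<in>K. - x \<in> K \<and> inverse x \<in> K)"

definition embeds_into_constants ::
    "'a::field set \<Rightarrow> ('a \<Rightarrow> 'u::field) \<Rightarrow> ('u \<Rightarrow> 'u) \<Rightarrow> bool" where
  "embeds_into_constants K \<iota> \<delta> \<longleftrightarrow>
     is_subfield K \<and> \<iota> 1 = 1 \<and>
     (\<forall>x\<in>K. \<forall>y\<in>K. \<iota> (x + y) = \<iota> x + \<iota> y \<and> \<iota> (x * y) = \<iota> x * \<iota> y) \<and>
     (\<forall>x\<in>K. \<delta> (\<iota> x) = 0)"

text \<open>Points of affine \<open>n\<close>-space are lists of length \<open>n\<close>; a point \<open>[x, y]\<close> is evaluated by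
  sending variable \<open>0\<close> to \<open>x\<close> and variable \<open>1\<close> to \<open>y\<close>.\<close>

definition vf_solutions ::
    "(complex \<Rightarrow> 'u::field) \<Rightarrow> (nat, complex) mpoly \<Rightarrow> (nat, complex) mpoly \<Rightarrow>
     ('u \<Rightarrow> 'u) \<Rightarrow> 'u list set" where
  "vf_solutions \<iota> f g \<delta> =
     {[x, y] | x y. \<delta> x = mpoly_eval \<iota> ((!) [x, y]) f \<and> \<delta> y = mpoly_eval \<iota> ((!) [x, y]) g}"


section \<open>First-order formulas in the language of differential rings\<close>

text \<open>Formulas with parameters from \<open>'a\<close>. \<open>fm_params\<close> is the set of parameters occurring in a
  formula, and \<open>map_fm e\<close> replaces every parameter \<open>c\<close> by \<open>e c\<close>.\<close>

datatype (tm_params: 'a) tm =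
    Var nat | Param 'a | TZero | TOne | TNeg "'a tm"
  | TAdd "'a tm" "'a tm" | TMul "'a tm" "'a tm" | TDer "'a tm"
  for map: map_tm

datatype (fm_params: 'a) fm =
    FEq "'a tm" "'a tm" | FNot "'a fm" | FAnd "'a fm" "'a fm" | FEx nat "'a fm"
  for map: map_fm

primrec tm_val :: "('u::field \<Rightarrow> 'u) \<Rightarrow> (nat \<Rightarrow> 'u) \<Rightarrow> 'u tm \<Rightarrow> 'u" where
  "tm_val \<delta> s (Var i) = s i"
| "tm_val \<delta> s (Param c) = c"
| "tm_val \<delta> s TZero = 0"
| "tm_val \<delta> s TOne = 1"
| "tm_val \<delta> s (TNeg t) = - tm_val \<delta> s t"
| "tm_val \<delta> s (TAdd t u) = tm_val \<delta> s t + tm_val \<delta> s u"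
| "tm_val \<delta> s (TMul t u) = tm_val \<delta> s t * tm_val \<delta> s u"
| "tm_val \<delta> s (TDer t) = \<delta> (tm_val \<delta> s t)"

primrec sat :: "('u::field \<Rightarrow> 'u) \<Rightarrow> (nat \<Rightarrow> 'u) \<Rightarrow> 'u fm \<Rightarrow> bool" where
  "sat \<delta> s (FEq t u) \<longleftrightarrow> tm_val \<delta> s t = tm_val \<delta> s u"
| "sat \<delta> s (FNot \<phi>) \<longleftrightarrow> \<not> sat \<delta> s \<phi>"
| "sat \<delta> s (FAnd \<phi> \<psi>) \<longleftrightarrow> sat \<delta> s \<phi> \<and> sat \<delta> s \<psi>"
| "sat \<delta> s (FEx i \<phi>) \<longleftrightarrow> (\<exists>a. sat \<delta> (s(i := a)) \<phi>)"

text \<open>The subset of affine \<open>n\<close>-space defined by \<open>\<phi>\<close>. Free variables with index at least \<open>n\<close>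
  are read as the constant \<open>0\<close>, so they need not be excluded.\<close>

definition defset :: "('u::field \<Rightarrow> 'u) \<Rightarrow> nat \<Rightarrow> 'u fm \<Rightarrow> 'u list set" where
  "defset \<delta> n \<phi> = {xs. length xs = n \<and> sat \<delta> (\<lambda>i. if i < n then xs ! i else 0) \<phi>}"

definition definable_over :: "('u::field \<Rightarrow> 'u) \<Rightarrow> nat \<Rightarrow> 'u set \<Rightarrow> 'u list set \<Rightarrow> bool" where
  "definable_over \<delta> n C X \<longleftrightarrow> (\<exists>\<phi>. fm_params \<phi> \<subseteq> C \<and> X = defset \<delta> n \<phi>)"

text \<open>The \<open>n\<close>-tuples algebraic over \<open>C\<close>.\<close>

definition acl :: "('u::field \<Rightarrow> 'u) \<Rightarrow> nat \<Rightarrow> 'u set \<Rightarrow> 'u list set" where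
  "acl \<delta> n C = \<Union>{X. definable_over \<delta> n C X \<and> finite X}"

definition elementary_embedding ::
    "('u::field \<Rightarrow> 'u) \<Rightarrow> ('w::field \<Rightarrow> 'w) \<Rightarrow> ('u \<Rightarrow> 'w) \<Rightarrow> bool" where
  "elementary_embedding \<delta> \<sigma> e \<longleftrightarrow>
     (\<forall>\<phi> s. sat \<sigma> (e \<circ> s) (map_fm e \<phi>) \<longleftrightarrow> sat \<delta> s \<phi>)"


section \<open>Strong minimality and disintegration\<close>

text \<open>Both notions refer to all elementary extensions. A definition cannot quantify over types,
  so the type \<open>'w\<close> carrying the extension is an argument; a theorem in which \<open>'w\<close> is a type
  variable covers all of them, including the structure itself (\<open>'w = 'u\<close>, \<open>e = id\<close>). The set
  \<open>D\<close> is interpreted in an extension through a formula \<open>\<phi>\<close> defining it; by elementarity the choice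
  of \<open>\<phi>\<close> does not matter.\<close>

definition strongly_minimal ::
    "'w::field itself \<Rightarrow> ('u::field \<Rightarrow> 'u) \<Rightarrow> nat \<Rightarrow> 'u list set \<Rightarrow> bool" where
  "strongly_minimal _ \<delta> n D \<longleftrightarrow>
     (\<exists>\<phi>. D = defset \<delta> n \<phi> \<and>
       (\<forall>(\<sigma> :: 'w \<Rightarrow> 'w) e. elementary_embedding \<delta> \<sigma> e \<longrightarrow>
         (let D' = defset \<sigma> n (map_fm e \<phi>) in
            infinite D' \<and>
            (\<forall>X. X \<subseteq> D' \<and> definable_over \<sigma> n UNIV X \<longrightarrow> finite X \<or> finite (D' - X)))))"

text \<open>\<open>F\<close> is a set of parameters over which \<open>D\<close> is defined. The set \<open>A\<close> must be nonempty:
  otherwise the union on the right is empty, while on the left \<open>acl B\<close> may meet \<open>D\<close>. A point of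
  \<open>A\<close> contributes its coordinates as parameters.\<close>

definition disintegrated ::
    "'w::field itself \<Rightarrow> ('u::field \<Rightarrow> 'u) \<Rightarrow> nat \<Rightarrow> 'u set \<Rightarrow> 'u list set \<Rightarrow> bool" where
  "disintegrated _ \<delta> n F D \<longleftrightarrow>
     (\<exists>\<phi>. fm_params \<phi> \<subseteq> F \<and> D = defset \<delta> n \<phi> \<and>
       (\<forall>(\<sigma> :: 'w \<Rightarrow> 'w) e. elementary_embedding \<delta> \<sigma> e \<longrightarrow>
         (let D' = defset \<sigma> n (map_fm e \<phi>) in
            \<forall>A B. A \<subseteq> D' \<and> A \<noteq> {} \<and> e ` F \<subseteq> B \<longrightarrow>
              acl \<sigma> n ((\<Union>a\<in>A. set a) \<union> B) \<inter> D' = (\<Union>a\<in>A. acl \<sigma> n (set a \<union> B) \<inter> D'))))"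

end

theory Submission
  imports Defs "HOL-Computational_Algebra.Computational_Algebra" "HOL-Computational_Algebra.Field_as_Ring" "HOL-Library.Countable_Set"
begin

text \<open>Write \<open>v\<close> for the vector field, and call a set closed if it is an algebraically closed
  differential subfield containing the coefficients.

  No invariant curves: if \<open>P\<close> divides \<open>v(P)\<close>, then comparing the three leading homogeneous parts of
  \<open>v(P) = h P\<close> along the line at infinity, and differentiating with respect to the (independent)
  coefficients of \<open>v\<close>, shows that \<open>P\<close> is constant. Hence a solution that is not in a closed field \<open>L\<close>
  satisfies no polynomial equation over \<open>L\<close>.

  Disintegration: if a solution \<open>z\<close> is algebraic over \<open>L\<close> and two solutions \<open>a\<close>, \<open>b\<close>, but not over \<open>L, a\<close>
  or \<open>L, b\<close>, then the Jacobian determinants \<open>\<partial>z/\<partial>a\<close> and \<open>\<partial>z/\<partial>b\<close> satisfy Liouville's formula, so their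
  quotient \<open>m\<close> solves \<open>m' = (div v(b) - div v(a)) m\<close>. The constant term of a minimal polynomial of \<open>m\<close>
  over the closure of \<open>L, b\<close> and \<open>a\<close> then yields invariant curves unless \<open>div v\<close> is a constant.

  Model theory: an ultrapower over \<open>\<nat>\<close> is countably saturated, so by Blum's axioms partial differential
  isomorphisms extend back and forth inside it. All solutions outside the closure of a parameter
  set therefore satisfy the same formulas, and such solutions exist.\<close>

section \<open>Derivations\<close>

text \<open>Genericity of the coefficients enters only through derivations: the coefficients can be
  varied independently, so an identity may be differentiated along each of them. Algebraic closure
  is described by derivations too, and everything lives in one ambient field; no tower of extensions
  is built. The first leading term of \<open>v(P) = h P\<close> only says that the zeros of the
  leading form are singular points at infinity, with multiplicities read off \<open>h\<close>. The
  third is the first to contain the coefficients of degree \<open>d - 2\<close>. Varying these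
  leaves the two earlier equations untouched, and this isolates the leading form. A second obstacle
  is that strong minimality concerns an arbitrary elementary extension, which need not be saturated.
  It is embedded as the constants of its own ultrapower. There every solution that is not constant
  is generic over every set of constant parameters, and what holds for a generic solution is read
  off in the original structure index by index.\<close>

definition ring_derivation :: "('a::comm_ring_1 \<Rightarrow> 'a) \<Rightarrow> bool" where
  "ring_derivation D \<longleftrightarrow>
     (\<forall>x y. D (x + y) = D x + D y) \<and> (\<forall>x y. D (x * y) = D x * y + x * D y)"

lemma derivation_iff: "derivation D \<longleftrightarrow> ring_derivation D"
  by (simp add: derivation_def ring_derivation_def)

context
  fixes D :: "'a::comm_ring_1 \<Rightarrow> 'a"
  assumes D: "ring_derivation D"
begin

lemma deriv_add: "D (x + y) = D x + D y"
  using D by (simp add: ring_derivation_def)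

lemma deriv_mult: "D (x * y) = D x * y + x * D y"
  using D by (simp add: ring_derivation_def)

lemma deriv_0: "D 0 = 0"
  using deriv_add[of 0 0] by simp

lemma deriv_1: "D 1 = 0"
  using deriv_mult[of 1 1] by simp

lemma deriv_minus: "D (- x) = - D x"
  using deriv_add[of x "- x"] deriv_0 by (simp add: eq_neg_iff_add_eq_0 add.commute)

lemma deriv_diff: "D (x - y) = D x - D y"
  using deriv_add[of x "- y"] deriv_minus by simp

lemma deriv_sum: "D (\<Sum>i\<in>A. h i) = (\<Sum>i\<in>A. D (h i))"
  by (induction A rule: infinite_finite_induct) (auto simp: deriv_0 deriv_add)

lemma deriv_of_nat: "D (of_nat n) = 0"
  by (induction n) (auto simp: deriv_0 deriv_add deriv_1)

lemma deriv_of_int: "D (of_int n) = 0"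
  by (cases n) (auto simp: deriv_of_nat deriv_diff deriv_minus deriv_1 simp del: of_nat_Suc)

lemma coeff_map_deriv: "coeff (map_poly D p) i = D (coeff p i)"
  by (simp add: coeff_map_poly deriv_0)

lemma map_deriv_pCons: "map_poly D (pCons a p) = pCons (D a) (map_poly D p)"
  by (simp add: map_poly_pCons deriv_0)

lemma degree_map_deriv_le: "degree (map_poly D p) \<le> degree p"
  by (rule degree_le) (simp add: coeff_map_deriv coeff_eq_0 deriv_0)

lemma ring_derivation_map_poly: "ring_derivation (map_poly D)"
  unfolding ring_derivation_def
proof (intro conjI allI)
  fix p q :: "'a poly"
  show "map_poly D (p + q) = map_poly D p + map_poly D q"
    by (rule poly_eqI) (simp add: coeff_map_deriv deriv_add)
  show "map_poly D (p * q) = map_poly D p * q + p * map_poly D q"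
    by (rule poly_eqI) (simp add: coeff_map_deriv coeff_mult deriv_sum deriv_mult sum.distrib)
qed

end

lemma deriv_poly:
  fixes p :: "'a::idom poly"
  assumes "ring_derivation D"
  shows "D (poly p x) = poly (map_poly D p) x + poly (pderiv p) x * D x"
  by (induction p)
     (auto simp: deriv_0[OF assms] deriv_add[OF assms] deriv_mult[OF assms]
        map_deriv_pCons[OF assms] pderiv_pCons algebra_simps)

lemma deriv_inverse:
  fixes x :: "'a::field"
  assumes "ring_derivation D"
  shows "D (inverse x) = - D x * inverse x * inverse x"
proof (cases "x = 0")
  case False
  have "0 = D (x * inverse x)"
    using False by (simp add: deriv_1[OF assms])
  also have "\<dots> = D x * inverse x + x * D (inverse x)"
    by (rule deriv_mult[OF assms])
  finally have "x * D (inverse x) = - D x * inverse x"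
    by (simp add: eq_neg_iff_add_eq_0 add.commute)
  then show ?thesis
    using False by (metis (no_types, lifting) left_inverse mult.assoc mult.commute mult.left_neutral)
qed (simp add: deriv_0[OF assms])

lemma deriv_divide:
  fixes x y :: "'a::field"
  assumes "ring_derivation D" "y \<noteq> 0"
  shows "D (x / y) = (D x * y - x * D y) / (y * y)"
proof -
  have "D (x / y) = D x * inverse y + x * (- D y * inverse y * inverse y)"
    by (simp only: divide_inverse deriv_mult[OF assms(1)] deriv_inverse[OF assms(1)])
  then show ?thesis
    using assms(2) by (simp add: divide_inverse algebra_simps)
qed

lemma ring_derivation_pderiv: "ring_derivation (pderiv :: 'a::idom poly \<Rightarrow> _)"
  by (simp add: ring_derivation_def pderiv_add pderiv_mult algebra_simps)

lemma ring_derivation_lincomb: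
  assumes "ring_derivation D" "ring_derivation E"
  shows "ring_derivation (\<lambda>x. a * D x + b * E x)"
  using assms by (auto simp: ring_derivation_def algebra_simps)

lemma ring_derivation_scale:
  assumes "ring_derivation D"
  shows "ring_derivation (\<lambda>x. a * D x)"
  using assms by (auto simp: ring_derivation_def algebra_simps)

lemma ring_derivation_commutator:
  assumes "ring_derivation D" "ring_derivation E"
  shows "ring_derivation (\<lambda>x. D (E x) - E (D x))"
  using assms by (auto simp: ring_derivation_def algebra_simps)

section \<open>Subrings and pseudo-division\<close>

inductive_set ring_gen :: "'a::comm_ring_1 set \<Rightarrow> 'a set" for S where
  base: "x \<in> S \<Longrightarrow> x \<in> ring_gen S"
| one: "1 \<in> ring_gen S"
| diff: "x \<in> ring_gen S \<Longrightarrow> y \<in> ring_gen S \<Longrightarrow> x - y \<in> ring_gen S"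
| mult: "x \<in> ring_gen S \<Longrightarrow> y \<in> ring_gen S \<Longrightarrow> x * y \<in> ring_gen S"

text \<open>A pair relation is a subring of the product ring; it plays the role of the graph of a
  partial homomorphism.\<close>

definition pair_ring :: "('a::comm_ring_1 \<times> 'b::comm_ring_1) set \<Rightarrow> bool" where
  "pair_ring \<Gamma> \<longleftrightarrow> (1, 1) \<in> \<Gamma> \<and>
     (\<forall>a a' b b'. (a, a') \<in> \<Gamma> \<and> (b, b') \<in> \<Gamma> \<longrightarrow> (a - b, a' - b') \<in> \<Gamma> \<and> (a * b, a' * b') \<in> \<Gamma>)"

text \<open>Because \<open>\<Gamma>\<close> is closed under differences, this one condition makes it
  the graph of an isomorphism between its two projections.\<close>

definition partial_iso :: "('a::comm_ring_1 \<times> 'b::comm_ring_1) set \<Rightarrow> bool" where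
  "partial_iso \<Gamma> \<longleftrightarrow> pair_ring \<Gamma> \<and> (\<forall>a b. (a, b) \<in> \<Gamma> \<longrightarrow> (a = 0 \<longleftrightarrow> b = 0))"

text \<open>With \<open>Id_on R\<close> for \<open>\<Gamma>\<close> this expresses that a polynomial
  has its coefficients in \<open>R\<close>, so the closure lemmas for pairs also serve for
  subrings.\<close>

definition polys_over :: "('a::zero \<times> 'b::zero) set \<Rightarrow> ('a poly \<times> 'b poly) set" where
  "polys_over \<Gamma> = {(p, q). \<forall>i. (coeff p i, coeff q i) \<in> \<Gamma>}"

context
  fixes \<Gamma> :: "('a::comm_ring_1 \<times> 'b::comm_ring_1) set"
  assumes \<Gamma>: "pair_ring \<Gamma>"
begin

lemma pair_one: "(1, 1) \<in> \<Gamma>"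
  using \<Gamma> by (simp add: pair_ring_def)

lemma pair_diff: "(a, a') \<in> \<Gamma> \<Longrightarrow> (b, b') \<in> \<Gamma> \<Longrightarrow> (a - b, a' - b') \<in> \<Gamma>"
  using \<Gamma> by (simp add: pair_ring_def)

lemma pair_mult: "(a, a') \<in> \<Gamma> \<Longrightarrow> (b, b') \<in> \<Gamma> \<Longrightarrow> (a * b, a' * b') \<in> \<Gamma>"
  using \<Gamma> by (simp add: pair_ring_def)

lemma pair_zero: "(0, 0) \<in> \<Gamma>"
  using pair_diff[OF pair_one pair_one] by simp

lemma pair_uminus: "(a, a') \<in> \<Gamma> \<Longrightarrow> (- a, - a') \<in> \<Gamma>"
  using pair_diff[OF pair_zero] by simp

lemma pair_add: "(a, a') \<in> \<Gamma> \<Longrightarrow> (b, b') \<in> \<Gamma> \<Longrightarrow> (a + b, a' + b') \<in> \<Gamma>"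
  using pair_diff[OF _ pair_uminus, of a a' b b'] by simp

lemma pair_sum: "(\<And>i. i \<in> I \<Longrightarrow> (h i, h' i) \<in> \<Gamma>) \<Longrightarrow> (sum h I, sum h' I) \<in> \<Gamma>"
  by (induction I rule: infinite_finite_induct) (auto intro: pair_zero pair_add)

lemma pair_prod: "(\<And>i. i \<in> I \<Longrightarrow> (h i, h' i) \<in> \<Gamma>) \<Longrightarrow> (prod h I, prod h' I) \<in> \<Gamma>"
  by (induction I rule: infinite_finite_induct) (auto intro: pair_one pair_mult)

lemma pair_power: "(a, a') \<in> \<Gamma> \<Longrightarrow> (a ^ n, a' ^ n) \<in> \<Gamma>"
  by (induction n) (auto intro: pair_one pair_mult)

lemma pair_of_nat: "(of_nat n, of_nat n) \<in> \<Gamma>"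
  by (induction n) (auto intro: pair_one pair_add pair_zero)

lemma pair_poly:
  assumes "(p, p') \<in> polys_over \<Gamma>" "(a, a') \<in> \<Gamma>"
  shows "(poly p a, poly p' a') \<in> \<Gamma>"
proof -
  let ?n = "max (degree p) (degree p')"
  have "poly p a = (\<Sum>i\<le>?n. coeff p i * a ^ i)" "poly p' a' = (\<Sum>i\<le>?n. coeff p' i * a' ^ i)"
    unfolding poly_altdef
    by (intro sum.mono_neutral_left; auto simp: coeff_eq_0 not_le)+
  then show ?thesis
    using assms by (auto simp: polys_over_def intro!: pair_sum pair_mult pair_power)
qed

lemma pair_ring_polys_over: "pair_ring (polys_over \<Gamma>)"
  by (auto simp: pair_ring_def polys_over_def coeff_mult coeff_pCons one_pCons
      intro!: pair_sum pair_mult pair_diff pair_one pair_zero split: nat.splits)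

lemma polys_over_const: "(a, a') \<in> \<Gamma> \<Longrightarrow> ([:a:], [:a':]) \<in> polys_over \<Gamma>"
  by (auto simp: polys_over_def coeff_pCons pair_zero split: nat.splits)

lemma polys_over_monom: "(a, a') \<in> \<Gamma> \<Longrightarrow> (monom a n, monom a' n) \<in> polys_over \<Gamma>"
  by (auto simp: polys_over_def pair_zero)

lemma polys_over_smult:
  "(a, a') \<in> \<Gamma> \<Longrightarrow> (p, p') \<in> polys_over \<Gamma> \<Longrightarrow> (smult a p, smult a' p') \<in> polys_over \<Gamma>"
  by (auto simp: polys_over_def intro: pair_mult)

end

lemma polys_over_pderiv:
  fixes \<Gamma> :: "('a::idom \<times> 'b::idom) set"
  assumes "pair_ring \<Gamma>" "(p, p') \<in> polys_over \<Gamma>"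
  shows "(pderiv p, pderiv p') \<in> polys_over \<Gamma>"
  using assms pair_mult[OF assms(1) pair_of_nat[OF assms(1)]]
  by (auto simp: polys_over_def coeff_pderiv simp del: of_nat_Suc)

lemma partial_iso_pair_ring: "partial_iso \<Gamma> \<Longrightarrow> pair_ring \<Gamma>"
  by (simp add: partial_iso_def)

lemma polys_over_degree:
  assumes "partial_iso \<Gamma>" "(p, p') \<in> polys_over \<Gamma>"
  shows "degree p = degree p'"
proof -
  have "coeff p i = 0 \<longleftrightarrow> coeff p' i = 0" for i
    using assms by (auto simp: partial_iso_def polys_over_def)
  then show ?thesis
    by (simp add: degree_def)
qed

lemma polys_over_eq_0_iff:
  assumes "partial_iso \<Gamma>" "(p, p') \<in> polys_over \<Gamma>"
  shows "p = 0 \<longleftrightarrow> p' = 0"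
  using assms by (auto simp: partial_iso_def polys_over_def poly_eq_iff)

text \<open>The coefficients form only a ring, so each step multiplies by the leading coefficient of
  the divisor instead of dividing by it; \<open>l\<close> collects these factors. As
  \<open>\<Gamma>\<close> preserves and reflects zero, degrees agree on both sides and the same
  steps work for \<open>p\<close> and \<open>p'\<close> at once.\<close>

lemma pseudo_division:
  fixes \<Gamma> :: "('a::idom \<times> 'b::idom) set"
  assumes \<Gamma>: "partial_iso \<Gamma>"
    and p: "(p, p') \<in> polys_over \<Gamma>" and b: "(b, b') \<in> polys_over \<Gamma>" and "b \<noteq> 0"
  shows "\<exists>l l' q q' r r'. (l, l') \<in> \<Gamma> \<and> l \<noteq> 0 \<and> (q, q') \<in> polys_over \<Gamma> \<and> (r, r') \<in> polys_over \<Gamma> \<and>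
           smult l p = q * b + r \<and> smult l' p' = q' * b' + r' \<and> (r = 0 \<or> degree r < degree b)"
  using p
proof (induction "degree p" arbitrary: p p' rule: less_induct)
  case less
  note R = partial_iso_pair_ring[OF \<Gamma>]
  note P = pair_ring_polys_over[OF R]
  have deg: "degree p = degree p'" "degree b = degree b'" and "b' \<noteq> 0"
    using polys_over_degree[OF \<Gamma>] polys_over_eq_0_iff[OF \<Gamma> b] less.prems b \<open>b \<noteq> 0\<close> by auto
  show ?case
  proof (cases "p = 0 \<or> degree p < degree b")
    case True
    then show ?thesis
      using less.prems pair_one[OF R] pair_zero[OF P]
      by (intro exI[of _ 1] exI[of _ 0] exI[of _ p] exI[of _ p']) auto
  next
    case False
    define n where "n = degree p - degree b"
    define p1 where "p1 = smult (lead_coeff b) p - monom (lead_coeff p) n * b"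
    define p1' where "p1' = smult (lead_coeff b') p' - monom (lead_coeff p') n * b'"
    have lb: "(lead_coeff b, lead_coeff b') \<in> \<Gamma>" and lp: "(lead_coeff p, lead_coeff p') \<in> \<Gamma>"
      using b less.prems deg by (auto simp: polys_over_def)
    have p1: "(p1, p1') \<in> polys_over \<Gamma>"
      unfolding p1_def p1'_def
      using lb lp less.prems b by (intro pair_diff[OF P] pair_mult[OF P] polys_over_smult[OF R] polys_over_monom[OF R])
    have dp: "degree (monom (lead_coeff p) n * b) = degree p"
      using False \<open>b \<noteq> 0\<close> by (simp add: degree_mult_eq degree_monom_eq n_def monom_eq_0_iff)
    have "coeff p1 (degree p) = 0"
    proof -
      have "coeff (monom (lead_coeff p) n * b) (degree p) = lead_coeff p * lead_coeff b"
        using dp lead_coeff_mult[of "monom (lead_coeff p) n" b] False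
        by (metis degree_monom_eq lead_coeff_monom leading_coeff_0_iff)
      then show ?thesis by (simp add: p1_def)
    qed
    moreover have "degree p1 \<le> degree p"
      unfolding p1_def using dp by (intro degree_diff_le) auto
    ultimately have small: "p1 = 0 \<or> degree p1 < degree p"
      by (metis le_neq_implies_less leading_coeff_0_iff)
    have "\<exists>l l' q q' r r'. (l, l') \<in> \<Gamma> \<and> l \<noteq> 0 \<and> (q, q') \<in> polys_over \<Gamma> \<and> (r, r') \<in> polys_over \<Gamma> \<and>
           smult l p1 = q * b + r \<and> smult l' p1' = q' * b' + r' \<and> (r = 0 \<or> degree r < degree b)"
    proof (cases "p1 = 0")
      case True
      then have "p1' = 0" using polys_over_eq_0_iff[OF \<Gamma> p1] by simp
      with True show ?thesis
        using pair_one[OF R] pair_zero[OF P]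
        by (intro exI[of _ 1] exI[of _ 0]) auto
    next
      case False
      with small less.hyps p1 show ?thesis by blast
    qed
    then obtain l l' q q' r r' where *: "(l, l') \<in> \<Gamma>" "l \<noteq> 0" "(q, q') \<in> polys_over \<Gamma>"
      "(r, r') \<in> polys_over \<Gamma>" "smult l p1 = q * b + r" "smult l' p1' = q' * b' + r'"
      "r = 0 \<or> degree r < degree b" by blast
    let ?q = "q + monom (l * lead_coeff p) n" and ?q' = "q' + monom (l' * lead_coeff p') n"
    have "smult (l * lead_coeff b) p = ?q * b + r"
      using *(5) unfolding p1_def
      by (simp add: smult_diff_right algebra_simps flip: smult_monom)
    moreover have "smult (l' * lead_coeff b') p' = ?q' * b' + r'"
      using *(6) unfolding p1'_def
      by (simp add: smult_diff_right algebra_simps flip: smult_monom)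
    moreover have "(?q, ?q') \<in> polys_over \<Gamma>"
      using * lp by (intro pair_add[OF P] polys_over_monom[OF R] pair_mult[OF R])
    moreover have "(l * lead_coeff b, l' * lead_coeff b') \<in> \<Gamma>"
      using * lb by (intro pair_mult[OF R])
    moreover have "l * lead_coeff b \<noteq> 0"
      using * \<open>b \<noteq> 0\<close> by simp
    ultimately show ?thesis using *(4,7) by blast
  qed
qed


section \<open>Extending derivations\<close>

lemma degree_pos_if_root: "p \<noteq> 0 \<Longrightarrow> poly p x = 0 \<Longrightarrow> 0 < degree p"
  by (rule ccontr) (auto elim: degree_eq_zeroE)

text \<open>Partial derivations as graphs: subrings of the dual numbers \<open>'a[\<epsilon>]\<close>.\<close>

definition dual_ring :: "('a::comm_ring_1 \<times> 'a) set \<Rightarrow> bool" where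
  "dual_ring G \<longleftrightarrow> (1, 0) \<in> G \<and>
     (\<forall>a a' b b'. (a, a') \<in> G \<and> (b, b') \<in> G \<longrightarrow>
        (a - b, a' - b') \<in> G \<and> (a * b, a' * b + a * b') \<in> G)"

context
  fixes G :: "('a::comm_ring_1 \<times> 'a) set"
  assumes G: "dual_ring G"
begin

lemma dual_one: "(1, 0) \<in> G"
  using G by (simp add: dual_ring_def)

lemma dual_diff: "(a, a') \<in> G \<Longrightarrow> (b, b') \<in> G \<Longrightarrow> (a - b, a' - b') \<in> G"
  using G by (simp add: dual_ring_def)

lemma dual_mult: "(a, a') \<in> G \<Longrightarrow> (b, b') \<in> G \<Longrightarrow> (a * b, a' * b + a * b') \<in> G"
  using G by (simp add: dual_ring_def)

lemma dual_zero: "(0, 0) \<in> G"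
  using dual_diff[OF dual_one dual_one] by simp

lemma dual_add: "(a, a') \<in> G \<Longrightarrow> (b, b') \<in> G \<Longrightarrow> (a + b, a' + b') \<in> G"
  using dual_diff[OF _ dual_diff[OF dual_zero], of a a' b b'] by simp

lemma dual_sum: "(\<And>i. i \<in> I \<Longrightarrow> (h i, h' i) \<in> G) \<Longrightarrow> (sum h I, sum h' I) \<in> G"
  by (induction I rule: infinite_finite_induct) (auto intro: dual_zero dual_add)

lemma dual_polys_mult:
  assumes "(p, p') \<in> polys_over G" "(q, q') \<in> polys_over G"
  shows "(p * q, p' * q + p * q') \<in> polys_over G"
proof -
  have "(coeff (p * q) i, coeff (p' * q + p * q') i) \<in> G" for i
    using assms unfolding polys_over_def coeff_add coeff_mult sum.distrib[symmetric]
    by (auto intro!: dual_sum dual_mult)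
  then show ?thesis by (simp add: polys_over_def)
qed

lemma dual_polys_diff:
  assumes "(p, p') \<in> polys_over G" "(q, q') \<in> polys_over G"
  shows "(p - q, p' - q') \<in> polys_over G"
  using assms by (auto simp: polys_over_def intro!: dual_diff)

lemma dual_polys_monom: "(a, a') \<in> G \<Longrightarrow> (monom a n, monom a' n) \<in> polys_over G"
  by (auto simp: polys_over_def dual_zero)

end

text \<open>The value at \<open>t\<close> of the derivative of \<open>p\<close>, where \<open>p'\<close> collects the derivatives of the
  coefficients of \<open>p\<close> and \<open>t\<close> has derivative \<open>u\<close>.\<close>

definition dual_val :: "'a::field \<Rightarrow> 'a \<Rightarrow> 'a poly \<Rightarrow> 'a poly \<Rightarrow> 'a" where
  "dual_val t u p p' = poly p' t + poly (pderiv p) t * u"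

lemma dual_val_mult:
  "dual_val t u (p * q) (p' * q + p * q') = dual_val t u p p' * poly q t + poly p t * dual_val t u q q'"
  by (simp add: dual_val_def pderiv_mult algebra_simps)

lemma dual_val_diff:
  "dual_val t u (p - q) (p' - q') = dual_val t u p p' - dual_val t u q q'"
  by (simp add: dual_val_def pderiv_diff algebra_simps)

text \<open>Cancelling the leading term of \<open>p\<close> against a multiple of \<open>m\<close>
  lowers the degree. By the Leibniz rule the value changes only by the factor
  \<open>lead_coeff m\<close>, since \<open>p\<close> and \<open>m\<close> vanish at
  \<open>t\<close> and the value for \<open>m\<close> is zero.\<close>

lemma dual_val_vanishes:
  fixes m :: "'a::field poly"
  assumes G: "dual_ring G" and functional: "\<And>b. (0, b) \<in> G \<Longrightarrow> b = 0"
    and m: "(m, m') \<in> polys_over G" "m \<noteq> 0" "poly m t = 0" "dual_val t u m m' = 0"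
    and minimal: "\<And>p p'. (p, p') \<in> polys_over G \<Longrightarrow> p \<noteq> 0 \<Longrightarrow> poly p t = 0 \<Longrightarrow> degree m \<le> degree p"
    and p: "(p, p') \<in> polys_over G" "poly p t = 0"
  shows "dual_val t u p p' = 0"
  using p
proof (induction "degree p" arbitrary: p p' rule: less_induct)
  case less
  show ?case
  proof (cases "p = 0")
    case True
    then have "p' = 0"
      using less.prems functional by (auto simp: polys_over_def poly_eq_iff)
    with True show ?thesis by (simp add: dual_val_def)
  next
    case False
    then have deg: "degree m \<le> degree p"
      using minimal less.prems by blast
    define n where "n = degree p - degree m"
    \<comment> \<open>The derivatives of the two leading coefficients are read off \<open>m'\<close>
      and \<open>p'\<close> at the degrees of \<open>m\<close> and \<open>p\<close>; these need not
      be the degrees of \<open>m'\<close> and \<open>p'\<close>.\<close>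
    let ?a = "monom (lead_coeff m) 0" and ?a' = "monom (coeff m' (degree m)) 0"
    let ?b = "monom (lead_coeff p) n" and ?b' = "monom (coeff p' (degree p)) n"
    define q where "q = ?a * p - ?b * m"
    define q' where "q' = (?a' * p + ?a * p') - (?b' * m + ?b * m')"
    have co: "(lead_coeff m, coeff m' (degree m)) \<in> G" "(lead_coeff p, coeff p' (degree p)) \<in> G"
      using m less.prems by (auto simp: polys_over_def)
    have q: "(q, q') \<in> polys_over G"
      unfolding q_def q'_def
      by (intro dual_polys_diff[OF G] dual_polys_mult[OF G] dual_polys_monom[OF G] co m less.prems)
    have val: "dual_val t u q q' = lead_coeff m * dual_val t u p p'"
      unfolding q_def q'_def dual_val_diff dual_val_mult
      using m less.prems by (simp add: poly_monom)
    have "poly q t = 0"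
      using m less.prems by (simp add: q_def)
    have "degree (?b * m) = degree p"
      using False \<open>m \<noteq> 0\<close> deg by (simp add: degree_mult_eq degree_monom_eq n_def monom_eq_0_iff)
    then have "degree q \<le> degree p"
      unfolding q_def by (intro degree_diff_le) (auto simp: monom_0)
    moreover have "coeff q (degree p) = 0"
      using deg by (simp add: q_def monom_0 coeff_monom_mult n_def)
    ultimately have "q = 0 \<or> degree q < degree p"
      by (metis le_neq_implies_less leading_coeff_0_iff)
    then have "dual_val t u q q' = 0"
    proof
      assume "q = 0"
      then have "q' = 0"
        using q functional by (auto simp: polys_over_def poly_eq_iff)
      with \<open>q = 0\<close> show ?thesis by (simp add: dual_val_def)
    qed (use less.hyps q \<open>poly q t = 0\<close> in blast)
    with val \<open>m \<noteq> 0\<close> show ?thesis by simp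
  qed
qed

text \<open>\<open>G'\<close> is \<open>G[t]\<close>. If \<open>t\<close> satisfies a polynomial
  over the domain of \<open>G\<close>, one of least degree forces the value \<open>u\<close>, its
  separant at \<open>t\<close> being nonzero in characteristic zero; otherwise every value is
  admissible and \<open>0\<close> is taken.\<close>

lemma dual_ring_extend_step:
  fixes G :: "('a::field_char_0 \<times> 'a) set"
  assumes G: "dual_ring G" and functional: "\<And>b. (0, b) \<in> G \<Longrightarrow> b = 0"
  shows "\<exists>u G'. dual_ring G' \<and> (\<forall>b. (0, b) \<in> G' \<longrightarrow> b = 0) \<and> G \<subseteq> G' \<and> (t, u) \<in> G'"
proof -
  let ?V = "\<lambda>p p'. (p, p') \<in> polys_over G"
  obtain u where u: "\<And>p p'. ?V p p' \<Longrightarrow> poly p t = 0 \<Longrightarrow> dual_val t u p p' = 0"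
  proof (cases "\<exists>p p'. ?V p p' \<and> p \<noteq> 0 \<and> poly p t = 0")
    case True
    define P where "P = (\<lambda>m. \<exists>m'. ?V m m' \<and> m \<noteq> 0 \<and> poly m t = 0)"
    from True obtain m where "P m" and min: "\<And>p. P p \<Longrightarrow> degree m \<le> degree p"
      using ex_has_least_nat[of P _ degree] unfolding P_def by blast
    then obtain m' where m: "?V m m'" "m \<noteq> 0" "poly m t = 0"
      unfolding P_def by blast
    have "degree m \<noteq> 0"
      using degree_pos_if_root[OF m(2,3)] by simp
    have "poly (pderiv m) t \<noteq> 0"
    proof
      assume "poly (pderiv m) t = 0"
      have pd: "(of_nat k, 0) \<in> G" for k
        by (induction k) (auto intro: dual_zero[OF G] dual_one[OF G] dual_add[OF G, of 1 0 _ 0, simplified])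
      have "?V (pderiv m) (pderiv m')"
        using m(1) dual_mult[OF G pd] by (auto simp: polys_over_def coeff_pderiv simp del: of_nat_Suc)
      moreover have "pderiv m \<noteq> 0"
        using \<open>degree m \<noteq> 0\<close> by (simp add: pderiv_eq_0_iff)
      ultimately have "degree m \<le> degree (pderiv m)"
        using min[of "pderiv m"] \<open>poly (pderiv m) t = 0\<close> unfolding P_def by blast
      with \<open>degree m \<noteq> 0\<close> show False by (simp add: degree_pderiv)
    qed
    then have "dual_val t (- poly m' t / poly (pderiv m) t) m m' = 0"
      by (simp add: dual_val_def)
    then show ?thesis
      using that dual_val_vanishes[OF G functional m] min unfolding P_def by metis
  next
    case False
    have "dual_val t 0 p p' = 0" if p: "?V p p'" "poly p t = 0" for p p'
    proof -
      have "p = 0" using False p by blast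
      moreover from this have "p' = 0"
        using p functional by (auto simp: polys_over_def poly_eq_iff)
      ultimately show ?thesis by (simp add: dual_val_def)
    qed
    then show ?thesis using that by blast
  qed
  define G' where "G' = {(poly p t, dual_val t u p p') | p p'. ?V p p'}"
  have const: "(a, a') \<in> G \<Longrightarrow> ?V [:a:] [:a':]" for a a'
    using dual_polys_monom[OF G, of a a' 0] by (simp add: monom_0)
  have "(t, u) \<in> G'"
    using dual_polys_monom[OF G dual_one[OF G], of 1]
    by (force simp: G'_def dual_val_def poly_monom pderiv_monom)
  moreover have "G \<subseteq> G'"
    using const by (force simp: G'_def dual_val_def pderiv_pCons)
  moreover have "dual_ring G'"
    unfolding dual_ring_def
  proof (intro conjI allI impI; (elim conjE)?)
    show "(1, 0) \<in> G'"
      using \<open>G \<subseteq> G'\<close> dual_one[OF G] by blast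
    fix a a' b b' assume "(a, a') \<in> G'" "(b, b') \<in> G'"
    then obtain p p' q q' where *: "?V p p'" "?V q q'" "a = poly p t" "b = poly q t"
      "a' = dual_val t u p p'" "b' = dual_val t u q q'"
      unfolding G'_def by blast
    have "(poly (p - q) t, dual_val t u (p - q) (p' - q')) \<in> G'"
      unfolding G'_def using dual_polys_diff[OF G *(1,2)] by blast
    then show "(a - b, a' - b') \<in> G'"
      by (simp add: * dual_val_diff)
    have "(poly (p * q) t, dual_val t u (p * q) (p' * q + p * q')) \<in> G'"
      unfolding G'_def using dual_polys_mult[OF G *(1,2)] by blast
    then show "(a * b, a' * b + a * b') \<in> G'"
      by (simp add: * dual_val_mult)
  qed
  moreover have "\<forall>b. (0, b) \<in> G' \<longrightarrow> b = 0"
    using u by (auto simp: G'_def)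
  ultimately show ?thesis by blast
qed

text \<open>A maximal functional dual ring, supplied by Zorn's lemma, is total because any missing
  element could still be adjoined.\<close>

theorem extend_derivation:
  fixes G :: "('a::field_char_0 \<times> 'a) set"
  assumes G: "dual_ring G" and functional: "\<And>b. (0, b) \<in> G \<Longrightarrow> b = 0"
  obtains D where "ring_derivation D" "\<And>a b. (a, b) \<in> G \<Longrightarrow> D a = b"
proof -
  define \<G> where "\<G> = {H. dual_ring H \<and> (\<forall>b. (0, b) \<in> H \<longrightarrow> b = 0) \<and> G \<subseteq> H}"
  have "\<exists>M\<in>\<G>. \<forall>X\<in>\<G>. M \<subseteq> X \<longrightarrow> X = M"
  proof (rule subset_Zorn_nonempty)
    show "\<G> \<noteq> {}" using assms by (auto simp: \<G>_def)
    fix C assume "C \<noteq> {}" and C: "subset.chain \<G> C"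
    then have in\<G>: "\<And>H. H \<in> C \<Longrightarrow> H \<in> \<G>" and
      tot: "\<And>H H'. H \<in> C \<Longrightarrow> H' \<in> C \<Longrightarrow> H \<subseteq> H' \<or> H' \<subseteq> H"
      by (auto simp: subset.chain_def)
    have two: "\<exists>H\<in>C. x \<in> H \<and> y \<in> H" if "x \<in> \<Union>C" "y \<in> \<Union>C" for x y
      using that tot by blast
    have "dual_ring (\<Union>C)"
      unfolding dual_ring_def
    proof (intro conjI allI impI; (elim conjE)?)
      show "(1, 0) \<in> \<Union>C"
        using \<open>C \<noteq> {}\<close> in\<G> by (auto simp: \<G>_def dual_ring_def)
      fix a a' b b' assume "(a, a') \<in> \<Union>C" "(b, b') \<in> \<Union>C"
      then obtain H where "H \<in> C" "(a, a') \<in> H" "(b, b') \<in> H" using two by blast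
      moreover have "dual_ring H" using in\<G> \<open>H \<in> C\<close> by (simp add: \<G>_def)
      ultimately show "(a - b, a' - b') \<in> \<Union>C" "(a * b, a' * b + a * b') \<in> \<Union>C"
        using dual_diff dual_mult by blast+
    qed
    moreover have "\<forall>b. (0, b) \<in> \<Union>C \<longrightarrow> b = 0"
      using in\<G> by (auto simp: \<G>_def)
    moreover have "G \<subseteq> \<Union>C"
      using \<open>C \<noteq> {}\<close> in\<G> by (auto simp: \<G>_def)
    ultimately show "\<Union>C \<in> \<G>" by (simp add: \<G>_def)
  qed
  then obtain M where M: "dual_ring M" "\<And>b. (0, b) \<in> M \<Longrightarrow> b = 0" "G \<subseteq> M"
    and max: "\<And>X. X \<in> \<G> \<Longrightarrow> M \<subseteq> X \<Longrightarrow> X = M"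
    by (auto simp: \<G>_def)
  have total: "\<exists>u. (t, u) \<in> M" for t
  proof -
    obtain u G' where "dual_ring G'" "\<forall>b. (0, b) \<in> G' \<longrightarrow> b = 0" "M \<subseteq> G'" "(t, u) \<in> G'"
      using dual_ring_extend_step[OF M(1,2)] by blast
    then show ?thesis
      using max[of G'] M(3) by (auto simp: \<G>_def)
  qed
  have unique: "u = u'" if "(t, u) \<in> M" "(t, u') \<in> M" for t u u'
    using dual_diff[OF M(1) that] M(2)[of "u - u'"] by simp
  obtain D where D: "\<And>t. (t, D t) \<in> M"
    using total by metis
  have "ring_derivation D"
    unfolding ring_derivation_def
    by (intro conjI allI; rule unique[OF D]) (intro dual_add[OF M(1)] dual_mult[OF M(1)] D)+
  moreover have "D a = b" if "(a, b) \<in> G" for a b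
    by (rule unique[OF D]) (use that M(3) in blast)
  ultimately show ?thesis by (rule that)
qed

section \<open>Algebraic closure through derivations\<close>

text \<open>In characteristic zero, the elements killed by every derivation that kills \<open>S\<close> are exactly
  those algebraic over the field generated by \<open>S\<close>.\<close>

definition alg_closure :: "'a::field_char_0 set \<Rightarrow> 'a set" where
  "alg_closure S = {x. \<forall>D. ring_derivation D \<and> (\<forall>s\<in>S. D s = 0) \<longrightarrow> D x = 0}"

lemma alg_closureD: "x \<in> alg_closure S \<Longrightarrow> ring_derivation D \<Longrightarrow> (\<And>s. s \<in> S \<Longrightarrow> D s = 0) \<Longrightarrow> D x = 0"
  by (simp add: alg_closure_def)

lemma alg_closure_base: "S \<subseteq> alg_closure S"
  by (auto simp: alg_closure_def)

lemma alg_closure_mono: "S \<subseteq> T \<Longrightarrow> alg_closure S \<subseteq> alg_closure T"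
  by (auto simp: alg_closure_def)

lemma alg_closure_least: "S \<subseteq> alg_closure T \<Longrightarrow> alg_closure S \<subseteq> alg_closure T"
  unfolding alg_closure_def by blast

lemma alg_closure_idem: "alg_closure (alg_closure S) = alg_closure S"
  by (rule subset_antisym[OF alg_closure_least alg_closure_base]) simp

lemma alg_closureI:
  "(\<And>D. ring_derivation D \<Longrightarrow> (\<And>s. s \<in> S \<Longrightarrow> D s = 0) \<Longrightarrow> D x = 0) \<Longrightarrow> x \<in> alg_closure S"
  by (simp add: alg_closure_def)

lemma alg_closure_0: "0 \<in> alg_closure S"
  by (rule alg_closureI) (rule deriv_0)

lemma alg_closure_1: "1 \<in> alg_closure S"
  by (rule alg_closureI) (rule deriv_1)

lemma
  assumes "x \<in> alg_closure S" "y \<in> alg_closure S"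
  shows alg_closure_diff: "x - y \<in> alg_closure S"
    and alg_closure_mult: "x * y \<in> alg_closure S"
    and alg_closure_divide: "x / y \<in> alg_closure S"
proof -
  have *: "D (x - y) = 0 \<and> D (x * y) = 0 \<and> D (x / y) = 0"
    if D: "ring_derivation D" "\<And>s. s \<in> S \<Longrightarrow> D s = 0" for D
    using alg_closureD[OF assms(1) D] alg_closureD[OF assms(2) D]
    by (cases "y = 0")
      (simp_all add: deriv_0[OF D(1)] deriv_diff[OF D(1)] deriv_mult[OF D(1)]
        deriv_divide[OF D(1)])
  show "x - y \<in> alg_closure S" "x * y \<in> alg_closure S" "x / y \<in> alg_closure S"
    by (rule alg_closureI; use * in blast)+
qed

lemma deriv_eq_on_alg_closure:
  assumes "ring_derivation D" "ring_derivation E" "\<And>s. s \<in> S \<Longrightarrow> D s = E s" "x \<in> alg_closure S"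
  shows "D x = E x"
  using alg_closureD[OF assms(4) ring_derivation_lincomb[OF assms(1,2), of 1 "- 1"]] assms(3) by simp

text \<open>For a polynomial \<open>m\<close> of least degree over the closure, applying a
  derivation that kills \<open>S\<close> to \<open>poly m x = 0\<close> leaves
  \<open>poly (pderiv m) x * D x = 0\<close>, and the first factor is nonzero by minimality.\<close>

lemma alg_closure_root:
  assumes p: "\<And>i. coeff p i \<in> alg_closure S" "p \<noteq> 0" "poly p x = 0"
  shows "x \<in> alg_closure S"
proof -
  let ?P = "\<lambda>p. (\<forall>i. coeff p i \<in> alg_closure S) \<and> p \<noteq> 0 \<and> poly p x = 0"
  have "?P p" using p by blast
  then obtain m where m: "\<And>i. coeff m i \<in> alg_closure S" "m \<noteq> 0" "poly m x = 0"
    and min: "\<And>q. ?P q \<Longrightarrow> degree m \<le> degree q"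
    using ex_has_least_nat[of ?P p degree] by blast
  have "degree m \<noteq> 0"
    using degree_pos_if_root[OF m(2,3)] by simp
  have of_nat: "of_nat k \<in> alg_closure S" for k
    unfolding alg_closure_def using deriv_of_nat by blast
  have "poly (pderiv m) x \<noteq> 0"
  proof
    assume "poly (pderiv m) x = 0"
    then have "?P (pderiv m)"
      using m \<open>degree m \<noteq> 0\<close> alg_closure_mult[OF of_nat m(1)]
      by (auto simp: coeff_pderiv pderiv_eq_0_iff simp del: of_nat_Suc)
    from min[OF this] \<open>degree m \<noteq> 0\<close> show False by (simp add: degree_pderiv)
  qed
  moreover have "poly (pderiv m) x * D x = 0" if D: "ring_derivation D" "\<forall>s\<in>S. D s = 0" for D
  proof -
    have "map_poly D m = 0"
      using m(1) D by (auto simp: poly_eq_iff coeff_map_deriv alg_closure_def)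
    then show ?thesis
      using deriv_poly[OF D(1), of m x] m(3) by (simp add: deriv_0[OF D(1)])
  qed
  ultimately show ?thesis by (auto simp: alg_closure_def)
qed

lemma pair_ring_Id_on_ring_gen: "pair_ring (Id_on (ring_gen S))"
  by (auto simp: pair_ring_def intro: ring_gen.intros)

lemma Id_on_polys_over: "(p, q) \<in> polys_over (Id_on R) \<longleftrightarrow> p = q \<and> (\<forall>i. coeff p i \<in> R)"
  by (auto simp: polys_over_def Id_on_def poly_eq_iff)

text \<open>If \<open>x\<close> were transcendental over \<open>ring_gen S\<close>, formal
  differentiation \<open>p(x) \<mapsto> p'(x)\<close> would be well defined, and its extension to
  the whole field would kill \<open>S\<close> but not \<open>x\<close>.\<close>

lemma alg_closure_imp_algebraic:
  assumes "x \<in> alg_closure S"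
  obtains p where "p \<noteq> 0" "\<And>i. coeff p i \<in> ring_gen S" "poly p x = 0"
proof (rule ccontr)
  assume "\<not> thesis"
  with that have tr: "p = 0" if "\<And>i. coeff p i \<in> ring_gen S" "poly p x = 0" for p
    using that by blast
  let ?V = "\<lambda>p. \<forall>i. coeff p i \<in> ring_gen S"
  note R = pair_ring_polys_over[OF pair_ring_Id_on_ring_gen[of S]]
  define G where "G = {(poly p x, poly (pderiv p) x) | p. ?V p}"
  have V: "?V (p - q)" "?V (p * q)" if "?V p" "?V q" for p q
    using pair_diff[OF R, of p p q q] pair_mult[OF R, of p p q q] that
    unfolding Id_on_polys_over by auto
  have V1: "?V 1"
    using pair_one[OF R] unfolding Id_on_polys_over by auto
  have "dual_ring G"
    unfolding dual_ring_def
  proof (intro conjI allI impI; (elim conjE)?)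
    show "(1, 0) \<in> G"
      unfolding G_def using V1 by (auto intro!: exI[of _ 1])
    fix a a' b b' assume "(a, a') \<in> G" "(b, b') \<in> G"
    then obtain p q where *: "?V p" "?V q" "a = poly p x" "a' = poly (pderiv p) x"
      "b = poly q x" "b' = poly (pderiv q) x" unfolding G_def by blast
    show "(a - b, a' - b') \<in> G"
      unfolding G_def using * V(1)[OF *(1,2)] by (auto intro!: exI[of _ "p - q"] simp: pderiv_diff)
    show "(a * b, a' * b + a * b') \<in> G"
      unfolding G_def using * V(2)[OF *(1,2)]
      by (auto intro!: exI[of _ "p * q"] simp: pderiv_mult algebra_simps)
  qed
  moreover have "b = 0" if "(0, b) \<in> G" for b
    using that tr unfolding G_def by force
  ultimately obtain D where D: "ring_derivation D" "\<And>a b. (a, b) \<in> G \<Longrightarrow> D a = b"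
    using extend_derivation by blast
  have "(s, 0) \<in> G" if "s \<in> S" for s
  proof -
    have "?V [:s:]"
      using that polys_over_const[OF pair_ring_Id_on_ring_gen, of s s S]
      unfolding Id_on_polys_over by (auto intro: ring_gen.base)
    then show ?thesis
      unfolding G_def by (auto intro!: exI[of _ "[:s:]"] simp: pderiv_pCons)
  qed
  then have "D x = 0"
    using alg_closureD[OF assms D(1)] D(2) by blast
  moreover have "(x, 1) \<in> G"
  proof -
    have "?V [:0, 1:]"
      using polys_over_monom[OF pair_ring_Id_on_ring_gen, of 1 1 S 1]
      unfolding Id_on_polys_over by (simp add: monom_altdef Id_on_def ring_gen.one)
    then show ?thesis
      unfolding G_def by (auto intro!: exI[of _ "[:0, 1:]"] simp: pderiv_pCons)
  qed
  ultimately show False using D(2) by fastforce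
qed

text \<open>For \<open>D\<close> killing \<open>S\<close>, the commutator of \<open>D\<close> and
  \<open>\<delta>\<close> is a derivation that kills \<open>S\<close> as well, hence
  \<open>x\<close>; since \<open>D x = 0\<close>, only \<open>D (\<delta> x)\<close> is left of it
  at \<open>x\<close>.\<close>

lemma alg_closure_deriv_closed:
  assumes \<delta>: "ring_derivation \<delta>" and S: "\<And>s. s \<in> S \<Longrightarrow> \<delta> s \<in> alg_closure S" and x: "x \<in> alg_closure S"
  shows "\<delta> x \<in> alg_closure S"
  unfolding alg_closure_def
proof (intro CollectI allI impI)
  fix D assume D: "ring_derivation D \<and> (\<forall>s\<in>S. D s = 0)"
  have "D (\<delta> x) - \<delta> (D x) = 0"
  proof (rule alg_closureD[OF x])
    show "ring_derivation (\<lambda>x. D (\<delta> x) - \<delta> (D x))"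
      using ring_derivation_commutator \<delta> D by blast
    show "D (\<delta> s) - \<delta> (D s) = 0" if "s \<in> S" for s
      using D S[OF that] that by (simp add: alg_closure_def deriv_0[OF \<delta>])
  qed
  moreover have "D x = 0" using alg_closureD[OF x] D by blast
  ultimately show "D (\<delta> x) = 0" by (simp add: deriv_0[OF \<delta>])
qed


section \<open>The three leading terms of an invariant curve\<close>

text \<open>A predicate on the type, because for the ultrapower it is derived from a hypothesis on a
  derivation and so cannot be a class instance.\<close>

definition alg_closed :: "'a::field itself \<Rightarrow> bool" where
  "alg_closed _ \<longleftrightarrow> (\<forall>p :: 'a poly. 0 < degree p \<longrightarrow> (\<exists>x. poly p x = 0))"

lemma alg_closedD: "alg_closed TYPE('a::field) \<Longrightarrow> 0 < degree p \<Longrightarrow> \<exists>x::'a. poly p x = 0"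
  unfolding alg_closed_def by blast

lemma linear_poly:
  fixes r :: "'a::idom"
  assumes "L = [:- r, 1:]"
  shows "pderiv L = 1" "poly L x = x - r" "degree L = 1" "L \<noteq> 0"
  by (auto simp: assms pderiv_pCons)

lemma poly_pderiv_root:
  fixes v :: "'a::idom poly"
  assumes "w = [:- r, 1:] * v"
  shows "poly (pderiv w) r = poly v r"
  using linear_poly[OF refl, of r] unfolding assms pderiv_mult by simp

lemma root_factor:
  fixes r :: "'a::idom"
  assumes "poly w r = 0"
  shows "\<exists>v. w = [:- r, 1:] * v"
  using assms unfolding poly_eq_0_iff_dvd dvd_def .

lemma pderiv_linear_power:
  fixes r :: "'a::idom"
  assumes "L = [:- r, 1:]"
  shows "L * pderiv (L ^ m) = smult (of_nat m) (L ^ m)"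
proof (cases m)
  case (Suc k)
  then show ?thesis
    unfolding Suc pderiv_power_Suc linear_poly(1)[OF assms] by simp
qed simp

text \<open>An indicial equation. On a polynomial starting with \<open>(X - r)^k\<close>, the
  operator \<open>y \<mapsto> w y' - B y\<close> multiplies the lowest coefficient by
  \<open>k w'(r) - B(r)\<close>. As long as this is nonzero, divisibility of the image by one more
  power of \<open>X - r\<close> forces divisibility of \<open>y\<close>.\<close>

lemma linear_power_dvd_nonresonant:
  fixes w :: "'a::field_char_0 poly"
  assumes dvd: "[:- r, 1:] ^ m dvd w * pderiv y - B * y" and w: "poly w r = 0"
    and nonres: "\<And>k. k < m \<Longrightarrow> of_nat k * poly (pderiv w) r \<noteq> poly B r"
  shows "[:- r, 1:] ^ m dvd y"
proof -
  define L where "L = [:- r, 1:]"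
  note L = linear_poly[OF L_def]
  obtain v where v: "w = L * v" using w root_factor unfolding L_def by blast
  have v': "poly (pderiv w) r = poly v r"
    using v unfolding L_def by (rule poly_pderiv_root)
  have "L ^ k dvd y" if "k \<le> m" for k
    using that
  proof (induction k)
    case (Suc k)
    then obtain x where x: "y = L ^ k * x" by (auto simp: dvd_def)
    have "w * pderiv y = v * x * (L * pderiv (L ^ k)) + L ^ k * (L * v * pderiv x)"
      by (simp add: x v pderiv_mult algebra_simps)
    then have eq: "w * pderiv y - B * y = L ^ k * (smult (of_nat k) (v * x) + L * v * pderiv x - B * x)"
      by (simp add: pderiv_linear_power[OF L_def] x algebra_simps smult_add_right)
    have "L ^ Suc k dvd w * pderiv y - B * y"
      using Suc.prems dvd unfolding L_def by (meson dvd_trans le_imp_power_dvd)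
    then have "L dvd smult (of_nat k) (v * x) + L * v * pderiv x - B * x"
      unfolding eq power_Suc2 using L(4) by (simp only: dvd_mult_cancel_left) simp
    then have "poly (smult (of_nat k) (v * x) + L * v * pderiv x - B * x) r = 0"
      unfolding L_def by (simp only: poly_eq_0_iff_dvd)
    then have "(of_nat k * poly v r - poly B r) * poly x r = 0"
      by (simp add: L algebra_simps)
    then have "poly x r = 0"
      using nonres[of k] Suc.prems by (simp add: v')
    then have "L dvd x" by (simp add: L_def poly_eq_0_iff_dvd)
    then show ?case
      unfolding x power_Suc2 by (rule mult_dvd_mono[OF dvd_refl])
  qed simp
  then show ?thesis unfolding L_def by blast
qed

text \<open>Over an algebraically closed field \<open>p\<close> is a product of powers of distinct
  linear factors up to a constant; each power divides \<open>y\<close> by the local statement, and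
  one root is stripped off at a time.\<close>

lemma dvd_nonresonant:
  fixes p :: "'a::field_char_0 poly"
  assumes ac: "alg_closed TYPE('a)" and "p \<noteq> 0" and "p dvd w * pderiv y - B * y"
    and "\<And>r. poly p r = 0 \<Longrightarrow> poly w r = 0"
    and "\<And>r k. poly p r = 0 \<Longrightarrow> k < order r p \<Longrightarrow> of_nat k * poly (pderiv w) r \<noteq> poly B r"
  shows "p dvd y"
  using assms(2-)
proof (induction "degree p" arbitrary: p rule: less_induct)
  case less
  show ?case
  proof (cases "degree p = 0")
    case True
    then obtain c where "p = [:c:]" by (rule degree_eq_zeroE)
    with \<open>p \<noteq> 0\<close> have "is_unit p" by (simp add: is_unit_triv)
    then show ?thesis by (rule unit_imp_dvd)
  next
    case False
    then obtain r where r: "poly p r = 0" using alg_closedD[OF ac] by blast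
    obtain q where q: "p = [:- r, 1:] ^ order r p * q" "\<not> [:- r, 1:] dvd q"
      using order_decomp[OF \<open>p \<noteq> 0\<close>] by blast
    define m where "m = order r p"
    have "m \<noteq> 0" using r \<open>p \<noteq> 0\<close> by (simp add: m_def order_root)
    have "q \<noteq> 0" using q(2) by auto
    have deg: "degree p = m + degree q"
      using \<open>q \<noteq> 0\<close> by (subst q(1)) (simp add: m_def degree_mult_eq degree_power_eq)
    have "q dvd p" by (subst q(1)) simp
    have "q dvd y"
    proof (rule less.hyps)
      show "q dvd w * pderiv y - B * y" using \<open>q dvd p\<close> less.prems(2) dvd_trans by blast
      show "poly w x = 0" if "poly q x = 0" for x
        using less.prems(3)[of x] \<open>q dvd p\<close> that by (auto simp: dvd_def)
      show "of_nat k * poly (pderiv w) x \<noteq> poly B x" if "poly q x = 0" "k < order x q" for x k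
      proof (rule less.prems(4))
        show "poly p x = 0" using that(1) \<open>q dvd p\<close> by (auto simp: dvd_def)
        show "k < order x p" using that(2) dvd_imp_order_le[OF \<open>p \<noteq> 0\<close> \<open>q dvd p\<close>, of x] by simp
      qed
    qed (use \<open>m \<noteq> 0\<close> \<open>q \<noteq> 0\<close> deg in simp_all)
    then obtain z where z: "y = q * z" by (auto simp: dvd_def)
    have "[:- r, 1:] ^ m dvd p" unfolding m_def by (rule order_1)
    then have "[:- r, 1:] ^ m dvd w * pderiv y - B * y"
      using less.prems(2) by (rule dvd_trans)
    then have m: "[:- r, 1:] ^ m dvd y"
      using less.prems(3)[OF r] less.prems(4)[OF r]
      by (rule linear_power_dvd_nonresonant) (simp add: m_def)
    have "[:- r, 1:] ^ m dvd z"
    proof (cases "y = 0")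
      case True
      with z \<open>q \<noteq> 0\<close> show ?thesis by simp
    next
      case False
      then have "order r y = order r q + order r z"
        using z by (simp add: order_mult)
      moreover have "order r q = 0"
        using q(2) by (simp add: order_0I poly_eq_0_iff_dvd)
      moreover have "m \<le> order r y"
        using m False by (simp add: order_divides)
      ultimately show ?thesis by (simp add: order_divides)
    qed
    then show ?thesis
      unfolding z by (subst q(1), subst mult.commute) (simp add: m_def mult_dvd_mono)
  qed
qed

text \<open>The case \<open>w = 0\<close> of the preceding lemma: the operator is multiplication by
  \<open>- B\<close>, and nonresonance means that \<open>B\<close> does not vanish at the roots of
  \<open>p\<close>.\<close>

lemma dvd_coprime_roots:
  fixes p :: "'a::field_char_0 poly"
  assumes "alg_closed TYPE('a)" "p \<noteq> 0" "p dvd B * y" "\<And>r. poly p r = 0 \<Longrightarrow> poly B r \<noteq> 0"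
  shows "p dvd y"
  using assms by (auto intro: dvd_nonresonant[OF assms(1,2), where w = 0 and B = B])

text \<open>If \<open>w p' = R p\<close> then every root of \<open>p\<close> is a root of \<open>w\<close>, and its order is read off \<open>R\<close>.\<close>

lemma log_derivative_at_root:
  fixes p :: "'a::field_char_0 poly"
  assumes eq: "w * pderiv p = R * p" and "p \<noteq> 0" "poly p r = 0"
  shows "poly w r = 0" "poly R r = of_nat (order r p) * poly (pderiv w) r"
proof -
  define L where "L = [:- r, 1:]"
  note L = linear_poly[OF L_def]
  define m where "m = order r p"
  obtain q where q: "p = L ^ m * q" "\<not> L dvd q"
    using order_decomp[OF \<open>p \<noteq> 0\<close>] unfolding L_def m_def by blast
  have qr: "poly q r \<noteq> 0" using q(2) by (simp add: L_def poly_eq_0_iff_dvd)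
  have "m \<noteq> 0" using assms(2,3) by (simp add: m_def order_root)
  have "L * pderiv p = q * (L * pderiv (L ^ m)) + L ^ m * (L * pderiv q)"
    by (simp add: q(1) pderiv_mult algebra_simps)
  also have "\<dots> = L ^ m * (smult (of_nat m) q + L * pderiv q)"
    by (simp add: pderiv_linear_power[OF L_def] algebra_simps)
  finally have Lp: "L * pderiv p = L ^ m * (smult (of_nat m) q + L * pderiv q)" .
  have "L ^ m * (w * (smult (of_nat m) q + L * pderiv q)) = w * (L * pderiv p)"
    unfolding Lp by (simp only: mult_ac)
  also have "\<dots> = L ^ m * (R * L * q)"
    using eq by (simp add: q(1) mult_ac)
  finally have eq2: "w * (smult (of_nat m) q + L * pderiv q) = R * L * q"
    using L(4) by (subst (asm) mult_cancel_left) simp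
  from arg_cong[OF this, of "\<lambda>s. poly s r"] qr \<open>m \<noteq> 0\<close> show "poly w r = 0"
    by (simp add: L)
  then obtain v where v: "w = L * v" using root_factor unfolding L_def by blast
  have v': "poly (pderiv w) r = poly v r"
    using v unfolding L_def by (rule poly_pderiv_root)
  have "L * (v * (smult (of_nat m) q + L * pderiv q)) = L * (R * q)"
    using eq2 by (simp only: v mult_ac)
  then have "v * (smult (of_nat m) q + L * pderiv q) = R * q"
    using L(4) by (subst (asm) mult_cancel_left) simp
  from arg_cong[OF this, of "\<lambda>s. poly s r"] qr
  show "poly R r = of_nat (order r p) * poly (pderiv w) r"
    by (simp add: v' L m_def[symmetric] mult.commute)
qed

lemma map_deriv_pderiv:
  assumes "ring_derivation D"
  shows "map_poly D (pderiv p) = pderiv (map_poly D (p :: 'a::field_char_0 poly))"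
  by (rule poly_eqI)
    (simp add: coeff_map_deriv[OF assms] coeff_pderiv deriv_mult[OF assms] deriv_of_nat[OF assms] del: of_nat_Suc)

text \<open>\<open>p\<close> is a constant \<open>c\<close> times a product of factors
  \<open>X - r\<close> with \<open>D r = 0\<close>, so only \<open>c\<close> contributes and
  \<open>\<beta>\<close> is \<open>D c / c\<close>.\<close>

lemma map_deriv_killed_roots:
  fixes p :: "'a::field_char_0 poly"
  assumes ac: "alg_closed TYPE('a)" and D: "ring_derivation D"
    and "p \<noteq> 0" "\<And>r. poly p r = 0 \<Longrightarrow> D r = 0"
  shows "\<exists>\<beta>. map_poly D p = smult \<beta> p"
  using assms(3-)
proof (induction "degree p" arbitrary: p rule: less_induct)
  case less
  show ?case
  proof (cases "degree p = 0")
    case True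
    then obtain c where c: "p = [:c:]" by (rule degree_eq_zeroE)
    with \<open>p \<noteq> 0\<close> show ?thesis
      by (intro exI[of _ "D c / c"]) (simp add: map_deriv_pCons[OF D])
  next
    case False
    then obtain r where r: "poly p r = 0" using alg_closedD[OF ac] by blast
    then obtain q where q: "p = [:- r, 1:] * q" using root_factor by blast
    then have "q \<noteq> 0" using \<open>p \<noteq> 0\<close> by auto
    then have "degree q < degree p"
      unfolding q by (subst degree_mult_eq) auto
    then obtain \<beta> where \<beta>: "map_poly D q = smult \<beta> q"
      using less.hyps[of q] less.prems(2) \<open>q \<noteq> 0\<close> unfolding q poly_mult by auto
    have "map_poly D [:- r, 1:] = 0"
      using less.prems(2)[OF r] by (simp add: map_deriv_pCons[OF D] deriv_minus[OF D] deriv_1[OF D])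
    then have "map_poly D p = smult \<beta> p"
      unfolding q deriv_mult[OF ring_derivation_map_poly[OF D]] \<beta> by simp
    then show ?thesis ..
  qed
qed


text \<open>The equations \<open>E0\<close>--\<open>E2\<close> are the three leading homogeneous parts of
  \<open>\<delta>(P) + f P\<^sub>x + g P\<^sub>y = h P\<close>, read in the chart \<open>t = y/x\<close> at infinity: \<open>p\<close>, \<open>p1\<close>, \<open>p2\<close> are the
  leading parts of \<open>P\<close>, and \<open>fi\<close>, \<open>gi\<close>, \<open>Ti\<close> those of \<open>f\<close>, \<open>g\<close>, \<open>h\<close>. The zeros of \<open>w\<close> are the
  singular points at infinity. Nonresonance there forces \<open>p1/p\<close> and \<open>p2/p\<close> to have poles of order at
  most one and two, so they are determined by the coefficients; differentiating with
  respect to the coefficients of \<open>q2\<close> then determines \<open>R = w p'/p\<close> up to a constant.\<close>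

lemma no_leading_terms:
  fixes f0 f1 f2 g0 g1 g2 p p1 p2 T0 T1 T2 :: "'a::field_char_0 poly"
  assumes ac: "alg_closed TYPE('a)"
    and "2 \<le> d" "1 \<le> n" "p \<noteq> 0"
    and deg_f0: "degree f0 \<le> d" and deg_g0: "degree g0 \<le> d"
    and lead: "coeff f0 d \<noteq> 0"
    and deg_p: "degree p \<le> n" and deg_p1: "p1 = 0 \<or> degree p1 + 1 \<le> n"
    and deg_p2: "p2 = 0 \<or> degree p2 + 2 \<le> n" and deg_T0: "degree T0 < d"
    and w: "w = g0 - [:0, 1:] * f0" and q1: "q1 = g1 - [:0, 1:] * f1" and q2: "q2 = g2 - [:0, 1:] * f2"
    and nonres: "\<And>r a b. poly w r = 0 \<Longrightarrow> of_int a * poly f0 r = of_int b * poly (pderiv w) r \<Longrightarrow> a = 0"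
    and simple: "\<And>r. poly w r = 0 \<Longrightarrow> poly (pderiv w) r \<noteq> 0"
    and ders: "\<And>k. k < d \<Longrightarrow> \<exists>D. ring_derivation D \<and> map_poly D f0 = 0 \<and> map_poly D g0 = 0 \<and>
       map_poly D f1 = 0 \<and> map_poly D g1 = 0 \<and> map_poly D q2 = monom 1 k"
    and E0: "of_nat n * f0 * p + w * pderiv p = T0 * p"
    and E1: "(of_nat n - 1) * f0 * p1 + of_nat n * f1 * p + w * pderiv p1 + q1 * pderiv p = T0 * p1 + T1 * p"
    and E2: "(of_nat n - 2) * f0 * p2 + (of_nat n - 1) * f1 * p1 + of_nat n * f2 * p +
       w * pderiv p2 + q1 * pderiv p1 + q2 * pderiv p = T0 * p2 + T1 * p1 + T2 * p"
  shows False
proof -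
  define R where "R = T0 - of_nat n * f0"
  have T0: "T0 = R + of_nat n * f0" by (simp add: R_def)
  have wp: "w * pderiv p = R * p"
    using E0 by (simp add: T0 algebra_simps)
  have deg_nat: "degree (of_nat n * f0) \<le> d"
    using degree_mult_le[of "of_nat n" f0] deg_f0 by simp
  have deg_R: "degree R \<le> d"
    unfolding R_def using deg_nat deg_T0 by (intro degree_diff_le) auto
  have "coeff (of_nat n * f0) d = of_nat n * coeff f0 d"
    by (simp add: of_nat_poly)
  then have coeff_R: "coeff R d = - of_nat n * coeff f0 d"
    using deg_T0 by (simp add: R_def coeff_eq_0)
  have coeff_w: "coeff w (Suc d) = - coeff f0 d"
    using deg_g0 by (simp add: w coeff_eq_0)
  have "degree w \<le> Suc d"
    unfolding w using deg_f0 deg_g0 degree_mult_le[of "[:0, 1:]" f0] by (intro degree_diff_le) auto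
  with coeff_w lead have deg_w: "degree w = Suc d"
    by (metis le_antisym le_degree neg_equal_0_iff_equal)
  then have "w \<noteq> 0" by auto
  have "R \<noteq> 0"
    using coeff_R lead \<open>1 \<le> n\<close> by auto
  have deg_R': "degree R = d"
    using deg_R coeff_R lead \<open>1 \<le> n\<close> by (intro le_antisym le_degree) auto
  have "pderiv p \<noteq> 0"
    using wp \<open>R \<noteq> 0\<close> \<open>p \<noteq> 0\<close> by auto
  \<comment> \<open>The leading coefficients of \<open>w * pderiv p\<close> and \<open>R * p\<close>
    are \<open>- coeff f0 d * lead_coeff p\<close> times \<open>degree p\<close> and times
    \<open>n\<close>; hence the leading form of the curve has no zero at the point missing from the
    chart.\<close>
  then have "lead_coeff (w * pderiv p) = - coeff f0 d * (of_nat (degree p) * lead_coeff p)"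
    unfolding lead_coeff_mult deg_w coeff_w
    by (simp add: degree_pderiv coeff_pderiv pderiv_eq_0_iff del: of_nat_Suc)
  then have n: "degree p = n"
    using lead \<open>p \<noteq> 0\<close> by (simp add: wp lead_coeff_mult deg_R' coeff_R flip: of_nat_mult)
  have root: "poly w r = 0" "poly R r = of_nat (order r p) * poly (pderiv w) r" if "poly p r = 0" for r
    using log_derivative_at_root[OF wp \<open>p \<noteq> 0\<close> that] .
  note nonres' = nonres[where a = 1, simplified] nonres[where a = 2, simplified]

  have "p dvd w * p1"
  \<comment> \<open>The factor \<open>w\<close> turns \<open>q1 * pderiv p\<close> into a multiple
    of \<open>p\<close>. At a root of \<open>p\<close>, the value of \<open>R\<close> is the order
    of the root times that of \<open>pderiv w\<close>, so a resonance would make \<open>f0\<close>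
    an integer multiple of \<open>pderiv w\<close> there.\<close>
  proof (rule dvd_nonresonant[OF ac \<open>p \<noteq> 0\<close>, where w = w and B = "pderiv w + R + f0"])
    have "w * pderiv (w * p1) - (pderiv w + R + f0) * (w * p1) = w * (w * pderiv p1 - R * p1 - f0 * p1)"
      by (simp add: pderiv_mult algebra_simps)
    also have "w * pderiv p1 - R * p1 - f0 * p1 = (T1 - of_nat n * f1) * p - q1 * pderiv p"
      using E1 by (simp add: T0 algebra_simps)
    also have "w * \<dots> = p * (w * (T1 - of_nat n * f1) - q1 * R)"
      using wp by (simp add: algebra_simps)
    finally show "p dvd w * pderiv (w * p1) - (pderiv w + R + f0) * (w * p1)" by simp
    fix r k assume r: "poly p r = 0"
    then show "poly w r = 0" using root by blast
    show "of_nat k * poly (pderiv w) r \<noteq> poly (pderiv w + R + f0) r"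
    proof
      assume "of_nat k * poly (pderiv w) r = poly (pderiv w + R + f0) r"
      then have "poly f0 r = of_int (int k - 1 - int (order r p)) * poly (pderiv w) r"
        using root[OF r] by (simp add: algebra_simps)
      then show False using nonres'(1) root[OF r] by blast
    qed
  qed
  \<comment> \<open>That is, \<open>p1 / p = u1 / w\<close>. In the resulting equation
    \<open>I\<close> for \<open>u1\<close>, \<open>p\<close> occurs only through
    \<open>R\<close>.\<close>
  then obtain u1 where u1: "w * p1 = p * u1" by (auto simp: dvd_def)
  have wu1: "w * pderiv (w * p1) = p * (R * u1 + w * pderiv u1)"
  proof -
    have "w * pderiv (p * u1) = (w * pderiv p) * u1 + p * (w * pderiv u1)"
      by (simp add: pderiv_mult algebra_simps)
    then show ?thesis unfolding u1 wp by (simp add: algebra_simps)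
  qed
  note wu1' = wu1[unfolded u1]
  have I: "w * pderiv u1 - (pderiv w + f0) * u1 + q1 * R = w * (T1 - of_nat n * f1)"
  proof -
    have "p * (w * pderiv u1 - (pderiv w + f0) * u1 + q1 * R) =
        w * pderiv (w * p1) - (R + pderiv w + f0) * (w * p1) + p * (q1 * R)"
      unfolding u1 wu1' by (simp add: algebra_simps)
    also have "\<dots> = w * (w * pderiv p1 - R * p1 - f0 * p1 + q1 * pderiv p)"
      using wp by (simp add: pderiv_mult algebra_simps)
    also have "w * pderiv p1 - R * p1 - f0 * p1 + q1 * pderiv p = (T1 - of_nat n * f1) * p"
      using E1 by (simp add: T0 algebra_simps)
    finally have "p * (w * pderiv u1 - (pderiv w + f0) * u1 + q1 * R) = p * (w * (T1 - of_nat n * f1))"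
      by (simp add: mult_ac)
    then show ?thesis using \<open>p \<noteq> 0\<close> by simp
  qed

  define S where "S = w * w * (T2 - of_nat n * f2) + w * (T1 - (of_nat n - 1) * f1) * u1
      - q1 * (R * u1 + w * pderiv u1 - pderiv w * u1) - q2 * w * R"
  have S: "w * pderiv (w * w * p2) - (2 * pderiv w + R + 2 * f0) * (w * w * p2) = p * S"
  proof -
    have "w * pderiv (w * w * p2) - (2 * pderiv w + R + 2 * f0) * (w * w * p2)
        = w * w * (w * pderiv p2 - R * p2 - 2 * f0 * p2)"
      by (simp add: pderiv_mult algebra_simps)
    also have "w * pderiv p2 - R * p2 - 2 * f0 * p2 =
        (T2 - of_nat n * f2) * p + (T1 - (of_nat n - 1) * f1) * p1 - q1 * pderiv p1 - q2 * pderiv p"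
      using E2 by (simp add: T0 algebra_simps)
    also have "w * w * \<dots> = w * w * (T2 - of_nat n * f2) * p + w * (T1 - (of_nat n - 1) * f1) * (w * p1)
        - q1 * (w * pderiv (w * p1) - pderiv w * (w * p1)) - q2 * w * (w * pderiv p)"
      by (simp add: pderiv_mult algebra_simps)
    also have "\<dots> = p * S"
      unfolding S_def u1 wu1' wp by (simp add: algebra_simps)
    finally show ?thesis .
  qed
  \<comment> \<open>The same argument one order further: a double pole,
    \<open>p2 / p = y2 / (w * w)\<close>, where a resonance would concern
    \<open>2 * f0\<close>.\<close>
  have "p dvd w * w * p2"
  proof (rule dvd_nonresonant[OF ac \<open>p \<noteq> 0\<close>, where w = w and B = "2 * pderiv w + R + 2 * f0"])
    show "p dvd w * pderiv (w * w * p2) - (2 * pderiv w + R + 2 * f0) * (w * w * p2)"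
      unfolding S by simp
    fix r k assume r: "poly p r = 0"
    then show "poly w r = 0" using root by blast
    show "of_nat k * poly (pderiv w) r \<noteq> poly (2 * pderiv w + R + 2 * f0) r"
    proof
      assume "of_nat k * poly (pderiv w) r = poly (2 * pderiv w + R + 2 * f0) r"
      then have "2 * poly f0 r = of_int (int k - 2 - int (order r p)) * poly (pderiv w) r"
        using root[OF r] by (simp add: algebra_simps)
      then show False using nonres'(2) root[OF r] by blast
    qed
  qed
  then obtain y2 where y2: "w * w * p2 = p * y2" by (auto simp: dvd_def)
  have II: "w * pderiv y2 - 2 * (pderiv w + f0) * y2 = w * w * (T2 - of_nat n * f2) + w * f1 * u1
      + u1 * (w * pderiv u1 - (pderiv w + f0) * u1) - q1 * (w * pderiv u1 - pderiv w * u1) - q2 * w * R"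
  proof -
    have "w * pderiv (p * y2) = (w * pderiv p) * y2 + p * (w * pderiv y2)"
      by (simp add: pderiv_mult algebra_simps)
    then have wy2: "w * pderiv (p * y2) = p * (R * y2 + w * pderiv y2)"
      unfolding wp by (simp add: algebra_simps)
    from S[unfolded y2 wy2] have "p * (w * pderiv y2 - 2 * (pderiv w + f0) * y2) = p * S"
      by (simp add: algebra_simps)
    then have "w * pderiv y2 - 2 * (pderiv w + f0) * y2 = S"
      using \<open>p \<noteq> 0\<close> by simp
    \<comment> \<open>\<open>T1\<close> now occurs only in the combination that \<open>I\<close>
      expresses through \<open>u1\<close>; after this substitution \<open>T2\<close> is the only
      unknown cofactor besides \<open>R\<close>.\<close>
    moreover have "S = w * w * (T2 - of_nat n * f2) + (w * (T1 - of_nat n * f1)) * u1 + w * f1 * u1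
        - q1 * (R * u1 + w * pderiv u1 - pderiv w * u1) - q2 * w * R"
      by (simp add: S_def algebra_simps)
    ultimately show ?thesis
      unfolding I[symmetric] by (simp add: algebra_simps)
  qed
  have deg_u1: "degree u1 \<le> d"
  proof (cases "p1 = 0")
    case True
    then show ?thesis using u1 \<open>p \<noteq> 0\<close> by simp
  next
    case False
    then have "u1 \<noteq> 0" using u1 \<open>w \<noteq> 0\<close> by auto
    have "Suc d + degree p1 = n + degree u1"
      using arg_cong[OF u1, of degree] False \<open>u1 \<noteq> 0\<close> \<open>w \<noteq> 0\<close> \<open>p \<noteq> 0\<close>
      by (simp add: degree_mult_eq deg_w n)
    then show ?thesis using deg_p1 False by linarith
  qed
  have deg_y2: "degree y2 \<le> 2 * d"
  proof (cases "p2 = 0")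
    case True
    then show ?thesis using y2 \<open>p \<noteq> 0\<close> by simp
  next
    case False
    then have "y2 \<noteq> 0" using y2 \<open>w \<noteq> 0\<close> by auto
    have "Suc d + Suc d + degree p2 = n + degree y2"
      using arg_cong[OF y2, of degree] False \<open>y2 \<noteq> 0\<close> \<open>w \<noteq> 0\<close> \<open>p \<noteq> 0\<close>
      by (simp add: degree_mult_eq deg_w n)
    then show ?thesis using deg_p2 False by linarith
  qed

  have small: "x = 0" if "w dvd x" "degree x \<le> d" for x
    using that deg_w dvd_imp_degree_le[of w x] by fastforce
  have coprime1: "w dvd x" if "w dvd (pderiv w + f0) * x" for x
    using ac \<open>w \<noteq> 0\<close> that
  proof (rule dvd_coprime_roots)
    fix r assume r: "poly w r = 0"
    show "poly (pderiv w + f0) r \<noteq> 0"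
      using nonres'(1)[OF r, of "- 1"] by (auto simp: eq_neg_iff_add_eq_0 add.commute)
  qed
  have coprime2: "w dvd x" if "w dvd (pderiv w + 2 * f0) * x" for x
    using ac \<open>w \<noteq> 0\<close> that
  proof (rule dvd_coprime_roots)
    fix r assume r: "poly w r = 0"
    show "poly (pderiv w + 2 * f0) r \<noteq> 0"
      using nonres'(2)[OF r, of "- 1"] by (auto simp: eq_neg_iff_add_eq_0 add.commute)
  qed

  \<comment> \<open>Differentiation along the coefficient of \<open>q2\<close> at \<open>k\<close>.
    It fixes \<open>w\<close>, hence the simple roots of \<open>w\<close>, hence \<open>R\<close>;
    equation \<open>I\<close> then shows that it fixes \<open>u1\<close>, so of \<open>II\<close>
    only the terms with \<open>y2\<close>, \<open>T2\<close> and \<open>q2\<close> survive.\<close>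
  have "\<exists>y. degree y < d \<and> w dvd (pderiv w + 2 * f0) * y - monom 1 k * R" if k: "k < d" for k
  proof -
    obtain D where D: "ring_derivation D" and D0: "map_poly D f0 = 0" "map_poly D g0 = 0"
      "map_poly D f1 = 0" "map_poly D g1 = 0" and Dq2: "map_poly D q2 = monom 1 k"
      using ders[OF k] by blast
    let ?D = "map_poly D"
    have rD: "ring_derivation ?D" using ring_derivation_map_poly[OF D] .
    note Ds = deriv_add[OF rD] deriv_diff[OF rD] deriv_mult[OF rD] deriv_0[OF rD] deriv_of_nat[OF rD]
      map_deriv_pderiv[OF D] D0
    have DX: "?D [:0, 1:] = 0"
      by (simp add: map_deriv_pCons[OF D] deriv_0[OF D] deriv_1[OF D])
    have Dw: "?D w = 0" and Dq1: "?D q1 = 0"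
      unfolding w q1 by (simp_all only: Ds DX) simp_all
    have "D r = 0" if r: "poly p r = 0" for r
    proof -
      have "0 = D (poly w r)" using root(1)[OF r] by (simp add: deriv_0[OF D])
      also have "\<dots> = poly (pderiv w) r * D r"
        by (simp add: deriv_poly[OF D] Dw)
      finally show ?thesis using simple[OF root(1)[OF r]] by simp
    qed
    then obtain \<beta> where \<beta>: "?D p = smult \<beta> p"
      using map_deriv_killed_roots[OF ac D \<open>p \<noteq> 0\<close>] by blast
    have DR: "?D R = 0"
    proof -
      have "?D (w * pderiv p) = ?D (R * p)" using wp by simp
      then have "smult \<beta> (w * pderiv p) = ?D R * p + smult \<beta> (R * p)"
        by (simp add: Ds Dw \<beta> pderiv_smult)
      then show ?thesis using wp \<open>p \<noteq> 0\<close> by simp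
    qed
    have Du1: "?D u1 = 0"
    proof (rule small)
      have "?D (w * pderiv u1 - (pderiv w + f0) * u1 + q1 * R) = ?D (w * (T1 - of_nat n * f1))"
        using I by simp
      then have "(pderiv w + f0) * ?D u1 = w * (pderiv (?D u1) - ?D (T1 - of_nat n * f1))"
        unfolding Ds(1-6) by (simp add: Ds(4) Dw D0 Dq1 DR algebra_simps)
      then show "w dvd ?D u1"
        using coprime1[of "?D u1"] by simp
      show "degree (?D u1) \<le> d"
        using degree_map_deriv_le[OF D, of u1] deg_u1 by simp
    qed
    define z where "z = ?D y2"
    have z: "w * pderiv z - 2 * (pderiv w + f0) * z = w * w * ?D (T2 - of_nat n * f2) - monom 1 k * w * R"
    proof -
      have two: "?D 2 = 0" using deriv_of_nat[OF rD, of 2] by simp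
      show ?thesis
        using arg_cong[OF II, of ?D] unfolding Ds(1-6)
        by (simp add: Dw D0 Dq1 DR Du1 Dq2 two z_def Ds(4))
    qed
    then have "2 * (pderiv w + f0) * z = w * (pderiv z - w * ?D (T2 - of_nat n * f2) + monom 1 k * R)"
      by (simp add: algebra_simps)
    then have "w dvd (pderiv w + f0) * (2 * z)"
      by (simp add: mult_ac)
    then have "w dvd smult 2 z"
      using coprime1[of "2 * z"] by (simp add: numeral_poly)
    then have "w dvd z" by (simp add: dvd_smult_iff)
    then obtain y where y: "z = w * y" by (auto simp: dvd_def)
    \<comment> \<open>Since \<open>z\<close> is divisible by \<open>w\<close>, one factor
      \<open>w\<close> cancels, and modulo \<open>w\<close> the remaining equation no longer
      involves \<open>T2\<close>.\<close>
    have "w * (w * pderiv y - (pderiv w + 2 * f0) * y) = w * (w * ?D (T2 - of_nat n * f2) - monom 1 k * R)"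
      using z by (simp add: y pderiv_mult algebra_simps)
    then have "w * pderiv y - (pderiv w + 2 * f0) * y = w * ?D (T2 - of_nat n * f2) - monom 1 k * R"
      using \<open>w \<noteq> 0\<close> by simp
    then have "(pderiv w + 2 * f0) * y - monom 1 k * R = w * (pderiv y - ?D (T2 - of_nat n * f2))"
      by (simp add: algebra_simps)
    moreover have "degree y < d"
    proof (cases "y = 0")
      case False
      then have "Suc d + degree y \<le> 2 * d"
        using y deg_y2 degree_map_deriv_le[OF D, of y2] \<open>w \<noteq> 0\<close>
        by (simp add: z_def degree_mult_eq deg_w)
      then show ?thesis by simp
    qed (use \<open>2 \<le> d\<close> in auto)
    ultimately show ?thesis by force
  qed
  then obtain y where deg_y: "\<And>k. k < d \<Longrightarrow> degree (y k) < d"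
    and y: "\<And>k. k < d \<Longrightarrow> w dvd (pderiv w + 2 * f0) * y k - monom 1 k * R"
    by metis
  \<comment> \<open>Multiplying the congruence for \<open>k\<close> by the variable gives a solution
    of the one for \<open>k + 1\<close>. Solutions agree modulo \<open>w\<close>, and
    \<open>w\<close> has degree \<open>d + 1\<close>, too large for a nonzero difference.\<close>
  have shift: "y k = monom 1 k * y 0" if "k < d" for k
    using that
  proof (induction k)
    case (Suc k)
    have "w dvd ((pderiv w + 2 * f0) * y (Suc k) - monom 1 (Suc k) * R)
        - [:0, 1:] * ((pderiv w + 2 * f0) * y k - monom 1 k * R)"
      using Suc.prems by (intro dvd_diff[OF y dvd_mult[OF y]]) auto
    also have "\<dots> = (pderiv w + 2 * f0) * (y (Suc k) - [:0, 1:] * y k)"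
      by (simp add: monom_Suc algebra_simps)
    finally have "w dvd y (Suc k) - [:0, 1:] * y k" by (rule coprime2)
    moreover have "degree (y (Suc k) - [:0, 1:] * y k) \<le> d"
      using deg_y[of k] deg_y[of "Suc k"] degree_mult_le[of "[:0, 1:]" "y k"] Suc.prems
      by (intro degree_diff_le) auto
    ultimately have "y (Suc k) = [:0, 1:] * y k" using small by fastforce
    then show ?case using Suc by (simp add: monom_Suc)
  qed simp
  \<comment> \<open>\<open>y (d - 1) = monom 1 (d - 1) * y 0\<close> still has degree less than
    \<open>d\<close>.\<close>
  have "degree (y 0) = 0"
  proof (rule ccontr)
    assume "degree (y 0) \<noteq> 0"
    then have "degree (monom 1 (d - 1) * y 0) = d - 1 + degree (y 0)"
      by (subst degree_mult_eq) (auto simp: degree_monom_eq monom_eq_0_iff)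
    with deg_y[of "d - 1"] shift[of "d - 1"] \<open>degree (y 0) \<noteq> 0\<close> \<open>2 \<le> d\<close> show False by simp
  qed
  then obtain c where c: "y 0 = [:c:]" by (rule degree_eq_zeroE)
  have "w dvd (pderiv w + 2 * f0) * [:c:] - R"
    using y[of 0] \<open>2 \<le> d\<close> by (simp add: c)
  moreover have "degree ((pderiv w + 2 * f0) * [:c:] - R) \<le> d"
  proof -
    have "degree (pderiv w + 2 * f0) \<le> d"
      using deg_f0 degree_mult_le[of "2" f0]
      by (intro degree_add_le) (auto simp: degree_pderiv deg_w)
    then show ?thesis
      using degree_mult_le[of "pderiv w + 2 * f0" "[:c:]"] deg_R by (intro degree_diff_le) auto
  qed
  ultimately have "(pderiv w + 2 * f0) * [:c:] - R = 0" by (rule small)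
  then have R: "R = smult c (pderiv w + 2 * f0)" by simp
  have "coeff (2 * f0) d = 2 * coeff f0 d" by (simp add: numeral_poly)
  then have "of_nat n * coeff f0 d = (c * (of_nat d - 1)) * coeff f0 d"
    using coeff_R by (simp add: R coeff_pderiv coeff_w algebra_simps)
  then have c': "of_nat n = c * (of_nat d - 1)"
    using lead by simp
  \<comment> \<open>\<open>R\<close> is now a constant multiple of \<open>pderiv w + 2 * f0\<close>;
    comparing with its known value at a root of \<open>p\<close> gives a resonance with the nonzero
    integer \<open>2 * n\<close>.\<close>
  obtain r where r: "poly p r = 0"
    using alg_closedD[OF ac, of p] n \<open>1 \<le> n\<close> by auto
  have "of_nat (order r p) * poly (pderiv w) r = c * (poly (pderiv w) r + 2 * poly f0 r)"
    using root(2)[OF r] by (simp add: R)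
  then have "(of_nat d - 1) * (of_nat (order r p) * poly (pderiv w) r)
      = of_nat n * (poly (pderiv w) r + 2 * poly f0 r)"
    by (simp add: c' mult_ac)
  then have "of_int (2 * int n) * poly f0 r =
      of_int ((int d - 1) * int (order r p) - int n) * poly (pderiv w) r"
    by (simp add: algebra_simps)
  then have "2 * int n = 0" using nonres root(1)[OF r] by blast
  with \<open>1 \<le> n\<close> show False by simp
qed


section \<open>Bivariate polynomials\<close>

text \<open>A bivariate polynomial is an \<open>'a poly poly\<close>: the outer variable is \<open>y\<close>, the inner one \<open>x\<close>.\<close>

definition eval2 :: "'a::comm_ring_1 poly poly \<Rightarrow> 'a \<Rightarrow> 'a \<Rightarrow> 'a" where
  "eval2 P x y = poly (poly P [:y:]) x"

lemma eval2_simps [simp]: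
  "eval2 0 x y = 0" "eval2 1 x y = 1" "eval2 (P + Q) x y = eval2 P x y + eval2 Q x y"
  "eval2 (P - Q) x y = eval2 P x y - eval2 Q x y" "eval2 (P * Q) x y = eval2 P x y * eval2 Q x y"
  "eval2 [:q:] x y = poly q x" "eval2 (pCons q P) x y = poly q x + y * eval2 P x y"
  by (simp_all add: eval2_def)

lemma eval2_conv_map_poly: "eval2 P x y = poly (map_poly (\<lambda>q. poly q x) P) y"
  by (induction P) (simp_all add: map_poly_pCons)

definition var :: "'a::comm_ring_1 poly" where
  "var = [:0, 1:]"

lemma coeff_var_mult: "coeff (var * p) n = (case n of 0 \<Rightarrow> 0 | Suc m \<Rightarrow> coeff p m)"
  by (simp add: var_def coeff_pCons)

lemma map_deriv_var: "ring_derivation D \<Longrightarrow> map_poly D var = 0"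
  by (simp add: var_def map_deriv_pCons deriv_0 deriv_1)

lemma pderiv_var: "pderiv (var :: 'a::idom poly) = 1"
  by (simp add: var_def pderiv_pCons)

text \<open>The substitution \<open>y = t x\<close>; in the result \<open>x\<close> is the outer and \<open>t\<close> the inner variable.\<close>

definition lift_coeffs :: "'a::comm_ring_1 poly \<Rightarrow> 'a poly poly" where
  "lift_coeffs q = map_poly (\<lambda>a. [:a:]) q"

definition blowup :: "'a::comm_ring_1 poly poly \<Rightarrow> 'a poly poly" where
  "blowup A = poly (map_poly lift_coeffs A) [:0, [:0, 1:]:]"

lemma lift_coeffs_pCons: "lift_coeffs (pCons a q) = pCons [:a:] (lift_coeffs q)"
  by (simp add: lift_coeffs_def map_poly_pCons)

lemma coeff_lift_coeffs: "coeff (lift_coeffs q) i = [:coeff q i:]"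
  by (simp add: lift_coeffs_def coeff_map_poly)

lemma lift_coeffs_0 [simp]: "lift_coeffs 0 = 0"
  by (simp add: lift_coeffs_def)

lemma sum_pCons_0: "[:sum f A:] = (\<Sum>i\<in>A. [:f i:])"
  by (rule poly_eqI) (simp add: coeff_sum coeff_pCons split: nat.splits)

lemma lift_coeffs_1 [simp]: "lift_coeffs 1 = 1"
  by (simp add: lift_coeffs_def pCons_one)

lemma lift_coeffs_mult: "lift_coeffs (p * q) = lift_coeffs p * lift_coeffs q"
  by (rule poly_eqI) (simp add: coeff_lift_coeffs coeff_mult sum_pCons_0 mult.commute)

lemma blowup_pCons: "blowup (pCons q A) = lift_coeffs q + pCons 0 (smult [:0, 1:] (blowup A))"
  by (simp add: blowup_def map_poly_pCons)

lemma blowup_0 [simp]: "blowup 0 = 0"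
  by (simp add: blowup_def)

text \<open>The monomial \<open>x^i y^j\<close> becomes \<open>x^(i+j) t^j\<close>: the outer
  coefficient at \<open>m\<close> is the homogeneous part of degree \<open>m\<close>,
  dehomogenized.\<close>

lemma coeff_blowup:
  "coeff (coeff (blowup A) m) j = (if j \<le> m then coeff (coeff A j) (m - j) else 0)"
proof (induction A arbitrary: m j)
  case (pCons q A)
  then show ?case
    by (auto simp: blowup_pCons coeff_lift_coeffs coeff_pCons split: nat.splits)
qed simp

lemma blowup_1 [simp]: "blowup 1 = 1"
  using blowup_pCons[of 1 0] by (simp add: pCons_one)

lemma blowup_eq_0_iff: "blowup A = 0 \<longleftrightarrow> A = 0"
proof
  assume "blowup A = 0"
  then have "coeff (coeff A j) i = 0" for i j
    using coeff_blowup[of A "i + j" j] by simp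
  then show "A = 0" by (simp add: poly_eq_iff)
qed simp

lemma blowup_add: "blowup (A + B) = blowup A + blowup B"
  by (intro poly_eqI) (simp add: coeff_blowup)

lemma blowup_mult_const: "blowup ([:q:] * B) = lift_coeffs q * blowup B"
proof (induction B)
  case (pCons b B)
  then show ?case
    by (simp add: blowup_pCons lift_coeffs_mult distrib_left)
qed simp

lemma blowup_mult: "blowup (A * B) = blowup A * blowup B"
proof (induction A)
  case (pCons q A)
  have "pCons q A * B = [:q:] * B + pCons 0 (A * B)"
    by simp
  then show ?case
    by (simp only: blowup_add blowup_mult_const pCons.IH blowup_pCons)
      (simp add: distrib_right)
qed simp

text \<open>Coefficients are counted downwards from a nominal degree \<open>a\<close>, which only
  has to bound the degree. The value \<open>0\<close> beyond \<open>a\<close> lets the product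
  formula hold for every \<open>k\<close>.\<close>

definition top_coeff :: "nat \<Rightarrow> nat \<Rightarrow> 'a::zero poly \<Rightarrow> 'a" where
  "top_coeff a k A = (if k \<le> a then coeff A (a - k) else 0)"

lemma top_coeff_mult:
  fixes A B :: "'a::comm_semiring_0 poly"
  assumes "degree A \<le> a" "degree B \<le> b"
  shows "top_coeff (a + b) k (A * B) = (\<Sum>i\<le>k. top_coeff a i A * top_coeff b (k - i) B)"
proof -
  let ?S = "{i. i \<le> k \<and> i \<le> a \<and> k - i \<le> b}"
  have R: "(\<Sum>i\<le>k. top_coeff a i A * top_coeff b (k - i) B) =
      (\<Sum>i\<in>?S. coeff A (a - i) * coeff B (b - (k - i)))"
    by (rule sum.mono_neutral_cong_right) (auto simp: top_coeff_def)
  show ?thesis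
  proof (cases "k \<le> a + b")
    case True
    define m where "m = a + b - k"
    let ?T = "{i. i \<le> m \<and> i \<le> a \<and> m - i \<le> b}"
    have "top_coeff (a + b) k (A * B) = (\<Sum>i\<le>m. coeff A i * coeff B (m - i))"
      using True by (simp add: top_coeff_def coeff_mult m_def)
    also have "\<dots> = (\<Sum>i\<in>?T. coeff A i * coeff B (m - i))"
    proof (intro sum.mono_neutral_right ballI)
      fix i assume "i \<in> {..m} - ?T"
      then have "degree A < i \<or> degree B < m - i" using assms by auto
      then show "coeff A i * coeff B (m - i) = 0" by (auto simp: coeff_eq_0)
    qed auto
    also have "\<dots> = (\<Sum>i\<in>?S. coeff A (a - i) * coeff B (b - (k - i)))"
      using True
      by (intro sum.reindex_bij_witness[of _ "\<lambda>i. a - i" "\<lambda>i. a - i"])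
        (auto simp: m_def intro!: arg_cong2[where f = "(*)"] arg_cong[where f = "coeff B"])
    finally show ?thesis using R by simp
  next
    case False
    then have "?S = {}" by auto
    with False R show ?thesis by (simp add: top_coeff_def)
  qed
qed

section \<open>Generic vector fields have no invariant curves\<close>

text \<open>The last assumption expresses algebraic independence of the coefficients: they can be
  differentiated independently of each other.\<close>

locale generic_vf =
  fixes \<delta> :: "'a::{field_char_0,field_gcd} \<Rightarrow> 'a" and d :: nat and cf :: "bool \<times> nat \<times> nat \<Rightarrow> 'a"
  assumes \<delta>: "ring_derivation \<delta>" and ac: "alg_closed TYPE('a)" and d: "3 \<le> d"
    and cf_const: "\<And>k. k \<in> vf_index d \<Longrightarrow> \<delta> (cf k) = 0"
    and cf_nz: "\<And>k. k \<in> vf_index d \<Longrightarrow> cf k \<noteq> 0"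
    and cf_der: "\<And>b. \<exists>D. ring_derivation D \<and> (\<forall>k\<in>vf_index d. D (cf k) = b k)"
begin

section \<open>The total derivative, in affine coordinates and at infinity\<close>

definition vp :: "bool \<Rightarrow> 'a poly poly" where
  "vp c = (\<Sum>j\<le>d. monom (\<Sum>i\<le>d - j. monom (cf (c, i, j)) i) j)"

lemma coeff_vp: "coeff (coeff (vp c) j) i = (if i + j \<le> d then cf (c, i, j) else 0)"
  by (auto simp: vp_def coeff_sum)

text \<open>The derivation of the polynomial ring that extends \<open>\<delta>\<close> and maps the
  variables to the components of the vector field; at a solution it becomes the derivative of the
  value.\<close>

definition DD :: "'a poly poly \<Rightarrow> 'a poly poly" where
  "DD P = map_poly (map_poly \<delta>) P + (vp False * map_poly pderiv P + vp True * pderiv P)"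

lemma ring_derivation_DD: "ring_derivation DD"
proof -
  have "ring_derivation (map_poly (map_poly \<delta>))"
    by (intro ring_derivation_map_poly \<delta>)
  moreover have "ring_derivation (map_poly pderiv :: 'a poly poly \<Rightarrow> _)"
    by (intro ring_derivation_map_poly ring_derivation_pderiv)
  moreover have "ring_derivation (pderiv :: 'a poly poly \<Rightarrow> _)"
    by (rule ring_derivation_pderiv)
  ultimately show ?thesis
    unfolding DD_def ring_derivation_def by (simp add: algebra_simps)
qed

lemmas DD_add = deriv_add[OF ring_derivation_DD]
  and DD_mult = deriv_mult[OF ring_derivation_DD]

lemma DD_const: "DD [:[:a:]:] = [:[:\<delta> a:]:]"
  by (simp add: DD_def map_poly_pCons map_deriv_pCons[OF \<delta>] pderiv_pCons)

lemma DD_x: "DD [:[:0, 1:]:] = vp False"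
  by (simp add: DD_def map_poly_pCons map_deriv_pCons[OF \<delta>] deriv_0[OF \<delta>] deriv_1[OF \<delta>]
      deriv_1[OF ring_derivation_map_poly[OF \<delta>]] pderiv_pCons pCons_one)

lemma DD_y: "DD [:0, 1:] = vp True"
  by (simp add: DD_def map_poly_pCons map_deriv_pCons[OF \<delta>] deriv_0[OF \<delta>] deriv_1[OF \<delta>]
      deriv_1[OF ring_derivation_map_poly[OF ring_derivation_map_poly[OF \<delta>]]]
      deriv_1[OF ring_derivation_map_poly[OF ring_derivation_pderiv]] pderiv_pCons pCons_one)

text \<open>Compatibility of two derivations then has to be checked only on constants and the two
  variables.\<close>

lemma poly2_induct [case_names const X Y add mult]:
  assumes "\<And>a. Q [:[:a:]:]" "Q [:[:0, 1:]:]" "Q [:0, 1:]"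
    and add: "\<And>A B. Q A \<Longrightarrow> Q B \<Longrightarrow> Q (A + B)" and mult: "\<And>A B. Q A \<Longrightarrow> Q B \<Longrightarrow> Q (A * B)"
  shows "Q (A :: 'a poly poly)"
proof -
  have c: "Q [:q:]" for q :: "'a poly"
  proof (induction q)
    case 0
    then show ?case using assms(1)[of 0] by simp
  next
    case (pCons a q)
    have "[:pCons a q:] = [:[:a:]:] + [:[:0, 1:]:] * [:q:]" by simp
    then show ?case using add[OF assms(1)[of a] mult[OF assms(2) pCons.IH]] by simp
  qed
  show ?thesis
  proof (induction A)
    case 0
    then show ?case using c[of 0] by simp
  next
    case (pCons q A)
    have "pCons q A = [:q:] + [:0, 1:] * A" by simp
    then show ?case using add[OF c[of q] mult[OF assms(3) pCons.IH]] by simp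
  qed
qed

text \<open>In the coordinates \<open>(x, t)\<close> the field is \<open>f \<partial>/\<partial>x +
  ((g - t f) / x) \<partial>/\<partial>t\<close>; this is \<open>x\<close> times the total
  derivative, the factor \<open>var\<close> clearing the denominator.\<close>

definition EE :: "'a poly poly \<Rightarrow> 'a poly poly" where
  "EE S = var * map_poly (map_poly \<delta>) S + (blowup (vp False) * (var * pderiv S) +
     (blowup (vp True) - [:var:] * blowup (vp False)) * map_poly pderiv S)"

lemma ring_derivation_EE: "ring_derivation EE"
proof -
  have "ring_derivation (map_poly (map_poly \<delta>))"
    by (intro ring_derivation_map_poly \<delta>)
  moreover have "ring_derivation (map_poly pderiv :: 'a poly poly \<Rightarrow> _)"
    by (intro ring_derivation_map_poly ring_derivation_pderiv)
  moreover have "ring_derivation (pderiv :: 'a poly poly \<Rightarrow> _)"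
    by (rule ring_derivation_pderiv)
  ultimately show ?thesis
    unfolding EE_def ring_derivation_def by (simp add: algebra_simps del: mult_pCons_left mult_pCons_right)
qed

lemma EE_blowup: "EE (blowup A) = var * blowup (DD A)"
proof (induction A rule: poly2_induct)
  case (const a)
  then show ?case
    by (simp add: EE_def DD_const blowup_pCons lift_coeffs_pCons map_poly_pCons map_deriv_pCons[OF \<delta>]
        pderiv_pCons)
next
  case X
  have "blowup [:[:0, 1:]:] = (var :: 'a poly poly)"
    by (simp add: blowup_pCons lift_coeffs_pCons var_def pCons_one)
  then show ?case
    by (simp add: EE_def DD_x pderiv_var map_deriv_var[OF ring_derivation_map_poly[OF \<delta>]]
        map_deriv_var[OF ring_derivation_pderiv] del: mult_pCons_left mult_pCons_right)
next
  case Y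
  have Y: "blowup [:0, 1:] = [:var:] * (var :: 'a poly poly)"
    by (simp add: blowup_pCons lift_coeffs_pCons var_def pCons_one)
  have "map_poly (map_poly \<delta>) [:var:] = 0" "map_poly pderiv [:var :: 'a poly:] = 1" "pderiv [:var :: 'a poly:] = 0"
    by (simp_all add: map_poly_pCons map_deriv_var[OF \<delta>] pderiv_var pderiv_pCons pCons_one)
  then show ?case
    unfolding EE_def Y
    by (simp add: DD_y pderiv_var map_deriv_var[OF ring_derivation_map_poly[OF \<delta>]]
        map_deriv_var[OF ring_derivation_pderiv] pderiv_mult
        deriv_mult[OF ring_derivation_map_poly[OF ring_derivation_map_poly[OF \<delta>]]]
        deriv_mult[OF ring_derivation_map_poly[OF ring_derivation_pderiv]] algebra_simps
        del: mult_pCons_left mult_pCons_right)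
next
  case (add A B)
  then show ?case
    by (simp add: blowup_add deriv_add[OF ring_derivation_EE] DD_add distrib_left)
next
  case (mult A B)
  have "EE (blowup (A * B)) = (var * blowup (DD A)) * blowup B + blowup A * (var * blowup (DD B))"
    unfolding blowup_mult deriv_mult[OF ring_derivation_EE] mult.IH ..
  also have "\<dots> = var * blowup (DD (A * B))"
    by (simp add: DD_mult blowup_add blowup_mult algebra_simps)
  finally show ?case .
qed

text \<open>The part of degree \<open>d - k\<close> of a component, in the variable
  \<open>t\<close>. The family \<open>b\<close> is an argument because differentiating the
  coefficients yields another family of this shape.\<close>

definition tc :: "(bool \<times> nat \<times> nat \<Rightarrow> 'a) \<Rightarrow> bool \<Rightarrow> nat \<Rightarrow> 'a poly" where
  "tc b c k = (\<Sum>j\<le>d - k. monom (b (c, d - k - j, j)) j)"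

lemma coeff_tc: "coeff (tc b c k) j = (if j \<le> d - k then b (c, d - k - j, j) else 0)"
  by (auto simp: tc_def coeff_sum)

lemma top_coeff_blowup_vp: "k \<le> d \<Longrightarrow> top_coeff d k (blowup (vp c)) = tc cf c k"
  by (rule poly_eqI) (auto simp: top_coeff_def coeff_blowup coeff_tc coeff_vp)

lemma map_deriv_tc:
  assumes "ring_derivation D" "\<And>k. k \<in> vf_index d \<Longrightarrow> D (cf k) = b k"
  shows "map_poly D (tc cf c k) = tc b c k"
  using assms(2) by (intro poly_eqI) (auto simp: coeff_map_deriv[OF assms(1)] coeff_tc deriv_0[OF assms(1)] vf_index_def)

lemma degree_tc: "degree (tc b c k) \<le> d - k"
  by (rule degree_le) (simp add: coeff_tc)

section \<open>Singular points at infinity: simplicity, nonresonance, free coefficients\<close>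

abbreviation "wpoly \<equiv> tc cf True 0 - var * tc cf False 0"

text \<open>The derivation that varies only the constant coefficient of \<open>wpoly\<close>, with
  speed one, turns \<open>poly wpoly r = 0\<close> into
  \<open>0 = 1 + poly (pderiv wpoly) r * D r\<close>.\<close>

lemma wpoly_root_simple:
  assumes r: "poly wpoly r = 0"
  shows "poly (pderiv wpoly) r \<noteq> 0"
proof -
  define b :: "bool \<times> nat \<times> nat \<Rightarrow> 'a" where "b k = (if k = (True, d, 0) then 1 else 0)" for k
  obtain D where D: "ring_derivation D" "\<And>k. k \<in> vf_index d \<Longrightarrow> D (cf k) = b k"
    using cf_der by blast
  have "map_poly D wpoly = tc b True 0 - var * tc b False 0"
    by (simp add: deriv_diff[OF ring_derivation_map_poly[OF D(1)]]
        deriv_mult[OF ring_derivation_map_poly[OF D(1)]] map_deriv_tc[OF D] map_deriv_var[OF D(1)])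
  also have "tc b True 0 = 1"
    by (rule poly_eqI) (auto simp: coeff_tc b_def one_pCons coeff_pCons split: nat.splits)
  also have "tc b False 0 = 0"
    by (rule poly_eqI) (auto simp: coeff_tc b_def)
  finally have "map_poly D wpoly = 1" by simp
  then show ?thesis
    using deriv_poly[OF D(1), of wpoly r] r by (auto simp: deriv_0[OF D(1)])
qed

text \<open>Varying the leading form of \<open>f\<close> by \<open>x^d\<close> and that of
  \<open>g\<close> by \<open>x^(d-1) y\<close> moves neither \<open>wpoly\<close> nor its roots, nor
  the values of its derivative there, but increases the value of \<open>tc cf False 0\<close> at
  each root with speed one.\<close>

lemma wpoly_nonresonant:
  assumes r: "poly wpoly r = 0" and eq: "of_int a * poly (tc cf False 0) r = of_int b * poly (pderiv wpoly) r"
  shows "a = 0"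
proof -
  define c :: "bool \<times> nat \<times> nat \<Rightarrow> 'a" where
    "c k = (if k = (False, d, 0) \<or> k = (True, d - 1, 1) then 1 else 0)" for k
  obtain D where D: "ring_derivation D" "\<And>k. k \<in> vf_index d \<Longrightarrow> D (cf k) = c k"
    using cf_der by blast
  note X = map_deriv_var[OF D(1)]
  have f: "tc c False 0 = 1"
    by (rule poly_eqI) (auto simp: coeff_tc c_def one_pCons coeff_pCons split: nat.splits)
  have g: "tc c True 0 = var"
    using d by (intro poly_eqI) (auto simp: coeff_tc c_def var_def coeff_pCons split: nat.splits)
  have tc': "map_poly D (tc cf e k) = tc c e k" for e k
    using map_deriv_tc[of D c e k] D by blast
  have w: "map_poly D wpoly = 0"
    unfolding deriv_diff[OF ring_derivation_map_poly[OF D(1)]]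
      deriv_mult[OF ring_derivation_map_poly[OF D(1)]] tc' X f g by simp
  have "D r = 0"
    using deriv_poly[OF D(1), of wpoly r] r wpoly_root_simple[OF r] by (simp add: w deriv_0[OF D(1)])
  then have "D (poly (tc cf False 0) r) = 1" "D (poly (pderiv wpoly) r) = 0"
    by (simp_all add: deriv_poly[OF D(1)] map_deriv_tc[OF D] f map_deriv_pderiv[OF D(1)] w)
  then have "D (of_int a * poly (tc cf False 0) r) = of_int a" "D (of_int b * poly (pderiv wpoly) r) = 0"
    by (simp_all add: deriv_mult[OF D(1)] deriv_of_int[OF D(1)])
  then have "(of_int a :: 'a) = 0" using eq by simp
  then show ?thesis by simp
qed

text \<open>The monomials up to degree \<open>d - 2\<close> come from the coefficients of
  \<open>g\<close>. The top one, \<open>k = d - 1\<close>, comes only from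
  \<open>- var * tc cf False 2\<close>, whence the sign in the second case of
  \<open>b\<close>.\<close>

lemma independent_q2:
  assumes "k < d"
  shows "\<exists>D. ring_derivation D \<and> map_poly D (tc cf False 0) = 0 \<and> map_poly D (tc cf True 0) = 0 \<and>
     map_poly D (tc cf False 1) = 0 \<and> map_poly D (tc cf True 1) = 0 \<and>
     map_poly D (tc cf True 2 - var * tc cf False 2) = monom 1 k"
proof -
  define b :: "bool \<times> nat \<times> nat \<Rightarrow> 'a" where
    "b x = (if k \<le> d - 2 then (if x = (True, d - 2 - k, k) then 1 else 0)
            else (if x = (False, 0, d - 2) then - 1 else 0))" for x
  obtain D where D: "ring_derivation D" "\<And>k. k \<in> vf_index d \<Longrightarrow> D (cf k) = b k"
    using cf_der by blast
  note X = map_deriv_var[OF D(1)]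
  have tc': "map_poly D (tc cf e k) = tc b e k" for e k
    using map_deriv_tc[of D b e k] D by blast
  have b0: "b (c, i, j) = 0" if "i + j \<noteq> d - 2" for c i j
    using that assms by (auto simp: b_def)
  have "tc b c 0 = 0" "tc b c 1 = 0" for c
    using d by (auto intro!: poly_eqI b0 simp: coeff_tc)
  moreover have "tc b True 2 - var * tc b False 2 = monom 1 k"
  proof (cases "k \<le> d - 2")
    case True
    then have "tc b False 2 = 0" "tc b True 2 = monom 1 k"
      by (auto intro!: poly_eqI simp: coeff_tc b_def)
    then show ?thesis by simp
  next
    case False
    then have k: "k = Suc (d - 2)" using assms by linarith
    have "tc b True 2 = 0" "tc b False 2 = monom (- 1) (d - 2)"
      using False by (auto intro!: poly_eqI simp: coeff_tc b_def)
    then show ?thesis by (simp add: k var_def monom_Suc minus_monom)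
  qed
  ultimately show ?thesis
    by (intro exI[of _ D])
      (simp only: D(1) tc' deriv_diff[OF ring_derivation_map_poly[OF D(1)]]
        deriv_mult[OF ring_derivation_map_poly[OF D(1)]] X mult_zero_left add_0_left simp_thms)
qed

theorem no_invariant_curve:
  assumes "P dvd DD P" "P \<noteq> 0"
  obtains a where "P = [:[:a:]:]" "a \<noteq> 0"
proof -
  obtain h where h: "DD P = P * h" using assms(1) by (auto simp: dvd_def)
  define S where "S = blowup P"
  define n where "n = degree S"
  define T where "T = var * blowup h"
  have "S \<noteq> 0" using \<open>P \<noteq> 0\<close> by (simp add: S_def blowup_eq_0_iff)
  have "EE S = S * T"
    by (simp add: S_def EE_blowup h blowup_mult T_def mult_ac)
  have "n = 0"
  proof (rule ccontr)
    assume "n \<noteq> 0"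
    let ?F = "blowup (vp False)" and ?G = "blowup (vp True) - [:var:] * blowup (vp False)"
    have deg_vp: "degree (blowup (vp c)) \<le> d" for c
      by (rule degree_le) (auto intro!: poly_eqI simp: coeff_blowup coeff_vp)
    have deg_G: "degree ?G \<le> d"
      using deg_vp degree_smult_le[of var "blowup (vp False)"]
      by (intro degree_diff_le) (auto intro: order_trans)
    define U where "U = var * pderiv S"
    define V where "V = map_poly pderiv S"
    define W where "W = var * map_poly (map_poly \<delta>) S"
    have coeff_U: "coeff U m = of_nat m * coeff S m" for m
      by (cases m) (simp_all add: U_def coeff_var_mult coeff_pderiv)
    have coeff_V: "coeff V m = pderiv (coeff S m)" for m
      by (simp add: V_def coeff_map_poly)
    have deg_U: "degree U \<le> n" and deg_V: "degree V \<le> n"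
      by (auto intro!: degree_le simp: coeff_U coeff_V n_def coeff_eq_0)
    have coeff_W: "coeff W (Suc m) = map_poly \<delta> (coeff S m)" for m
      by (simp add: W_def coeff_var_mult coeff_map_poly)
    have ES: "S * T = W + (?F * U + ?G * V)"
      using \<open>EE S = S * T\<close> by (simp add: EE_def U_def V_def W_def)
    have "degree W \<le> n + d"
      using degree_map_deriv_le[OF ring_derivation_map_poly[OF \<delta>], of S] d
      unfolding W_def by (intro order_trans[OF degree_mult_le]) (simp add: n_def var_def)
    then have "degree (S * T) \<le> n + d"
      unfolding ES using deg_U deg_V deg_vp[of False] deg_G
        degree_mult_le[of ?F U] degree_mult_le[of ?G V]
      by (intro degree_add_le) auto
    then have deg_T: "degree T \<le> d"
      using \<open>S \<noteq> 0\<close> by (cases "T = 0") (simp_all add: degree_mult_eq n_def)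
    define s where "s k = top_coeff n k S" for k
    define \<tau> where "\<tau> k = top_coeff d k T" for k
    have "top_coeff (n + d) k (S * T) = top_coeff (n + d) k W +
        top_coeff (d + n) k (?F * U) + top_coeff (d + n) k (?G * V)" for k
      unfolding ES by (simp add: top_coeff_def add.commute)
    moreover have "top_coeff (n + d) k (S * T) = (\<Sum>i\<le>k. s i * \<tau> (k - i))" for k
      unfolding s_def \<tau>_def using deg_T by (intro top_coeff_mult) (auto simp: n_def)
    moreover have tU: "top_coeff n k U = (of_nat n - of_nat k) * s k" for k
      by (simp add: top_coeff_def s_def coeff_U of_nat_diff)
    moreover have tV: "top_coeff n k V = pderiv (s k)" for k
      by (simp add: top_coeff_def s_def coeff_V)
    moreover have tF: "top_coeff d k ?F = tc cf False k"
      and tG: "top_coeff d k ?G = tc cf True k - var * tc cf False k" if "k \<le> 2" for k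
      using that d top_coeff_blowup_vp[of k False] top_coeff_blowup_vp[of k True]
      by (simp_all add: top_coeff_def)
    ultimately have eq: "(\<Sum>i\<le>k. s i * \<tau> (k - i)) = top_coeff (n + d) k W +
        (\<Sum>i\<le>k. tc cf False i * ((of_nat n - of_nat (k - i)) * s (k - i))) +
        (\<Sum>i\<le>k. (tc cf True i - var * tc cf False i) * pderiv (s (k - i)))" if "k \<le> 2" for k
      using that top_coeff_mult[OF deg_vp[of False] deg_U, of k] top_coeff_mult[OF deg_G deg_V, of k]
      by (simp)
    \<comment> \<open>\<open>W\<close> has outer degree at most \<open>n + 1\<close>, so among the
      three leading parts it can show up only in the last one, and only for
      \<open>d = 3\<close>.\<close>
    have W01: "top_coeff (n + d) k W = (if d = 3 \<and> k = 2 then map_poly \<delta> (s 0) else 0)" if "k \<le> 2" for k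
    proof -
      have "n + d - k = Suc (n + (d - 1 - k))" using that d by simp
      then have "top_coeff (n + d) k W = map_poly \<delta> (coeff S (n + (d - 1 - k)))"
        using that d unfolding top_coeff_def by (simp add: coeff_W)
      moreover have "coeff S (n + (d - 1 - k)) = (if d = 3 \<and> k = 2 then s 0 else 0)"
        using that d by (auto simp: s_def top_coeff_def n_def intro!: coeff_eq_0)
      ultimately show ?thesis by simp
    qed
    have E0: "of_nat n * tc cf False 0 * s 0 + wpoly * pderiv (s 0) = \<tau> 0 * s 0"
      using eq[of 0] W01[of 0] by (simp add: algebra_simps)
    have E1: "(of_nat n - 1) * tc cf False 0 * s 1 + of_nat n * tc cf False 1 * s 0 + wpoly * pderiv (s 1)
        + (tc cf True 1 - var * tc cf False 1) * pderiv (s 0) = \<tau> 0 * s 1 + \<tau> 1 * s 0"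
      using eq[of 1] W01[of 1] by (simp add: algebra_simps)
    have "s 0 \<noteq> 0" using \<open>S \<noteq> 0\<close> by (simp add: s_def top_coeff_def n_def)
    have wp: "wpoly * pderiv (s 0) = (\<tau> 0 - of_nat n * tc cf False 0) * s 0"
      using E0 by (simp add: algebra_simps)
    have "\<delta> r = 0" if r: "poly (s 0) r = 0" for r
    proof -
      have wr: "poly wpoly r = 0"
        using log_derivative_at_root(1)[OF wp \<open>s 0 \<noteq> 0\<close> r] .
      have "map_poly \<delta> wpoly = 0"
      proof -
        have "map_poly \<delta> (tc cf c 0) = 0" for c
          by (rule poly_eqI) (auto simp: coeff_map_deriv[OF \<delta>] coeff_tc deriv_0[OF \<delta>] cf_const vf_index_def)
        then show ?thesis
          unfolding deriv_diff[OF ring_derivation_map_poly[OF \<delta>]]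
            deriv_mult[OF ring_derivation_map_poly[OF \<delta>]] map_deriv_var[OF \<delta>] by simp
      qed
      then show ?thesis
        using deriv_poly[OF \<delta>, of wpoly r] wr wpoly_root_simple[OF wr] by (simp add: deriv_0[OF \<delta>])
    qed
    then obtain \<beta> where \<beta>: "map_poly \<delta> (s 0) = smult \<beta> (s 0)"
      using map_deriv_killed_roots[OF ac \<delta> \<open>s 0 \<noteq> 0\<close>] by blast
    \<comment> \<open>\<open>\<delta>\<close> kills the roots of \<open>s 0\<close>, so the
      contribution of \<open>W\<close> is a multiple of \<open>s 0\<close> and is absorbed into the
      cofactor \<open>\<tau> 2\<close>.\<close>
    define \<gamma> :: "'a poly" where "\<gamma> = (if d = 3 then [:\<beta>:] else 0)"
    have W2: "top_coeff (n + d) 2 W = \<gamma> * s 0"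
      using W01[of 2] \<beta> by (simp add: \<gamma>_def)
    have E2: "(of_nat n - 2) * tc cf False 0 * s 2 + (of_nat n - 1) * tc cf False 1 * s 1
        + of_nat n * tc cf False 2 * s 0 + wpoly * pderiv (s 2)
        + (tc cf True 1 - var * tc cf False 1) * pderiv (s 1)
        + (tc cf True 2 - var * tc cf False 2) * pderiv (s 0) = \<tau> 0 * s 2 + \<tau> 1 * s 1 + (\<tau> 2 - \<gamma>) * s 0"
      using eq[of 2] W2 by (simp add: algebra_simps numeral_2_eq_2)
    have deg_s: "s k = 0 \<or> degree (s k) + k \<le> n" for k
    proof (cases "k \<le> n")
      case True
      have "degree (coeff S (n - k)) \<le> n - k"
        by (rule degree_le) (simp add: S_def coeff_blowup)
      with True show ?thesis by (intro disjI2) (simp add: s_def top_coeff_def)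
    qed (simp add: s_def top_coeff_def)
    show False
    proof (rule no_leading_terms[OF ac, where d = d and n = n and p = "s 0" and ?p1.0 = "s 1" and ?p2.0 = "s 2"])
      \<comment> \<open>The factor \<open>var\<close> in \<open>T\<close> shifts degrees by one: the
        leading part of \<open>T\<close> comes from the part of \<open>h\<close> of degree
        \<open>d - 1\<close>.\<close>
      show "degree (\<tau> 0) < d"
      proof -
        have "degree (\<tau> 0) \<le> d - 1"
          using d by (intro degree_le) (auto simp: \<tau>_def T_def top_coeff_def coeff_var_mult coeff_blowup split: nat.splits)
        then show ?thesis using d by simp
      qed
      show "coeff (tc cf False 0) d \<noteq> 0"
        using cf_nz[of "(False, 0, d)"] by (simp add: coeff_tc vf_index_def)
      show "2 \<le> d" "1 \<le> n" using d \<open>n \<noteq> 0\<close> by auto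
      show "s 0 \<noteq> 0" by fact
      show "degree (tc cf False 0) \<le> d" "degree (tc cf True 0) \<le> d"
        using degree_tc[of cf _ 0] by simp_all
      show "degree (s 0) \<le> n" "s 1 = 0 \<or> degree (s 1) + 1 \<le> n" "s 2 = 0 \<or> degree (s 2) + 2 \<le> n"
        using deg_s[of 0] deg_s[of 1] deg_s[of 2] by auto
      show "wpoly = tc cf True 0 - [:0, 1:] * tc cf False 0"
        by (simp only: var_def)
      show "tc cf True 1 - var * tc cf False 1 = tc cf True 1 - [:0, 1:] * tc cf False 1"
        "tc cf True 2 - var * tc cf False 2 = tc cf True 2 - [:0, 1:] * tc cf False 2"
        by (simp_all only: var_def)
      show "a = 0" if "poly wpoly r = 0" "of_int a * poly (tc cf False 0) r = of_int b * poly (pderiv wpoly) r"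
        for r a b using wpoly_nonresonant that .
      show "poly (pderiv wpoly) r \<noteq> 0" if "poly wpoly r = 0" for r
        using wpoly_root_simple that .
      show "\<exists>D. ring_derivation D \<and> map_poly D (tc cf False 0) = 0 \<and> map_poly D (tc cf True 0) = 0 \<and>
          map_poly D (tc cf False 1) = 0 \<and> map_poly D (tc cf True 1) = 0 \<and>
          map_poly D (tc cf True 2 - var * tc cf False 2) = monom 1 k" if "k < d" for k
        using independent_q2 that .
    qed (rule E0 E1 E2)+
  qed
  then have zero: "coeff (coeff P j) i = 0" if "i + j > 0" for i j
    using that coeff_blowup[of P "i + j" j] by (simp add: S_def n_def coeff_eq_0)
  have "P = [:[:coeff (coeff P 0) 0:]:]"
    by (intro poly_eqI) (auto simp: coeff_pCons zero split: nat.splits)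
  moreover from this have "coeff (coeff P 0) 0 \<noteq> 0"
    using \<open>P \<noteq> 0\<close> by (metis pCons_0_0)
  ultimately show ?thesis by (rule that)
qed

end


section \<open>Generic solutions\<close>

definition over2 :: "'a::comm_ring_1 set \<Rightarrow> 'a poly poly set" where
  "over2 L = {P. (P, P) \<in> polys_over (polys_over (Id_on L))}"

lemma over2_iff: "P \<in> over2 L \<longleftrightarrow> (\<forall>i j. coeff (coeff P j) i \<in> L)"
  by (auto simp: over2_def polys_over_def)

lemma
  fixes L :: "'a::comm_ring_1 set"
  assumes L: "pair_ring (Id_on L)"
  shows over2_1: "1 \<in> over2 L"
    and over2_diff: "P \<in> over2 L \<Longrightarrow> Q \<in> over2 L \<Longrightarrow> P - Q \<in> over2 L"
    and over2_add: "P \<in> over2 L \<Longrightarrow> Q \<in> over2 L \<Longrightarrow> P + Q \<in> over2 L"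
    and over2_mult: "P \<in> over2 L \<Longrightarrow> Q \<in> over2 L \<Longrightarrow> P * Q \<in> over2 L"
    and over2_const: "a \<in> L \<Longrightarrow> [:[:a:]:] \<in> over2 L"
    and over2_x: "[:[:0, 1:]:] \<in> over2 L"
    and over2_y: "[:0, 1:] \<in> over2 L"
proof -
  note L1 = pair_ring_polys_over[OF L] and L2 = pair_ring_polys_over[OF pair_ring_polys_over[OF L]]
  have 01: "0 \<in> L" "1 \<in> L" using pair_zero[OF L] pair_one[OF L] by auto
  show "1 \<in> over2 L" using pair_one[OF L2] by (simp add: over2_def)
  show "P \<in> over2 L \<Longrightarrow> Q \<in> over2 L \<Longrightarrow> P - Q \<in> over2 L" using pair_diff[OF L2] by (simp add: over2_def)
  show "P \<in> over2 L \<Longrightarrow> Q \<in> over2 L \<Longrightarrow> P + Q \<in> over2 L" using pair_add[OF L2] by (simp add: over2_def)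
  show "P \<in> over2 L \<Longrightarrow> Q \<in> over2 L \<Longrightarrow> P * Q \<in> over2 L" using pair_mult[OF L2] by (simp add: over2_def)
  show "a \<in> L \<Longrightarrow> [:[:a:]:] \<in> over2 L" "[:[:0, 1:]:] \<in> over2 L" "[:0, 1:] \<in> over2 L"
    using 01 by (auto simp: over2_iff coeff_pCons split: nat.splits)
qed

lemma pair_ring_alg_closure: "pair_ring (Id_on (alg_closure S))"
  by (auto simp: pair_ring_def alg_closure_1 alg_closure_diff alg_closure_mult)

lemma deriv_eval2:
  fixes x y :: "'a::idom"
  assumes D: "ring_derivation D"
  shows "D (eval2 P x y) = eval2 (map_poly (map_poly D) P) x y +
    eval2 (map_poly pderiv P) x y * D x + eval2 (pderiv P) x y * D y"
proof (induction P)
  case 0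
  then show ?case by (simp add: deriv_0[OF D])
next
  case (pCons q P)
  have "D (eval2 (pCons q P) x y) = D (poly q x) + (D y * eval2 P x y + y * D (eval2 P x y))"
    by (simp add: deriv_add[OF D] deriv_mult[OF D])
  also have "\<dots> = (poly (map_poly D q) x + poly (pderiv q) x * D x) + (D y * eval2 P x y +
      y * (eval2 (map_poly (map_poly D) P) x y + eval2 (map_poly pderiv P) x y * D x + eval2 (pderiv P) x y * D y))"
    by (simp only: deriv_poly[OF D] pCons.IH)
  also have "\<dots> = eval2 (map_poly (map_poly D) (pCons q P)) x y +
      eval2 (map_poly pderiv (pCons q P)) x y * D x + eval2 (pderiv (pCons q P)) x y * D y"
    by (simp add: map_poly_pCons pderiv_pCons algebra_simps)
  finally show ?case .
qed

lemma eval2_over_alg_closure: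
  assumes P: "P \<in> over2 L" and "L \<subseteq> alg_closure S" "x \<in> alg_closure S" "y \<in> alg_closure S"
  shows "eval2 P x y \<in> alg_closure S"
proof -
  have "(poly (coeff P j) x, poly (coeff P j) x) \<in> Id_on (alg_closure S)" for j
    using P assms(2,3) by (intro pair_poly[OF pair_ring_alg_closure]) (auto simp: over2_iff polys_over_def)
  then have "(poly (map_poly (\<lambda>q. poly q x) P) y, poly (map_poly (\<lambda>q. poly q x) P) y) \<in> Id_on (alg_closure S)"
    using assms(4) by (intro pair_poly[OF pair_ring_alg_closure]) (auto simp: polys_over_def coeff_map_poly)
  then show ?thesis by (auto simp: eval2_conv_map_poly)
qed

text \<open>Gauss's lemma: \<open>s\<close> divides the content of \<open>P * Q\<close>, which is
  the content of \<open>Q\<close> because \<open>P\<close> is primitive.\<close>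

lemma coprime_content_dvd_cancel:
  fixes P X :: "'a::{factorial_ring_gcd,semiring_gcd_mult_normalize} poly"
  assumes "content P = 1" "s \<noteq> 0" "P dvd [:s:] * X"
  shows "P dvd X"
proof -
  obtain Q where Q: "[:s:] * X = P * Q" using assms(3) by (auto simp: dvd_def)
  then have "s dvd content (P * Q)"
    by (metis const_poly_dvd_iff_dvd_content dvd_triv_left)
  then have "[:s:] dvd Q"
    using assms(1) by (simp add: content_mult const_poly_dvd_iff_dvd_content)
  then obtain Q' where "Q = [:s:] * Q'" by (auto simp: dvd_def)
  then have "[:s:] * X = [:s:] * (P * Q')" using Q by (simp add: mult_ac)
  then have "X = P * Q'" using \<open>s \<noteq> 0\<close> by (subst (asm) mult_cancel_left) simp
  then show ?thesis by simp
qed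

context generic_vf
begin

definition sol :: "'a \<Rightarrow> 'a \<Rightarrow> bool" where
  "sol x y \<longleftrightarrow> \<delta> x = eval2 (vp False) x y \<and> \<delta> y = eval2 (vp True) x y"

definition dclosed :: "'a set \<Rightarrow> bool" where
  "dclosed L \<longleftrightarrow> alg_closure L = L \<and> \<delta> ` L \<subseteq> L \<and> cf ` vf_index d \<subseteq> L"

lemma dclosed_pair_ring: "dclosed L \<Longrightarrow> pair_ring (Id_on L)"
  using pair_ring_alg_closure[of L] by (simp add: dclosed_def)

lemma dclosed_0: "dclosed L \<Longrightarrow> 0 \<in> L"
  using alg_closure_0[of L] by (simp add: dclosed_def)

lemma vp_over2: "dclosed L \<Longrightarrow> vp c \<in> over2 L"
  using dclosed_0[of L] by (auto simp: over2_iff coeff_vp dclosed_def vf_index_def)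

lemma deriv_sol:
  assumes "sol x y"
  shows "\<delta> (eval2 P x y) = eval2 (DD P) x y"
  using assms by (simp add: deriv_eval2[OF \<delta>] DD_def sol_def algebra_simps)

lemma pderiv_over2:
  assumes L: "dclosed L" and P: "P \<in> over2 L"
  shows "map_poly pderiv P \<in> over2 L" "pderiv P \<in> over2 L"
proof -
  have n: "of_nat k * x \<in> L" if "x \<in> L" for k x
    using pair_mult[OF dclosed_pair_ring[OF L] pair_of_nat[OF dclosed_pair_ring[OF L], of k], of x x] that by auto
  show "map_poly pderiv P \<in> over2 L" "pderiv P \<in> over2 L"
    using P n by (auto simp: over2_iff coeff_map_poly coeff_pderiv of_nat_poly simp del: of_nat_Suc)
qed

lemma DD_over2:
  assumes L: "dclosed L" and P: "P \<in> over2 L"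
  shows "DD P \<in> over2 L"
proof -
  have "map_poly (map_poly \<delta>) P \<in> over2 L"
    using P L by (auto simp: over2_iff coeff_map_poly coeff_map_deriv[OF \<delta>] dclosed_def)
  then show ?thesis
    unfolding DD_def using P L
    by (intro over2_add over2_mult vp_over2 pderiv_over2 dclosed_pair_ring)
qed

text \<open>\<open>y\<close> is a root of \<open>f(x, Y) - \<delta> x\<close>, a polynomial over
  \<open>L\<close> whose coefficient at \<open>Y^d\<close> is the nonzero constant
  \<open>cf (False, 0, d)\<close>. So a solution outside \<open>L\<close> has its first coordinate
  outside \<open>L\<close>.\<close>

lemma sol_fst_not_mem:
  assumes L: "dclosed L" and s: "sol x y" and "x \<in> L"
  shows "y \<in> L"
proof -
  let ?p = "map_poly (\<lambda>q. poly q x) (vp False) - [:\<delta> x:]"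
  have "y \<in> alg_closure L"
  proof (rule alg_closure_root)
    show "coeff ?p i \<in> alg_closure L" for i
    proof -
      have "(poly (coeff (vp False) i) x, poly (coeff (vp False) i) x) \<in> Id_on L"
        using vp_over2[OF L, of False] \<open>x \<in> L\<close>
        by (intro pair_poly[OF dclosed_pair_ring[OF L]]) (auto simp: over2_iff polys_over_def)
      moreover have "\<delta> x \<in> L" using L \<open>x \<in> L\<close> by (auto simp: dclosed_def)
      ultimately show ?thesis
        using alg_closure_base[of L] alg_closure_diff[of _ L] dclosed_0[OF L]
        by (auto simp: coeff_map_poly coeff_pCons split: nat.splits)
    qed
    have "coeff (coeff (vp False) d) i = coeff [:cf (False, 0, d):] i" for i
      by (auto simp: coeff_vp coeff_pCons split: nat.splits)
    then have "coeff (vp False) d = [:cf (False, 0, d):]"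
      by (rule poly_eqI)
    then have "coeff ?p d = cf (False, 0, d)"
      using d by (simp add: coeff_map_poly coeff_pCons split: nat.splits)
    then show "?p \<noteq> 0"
      using cf_nz[of "(False, 0, d)"] by (auto simp: vf_index_def simp del: coeff_diff)
    show "poly ?p y = 0"
      using s by (simp add: sol_def eval2_conv_map_poly)
  qed
  then show ?thesis using L by (simp add: dclosed_def)
qed

text \<open>For a relation \<open>M\<close> of least degree in \<open>y\<close>, the remainder of
  \<open>DD M\<close> under pseudo-division by \<open>M\<close> vanishes at the solution, hence is
  zero. After removal of factors in \<open>x\<close> alone by Gauss's lemma, \<open>M\<close>
  divides its image under \<open>DD\<close> and is an invariant curve.\<close>

theorem generic_over:
  assumes L: "dclosed L" and s: "sol x y" and "\<not> (x \<in> L \<and> y \<in> L)"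
    and P: "P \<in> over2 L" "eval2 P x y = 0"
  shows "P = 0"
proof (rule ccontr)
  assume "P \<noteq> 0"
  have "x \<notin> L" using sol_fst_not_mem[OF L s] assms(3) by blast
  let ?P = "\<lambda>P. P \<in> over2 L \<and> P \<noteq> 0 \<and> eval2 P x y = 0"
  obtain M where M: "M \<in> over2 L" "M \<noteq> 0" "eval2 M x y = 0"
    and min: "\<And>Q. ?P Q \<Longrightarrow> degree M \<le> degree Q"
    using ex_has_least_nat[of ?P P degree] P \<open>P \<noteq> 0\<close> by blast
  have "degree M \<noteq> 0"
  proof
    assume "degree M = 0"
    then obtain q where q: "M = [:q:]" by (rule degree_eq_zeroE)
    have "x \<in> alg_closure L"
    proof (rule alg_closure_root)
      show "coeff q i \<in> alg_closure L" for i
        using M(1) alg_closure_base[of L] by (auto simp: q over2_iff coeff_pCons split: nat.splits)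
      show "q \<noteq> 0" "poly q x = 0" using M by (auto simp: q)
    qed
    with \<open>x \<notin> L\<close> L show False by (simp add: dclosed_def)
  qed
  let ?\<Gamma> = "polys_over (Id_on L)"
  have "partial_iso ?\<Gamma>"
    using pair_ring_polys_over[OF dclosed_pair_ring[OF L]] by (auto simp: partial_iso_def polys_over_def poly_eq_iff)
  from pseudo_division[OF this, of "DD M" "DD M" M M] M DD_over2[OF L M(1)]
  obtain l q r r' where l: "l \<noteq> 0" and rr: "(r, r') \<in> polys_over ?\<Gamma>" and r: "smult l (DD M) = q * M + r"
      "r = 0 \<or> degree r < degree M"
    unfolding over2_def by blast
  have "r \<in> over2 L"
    using rr by (auto simp: over2_iff polys_over_def)
  have "poly l x * eval2 (DD M) x y = eval2 (q * M + r) x y"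
    unfolding r(1)[symmetric] by (simp add: eval2_def)
  then have "eval2 r x y = 0"
    using deriv_sol[OF s, of M] M(3) by (simp add: deriv_0[OF \<delta>])
  then have "r = 0"
    using min[of r] r(2) \<open>r \<in> over2 L\<close> by (meson not_le)
  then have dvd: "M dvd [:l:] * DD M" using r(1) by simp
  define M1 where "M1 = primitive_part M"
  define c where "c = content M"
  have M1: "M = [:c:] * M1" by (simp add: M1_def c_def)
  have "c \<noteq> 0" "M1 \<noteq> 0" using M(2) by (auto simp: c_def M1_def)
  have "M1 dvd M" unfolding M1 by (rule dvd_triv_right)
  then have "M1 dvd [:l:] * (DD [:c:] * M1 + [:c:] * DD M1)"
    using dvd unfolding DD_mult[symmetric] M1[symmetric] by (rule dvd_trans)
  then have "M1 dvd [:l:] * [:c:] * DD M1 + ([:l:] * DD [:c:]) * M1"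
    by (simp only: distrib_left mult_ac add.commute)
  then have "M1 dvd [:l * c:] * DD M1"
    by (simp only: dvd_add_times_triv_right_iff) (simp add: mult.commute)
  moreover have "content M1 = 1" using M(2) by (simp add: M1_def)
  ultimately have "M1 dvd DD M1"
    using l \<open>c \<noteq> 0\<close> coprime_content_dvd_cancel[of M1 "l * c" "DD M1"] by simp
  then obtain a where "M1 = [:[:a:]:]"
    using no_invariant_curve \<open>M1 \<noteq> 0\<close> by blast
  then have "degree M = 0" by (simp add: M1 degree_pCons_eq_if)
  with \<open>degree M \<noteq> 0\<close> show False by simp
qed

lemma ring_gen_insert:
  assumes "x \<in> ring_gen (insert t L)" "pair_ring (Id_on L)"
  shows "\<exists>q. (\<forall>i. coeff q i \<in> L) \<and> x = poly q t"
proof -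
  have iff: "(q, q) \<in> polys_over (Id_on L) \<longleftrightarrow> (\<forall>i. coeff q i \<in> L)" for q
    by (auto simp: polys_over_def)
  note R = pair_ring_polys_over[OF assms(2)]
  show ?thesis
    using assms(1)
  proof induction
    case (base x)
    have "(\<forall>i. coeff [:0, 1:] i \<in> L)" "x \<in> L \<Longrightarrow> (\<forall>i. coeff [:x:] i \<in> L)"
      using pair_zero[OF assms(2)] pair_one[OF assms(2)] by (auto simp: coeff_pCons split: nat.splits)
    with base show ?case by (auto intro: exI[of _ "[:0, 1:]"] exI[of _ "[:x:]"])
  next
    case one
    then show ?case using pair_one[OF R] iff[of 1] by (auto intro: exI[of _ 1])
  next
    case (diff x y)
    then obtain p q where "\<forall>i. coeff p i \<in> L" "x = poly p t" "\<forall>i. coeff q i \<in> L" "y = poly q t" by blast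
    then show ?case using pair_diff[OF R, of p p q q] iff by (intro exI[of _ "p - q"]) auto
  next
    case (mult x y)
    then obtain p q where "\<forall>i. coeff p i \<in> L" "x = poly p t" "\<forall>i. coeff q i \<in> L" "y = poly q t" by blast
    then show ?case using pair_mult[OF R, of p p q q] iff by (intro exI[of _ "p * q"]) auto
  qed
qed

text \<open>The partial derivatives with respect to \<open>x\<close> and \<open>y\<close>; they
  exist because the coordinates of a generic solution are algebraically independent over
  \<open>L\<close>.\<close>

lemma dual_derivations:
  assumes L: "dclosed L" and s: "sol x y" and ng: "\<not> (x \<in> L \<and> y \<in> L)"
  obtains E1 E2 where "ring_derivation E1" "ring_derivation E2"
    "\<And>s. s \<in> L \<Longrightarrow> E1 s = 0" "\<And>s. s \<in> L \<Longrightarrow> E2 s = 0"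
    "E1 x = 1" "E1 y = 0" "E2 x = 0" "E2 y = 1"
proof -
  have "x \<notin> L" using sol_fst_not_mem[OF L s] ng by blast
  have "y \<notin> alg_closure (insert x L)"
  proof
    assume "y \<in> alg_closure (insert x L)"
    then obtain p where p: "p \<noteq> 0" "\<And>i. coeff p i \<in> ring_gen (insert x L)" "poly p y = 0"
      using alg_closure_imp_algebraic[of y "insert x L"] by blast
    obtain q where q: "\<And>i j. coeff (q i) j \<in> L" "\<And>i. coeff p i = poly (q i) x"
      using ring_gen_insert[OF p(2) dclosed_pair_ring[OF L]] by metis
    define P where "P = (\<Sum>i\<le>degree p. monom (q i) i)"
    have coeff_P: "coeff P i = (if i \<le> degree p then q i else 0)" for i
      by (simp add: P_def coeff_sum)
    have "map_poly (\<lambda>q. poly q x) P = p"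
      by (rule poly_eqI) (auto simp: coeff_map_poly coeff_P q(2)[symmetric] coeff_eq_0)
    then have "eval2 P x y = 0" using p(3) by (simp add: eval2_conv_map_poly)
    moreover have "P \<in> over2 L"
      using q(1) dclosed_0[OF L] by (auto simp: over2_iff coeff_P)
    ultimately have "P = 0" using generic_over[OF L s ng] by blast
    then have "lead_coeff p = 0"
      using coeff_P[of "degree p"] q(2)[of "degree p"] by simp
    with p(1) show False by simp
  qed
  then obtain D where D: "ring_derivation D" "\<And>s. s \<in> L \<Longrightarrow> D s = 0" "D x = 0" "D y \<noteq> 0"
    by (auto simp: alg_closure_def)
  from \<open>x \<notin> L\<close> L have "x \<notin> alg_closure L" by (simp add: dclosed_def)
  then obtain D0 where D0: "ring_derivation D0" "\<And>s. s \<in> L \<Longrightarrow> D0 s = 0" "D0 x \<noteq> 0"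
    by (auto simp: alg_closure_def)
  show ?thesis
  proof (rule that)
    \<comment> \<open>\<open>D0\<close> is scaled to the value \<open>1\<close> at \<open>x\<close>
      and corrected by the multiple of \<open>D\<close> that makes it kill \<open>y\<close>.\<close>
    show "ring_derivation (\<lambda>s. inverse (D0 x) * D0 s + (- D0 y * inverse (D0 x) * inverse (D y)) * D s)"
      by (rule ring_derivation_lincomb[OF D0(1) D(1)])
    show "ring_derivation (\<lambda>s. inverse (D y) * D s)"
      by (rule ring_derivation_scale[OF D(1)])
  qed (use D D0 in auto)
qed

text \<open>No further derivatives have to be added: those of \<open>x\<close> and \<open>y\<close>
  are polynomials in \<open>x\<close> and \<open>y\<close> over \<open>L\<close>.\<close>

lemma dclosed_adjoin:
  assumes L: "dclosed L" and s: "sol x y"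
  shows "dclosed (alg_closure (L \<union> {x, y}))"
proof -
  let ?A = "alg_closure (L \<union> {x, y})"
  have sub: "L \<union> {x, y} \<subseteq> ?A" by (rule alg_closure_base)
  then have "eval2 (vp c) x y \<in> ?A" for c
    using vp_over2[OF L] by (intro eval2_over_alg_closure) auto
  then have "\<delta> t \<in> ?A" if "t \<in> L \<union> {x, y}" for t
    using that s L sub by (auto simp: sol_def dclosed_def)
  then have "\<delta> t \<in> ?A" if "t \<in> ?A" for t
    using alg_closure_deriv_closed[OF \<delta> _ that] by blast
  then show ?thesis
    using L sub by (auto simp: dclosed_def alg_closure_idem)
qed

section \<open>Liouville's formula and disintegration of generic solutions\<close>

definition divergence :: "'a \<Rightarrow> 'a \<Rightarrow> 'a" where
  "divergence x y = eval2 (map_poly pderiv (vp False) + pderiv (vp True)) x y"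

lemma deriv_vp:
  assumes L: "dclosed L" and E: "ring_derivation E" "\<And>s. s \<in> L \<Longrightarrow> E s = 0"
  shows "E (eval2 (vp c) x y) =
    eval2 (map_poly pderiv (vp c)) x y * E x + eval2 (pderiv (vp c)) x y * E y"
proof -
  have "map_poly (map_poly E) (vp c) = 0"
    using E(2) vp_over2[OF L, of c]
    by (intro poly_eqI) (simp add: coeff_map_poly coeff_map_deriv[OF E(1)] over2_iff)
  then show ?thesis by (simp add: deriv_eval2[OF E(1)])
qed

text \<open>If the solution \<open>z\<close> is algebraic over the solution \<open>a\<close>, the Jacobian determinant of \<open>z\<close>
  with respect to \<open>a\<close> satisfies the difference of the two traced variational equations.\<close>

lemma jacobian_determinant:
  assumes L: "dclosed L" and a: "sol a1 a2" "\<not> (a1 \<in> L \<and> a2 \<in> L)"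
    and z: "sol z1 z2" "\<not> (z1 \<in> L \<and> z2 \<in> L)"
    and alg: "z1 \<in> alg_closure (L \<union> {a1, a2})" "z2 \<in> alg_closure (L \<union> {a1, a2})"
  obtains m where "m \<noteq> 0" "m \<in> alg_closure (L \<union> {a1, a2})"
    "\<delta> m = (divergence z1 z2 - divergence a1 a2) * m"
proof -
  let ?A = "alg_closure (L \<union> {a1, a2})"
  obtain E1 E2 where E: "ring_derivation E1" "ring_derivation E2"
    "\<And>s. s \<in> L \<Longrightarrow> E1 s = 0" "\<And>s. s \<in> L \<Longrightarrow> E2 s = 0"
    "E1 a1 = 1" "E1 a2 = 0" "E2 a1 = 0" "E2 a2 = 1"
    using dual_derivations[OF L a] by metis
  obtain N1 N2 where N: "ring_derivation N1" "ring_derivation N2"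
    "\<And>s. s \<in> L \<Longrightarrow> N1 s = 0" "\<And>s. s \<in> L \<Longrightarrow> N2 s = 0"
    "N1 z1 = 1" "N1 z2 = 0" "N2 z1 = 0" "N2 z2 = 1"
    using dual_derivations[OF L z] by metis
  \<comment> \<open>On the closure of \<open>L\<close> and \<open>a\<close>, a derivation that kills
    \<open>L\<close> is determined by its values at \<open>a1\<close> and \<open>a2\<close>.\<close>
  have expand: "X t = X a1 * E1 t + X a2 * E2 t"
    if X: "ring_derivation X" "\<And>s. s \<in> L \<Longrightarrow> X s = 0" and "t \<in> ?A" for X t
    by (rule deriv_eq_on_alg_closure[OF X(1) ring_derivation_lincomb[OF E(1,2)] _ \<open>t \<in> ?A\<close>])
      (use X E in auto)
  define m where "m = E1 z1 * E2 z2 - E1 z2 * E2 z1"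
  \<comment> \<open>The chain rule: the Jacobian determinants of \<open>a\<close> with respect to
    \<open>z\<close> and of \<open>z\<close> with respect to \<open>a\<close> are inverse to each
    other.\<close>
  have "(N1 a1 * N2 a2 - N1 a2 * N2 a1) * m =
      (N1 a1 * E1 z1 + N1 a2 * E2 z1) * (N2 a1 * E1 z2 + N2 a2 * E2 z2)
      - (N1 a1 * E1 z2 + N1 a2 * E2 z2) * (N2 a1 * E1 z1 + N2 a2 * E2 z1)"
    by (simp add: m_def algebra_simps)
  also have "\<dots> = N1 z1 * N2 z2 - N1 z2 * N2 z1"
    by (simp only: expand[OF N(1,3) alg(1)] expand[OF N(1,3) alg(2)] expand[OF N(2,4) alg(1)] expand[OF N(2,4) alg(2)])
  finally have "m \<noteq> 0" using N by auto
  moreover have "m \<in> ?A"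
  proof -
    have "E1 t \<in> ?A" "E2 t \<in> ?A" if "t \<in> ?A" for t
      by (rule alg_closure_deriv_closed[OF _ _ that]; use E alg_closure_0 alg_closure_1 in force)+
    then show ?thesis
      unfolding m_def using alg by (intro alg_closure_diff alg_closure_mult)
  qed
  moreover have "\<delta> m = (divergence z1 z2 - divergence a1 a2) * m"
  proof -
    let ?x = "\<lambda>c x y. eval2 (map_poly pderiv (vp c)) x y" and ?y = "\<lambda>c x y. eval2 (pderiv (vp c)) x y"
    \<comment> \<open>The commutator of \<open>\<delta>\<close> and \<open>X\<close> kills
      \<open>L\<close>, since \<open>\<delta>\<close> maps \<open>L\<close> into itself, so
      \<open>expand\<close> applies to it. For \<open>E1\<close> and \<open>E2\<close> its values at
      \<open>a1\<close>, \<open>a2\<close> are, up to sign, the entries of the Jacobian matrix of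
      the field: this is the variational equation.\<close>
    have comm: "\<delta> (X t) = X (\<delta> t) + (X' a1 * E1 t + X' a2 * E2 t)"
      if X: "ring_derivation X" "\<And>s. s \<in> L \<Longrightarrow> X s = 0" and "t \<in> ?A"
        and X': "X' a1 = \<delta> (X a1) - X (\<delta> a1)" "X' a2 = \<delta> (X a2) - X (\<delta> a2)" for X X' t
    proof -
      let ?C = "\<lambda>t. \<delta> (X t) - X (\<delta> t)"
      have "?C t = ?C a1 * E1 t + ?C a2 * E2 t"
      proof (rule expand)
        show "ring_derivation ?C" by (rule ring_derivation_commutator[OF \<delta> X(1)])
        show "?C s = 0" if "s \<in> L" for s
          using L X(2) that by (auto simp: dclosed_def deriv_0[OF \<delta>])
      qed fact
      then show ?thesis by (simp add: X' algebra_simps)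
    qed
    have \<delta>a: "\<delta> a1 = eval2 (vp False) a1 a2" "\<delta> a2 = eval2 (vp True) a1 a2"
      and \<delta>z: "\<delta> z1 = eval2 (vp False) z1 z2" "\<delta> z2 = eval2 (vp True) z1 z2"
      using a z by (auto simp: sol_def)
    have dv: "E1 (eval2 (vp c) x y) = ?x c x y * E1 x + ?y c x y * E1 y"
      "E2 (eval2 (vp c) x y) = ?x c x y * E2 x + ?y c x y * E2 y" for c x y
      by (rule deriv_vp[OF L E(1,3)] deriv_vp[OF L E(2,4)]; assumption)+
    \<comment> \<open>\<open>X'\<close> merely records two values; \<open>a1 = a2\<close> is
      excluded by \<open>E1 a1 = 1\<close> and \<open>E1 a2 = 0\<close>.\<close>
    have c1: "\<delta> (E1 t) = E1 (\<delta> t) + (- ?x False a1 a2 * E1 t + - ?x True a1 a2 * E2 t)" if "t \<in> ?A" for t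
      using comm[OF E(1,3) that, of "\<lambda>s. if s = a1 then - ?x False a1 a2 else - ?x True a1 a2"]
      by (cases "a1 = a2") (use E in \<open>auto simp: \<delta>a dv deriv_0[OF \<delta>] deriv_1[OF \<delta>]\<close>)
    have c2: "\<delta> (E2 t) = E2 (\<delta> t) + (- ?y False a1 a2 * E1 t + - ?y True a1 a2 * E2 t)" if "t \<in> ?A" for t
      using comm[OF E(2,4) that, of "\<lambda>s. if s = a1 then - ?y False a1 a2 else - ?y True a1 a2"]
      by (cases "a1 = a2") (use E in \<open>auto simp: \<delta>a dv deriv_0[OF \<delta>] deriv_1[OF \<delta>]\<close>)
    have "\<delta> m = \<delta> (E1 z1) * E2 z2 + E1 z1 * \<delta> (E2 z2) - (\<delta> (E1 z2) * E2 z1 + E1 z2 * \<delta> (E2 z1))"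
      by (simp add: m_def deriv_diff[OF \<delta>] deriv_mult[OF \<delta>])
    also have "\<dots> = (?x False z1 z2 + ?y True z1 z2 - ?x False a1 a2 - ?y True a1 a2) * m"
      unfolding c1[OF alg(1)] c1[OF alg(2)] c2[OF alg(1)] c2[OF alg(2)] \<delta>z
        dv m_def
      by (simp add: algebra_simps)
    finally show ?thesis by (simp add: divergence_def algebra_simps)
  qed
  ultimately show ?thesis by (rule that)
qed

end


lemma alg_closure_Un: "alg_closure (alg_closure S \<union> T) = alg_closure (S \<union> T)"
proof (rule subset_antisym)
  have "alg_closure S \<union> T \<subseteq> alg_closure (S \<union> T)"
    using alg_closure_mono[of S "S \<union> T"] alg_closure_base[of "S \<union> T"] by auto
  then show "alg_closure (alg_closure S \<union> T) \<subseteq> alg_closure (S \<union> T)"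
    by (rule alg_closure_least)
  show "alg_closure (S \<union> T) \<subseteq> alg_closure (alg_closure S \<union> T)"
    using alg_closure_base[of S] by (intro alg_closure_mono) auto
qed

context generic_vf
begin

text \<open>Applying \<open>\<delta>\<close> to a relation of least degree \<open>r\<close> for
  \<open>m\<close> over \<open>R = L[a1, a2]\<close> gives a proportional relation, so the quotient
  of its constant and leading coefficients satisfies the same linear equation as
  \<open>m ^ r\<close>, now inside the fraction field of \<open>R\<close>.\<close>

lemma no_divergence_logarithm:
  assumes L: "dclosed L" and a: "sol a1 a2" "\<not> (a1 \<in> L \<and> a2 \<in> L)"
    and m: "m \<in> alg_closure (L \<union> {a1, a2})" "m \<noteq> 0" and "c \<in> L"
    and \<delta>m: "\<delta> m = (c - divergence a1 a2) * m"
  shows False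
proof -
  note LR = dclosed_pair_ring[OF L]
  define divp where "divp = map_poly pderiv (vp False) + pderiv (vp True)"
  define H where "H = [:[:c:]:] - divp"
  have H: "H \<in> over2 L" "c - divergence a1 a2 = eval2 H a1 a2"
    unfolding H_def divp_def using L \<open>c \<in> L\<close>
    by (intro over2_diff over2_add over2_const pderiv_over2 vp_over2 LR) (simp_all add: divergence_def)
  define R where "R = (\<lambda>P. eval2 P a1 a2) ` over2 L"
  have R1: "1 \<in> R" unfolding R_def using over2_1[OF LR] by (intro image_eqI[of _ _ 1]) auto
  have Rdm: "u - v \<in> R" "u * v \<in> R" if uv: "u \<in> R" "v \<in> R" for u v
  proof -
    obtain P Q where P: "P \<in> over2 L" "Q \<in> over2 L" "u = eval2 P a1 a2" "v = eval2 Q a1 a2"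
      using uv unfolding R_def by blast
    have "eval2 (P - Q) a1 a2 \<in> R" "eval2 (P * Q) a1 a2 \<in> R"
      unfolding R_def using over2_diff[OF LR P(1,2)] over2_mult[OF LR P(1,2)] by blast+
    then show "u - v \<in> R" "u * v \<in> R"
      by (simp_all add: P)
  qed
  have R: "pair_ring (Id_on R)"
    using R1 Rdm by (auto simp: pair_ring_def)
  have R\<delta>: "\<delta> u \<in> R" if "u \<in> R" for u
    using that DD_over2[OF L] deriv_sol[OF a(1)] by (auto simp: R_def)
  have "L \<union> {a1, a2} \<subseteq> R"
  proof -
    have "eval2 [:[:0, 1:]:] a1 a2 = a1" "eval2 [:0, 1:] a1 a2 = a2" "\<And>s. eval2 [:[:s:]:] a1 a2 = s"
      by simp_all
    then show ?thesis
      unfolding R_def using over2_const[OF LR] over2_x[OF LR] over2_y[OF LR]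
      by (force intro: rev_image_eqI)
  qed
  have gen: "ring_gen (L \<union> {a1, a2}) \<subseteq> R"
  proof
    fix x assume "x \<in> ring_gen (L \<union> {a1, a2})"
    then show "x \<in> R"
    proof induction
      case (base x)
      then show ?case using \<open>L \<union> {a1, a2} \<subseteq> R\<close> by blast
    qed (use R1 Rdm in auto)
  qed
  let ?P = "\<lambda>p. p \<noteq> 0 \<and> (\<forall>i. coeff p i \<in> R) \<and> poly p m = 0"
  obtain p0 where "p0 \<noteq> 0" "\<And>i. coeff p0 i \<in> ring_gen (L \<union> {a1, a2})" "poly p0 m = 0"
    using alg_closure_imp_algebraic[OF m(1)] by blast
  then have "?P p0" using gen by blast
  then obtain p where p: "p \<noteq> 0" "\<And>i. coeff p i \<in> R" "poly p m = 0"
    and min: "\<And>q. ?P q \<Longrightarrow> degree p \<le> degree q"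
    using ex_has_least_nat[of ?P p0 degree] by blast
  define r where "r = degree p"
  have "r \<noteq> 0" using degree_pos_if_root[OF p(1,3)] by (simp add: r_def)
  have "coeff p 0 \<noteq> 0"
  proof
    assume "coeff p 0 = 0"
    then obtain q where q: "p = pCons 0 q" by (cases p) auto
    have "coeff q i \<in> R" for i using p(2)[of "Suc i"] q by simp
    then have "?P q" using p m(2) q by auto
    from min[OF this] p(1) show False by (simp add: q degree_pCons_eq_if split: if_splits)
  qed
  define h where "h = eval2 H a1 a2"
  have "h \<in> R" using H(1) by (simp add: h_def R_def)
  define q where "q = map_poly \<delta> p + smult h (var * pderiv p)"
  have coeff_q: "coeff q i = \<delta> (coeff p i) + h * (of_nat i * coeff p i)" for i
    by (cases i) (simp_all add: q_def coeff_map_deriv[OF \<delta>] coeff_var_mult coeff_pderiv)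
  have "poly q m = \<delta> (poly p m)"
    unfolding deriv_poly[OF \<delta>] \<delta>m H(2) by (simp add: q_def h_def var_def mult_ac)
  then have "poly q m = 0" by (simp add: p(3) deriv_0[OF \<delta>])
  have q_R: "coeff q i \<in> R" for i
  proof -
    have "(coeff q i, coeff q i) \<in> Id_on R"
      unfolding coeff_q using R\<delta>[OF p(2)] \<open>h \<in> R\<close> p(2)
      by (intro pair_add[OF R] pair_mult[OF R] pair_of_nat[OF R]) auto
    then show ?thesis by auto
  qed
  define s where "s = smult (coeff p r) q - smult (coeff q r) p"
  have "degree q \<le> r"
    by (rule degree_le) (simp add: coeff_q r_def coeff_eq_0 deriv_0[OF \<delta>])
  have "s = 0"
  proof (rule ccontr)
    assume "s \<noteq> 0"
    have "degree s \<le> r"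
      unfolding s_def using \<open>degree q \<le> r\<close>
      by (intro degree_diff_le order_trans[OF degree_smult_le]) (auto simp: r_def)
    moreover have "coeff s r = 0" by (simp add: s_def)
    ultimately have "degree s < r"
      using \<open>s \<noteq> 0\<close> by (metis le_neq_implies_less leading_coeff_0_iff)
    moreover have "?P s"
    proof (intro conjI allI)
      show "poly s m = 0" by (simp add: s_def \<open>poly q m = 0\<close> p(3))
      fix i
      have "(coeff s i, coeff s i) \<in> Id_on R"
        unfolding s_def coeff_diff coeff_smult using p(2) q_R
        by (intro pair_diff[OF R] pair_mult[OF R]) auto
      then show "coeff s i \<in> R" by auto
    qed fact
    ultimately show False using min[of s] by (simp add: r_def)
  qed
  then have s0: "coeff p r * \<delta> (coeff p 0) = (\<delta> (coeff p r) + h * (of_nat r * coeff p r)) * coeff p 0"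
  proof -
    have "coeff s 0 = 0" using \<open>s = 0\<close> by simp
    then show ?thesis unfolding s_def coeff_diff coeff_smult coeff_q by simp
  qed
  obtain A B where AB: "A \<in> over2 L" "B \<in> over2 L" "coeff p 0 = eval2 A a1 a2" "coeff p r = eval2 B a1 a2"
    using p(2) unfolding R_def by blast
  have "A \<noteq> 0" "B \<noteq> 0" using AB p(1) \<open>coeff p 0 \<noteq> 0\<close> by (auto simp: r_def)
  \<comment> \<open>Genericity of \<open>a\<close> turns the identity of values into an identity of
    polynomials.\<close>
  have "B * DD A - A * (DD B + H * ([:[:of_nat r:]:] * B)) = 0"
  proof (rule generic_over[OF L a])
    have "(of_nat r, of_nat r) \<in> Id_on L" by (rule pair_of_nat[OF LR])
    then show "B * DD A - A * (DD B + H * ([:[:of_nat r:]:] * B)) \<in> over2 L"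
      using AB H(1) L by (intro over2_diff over2_add over2_mult over2_const DD_over2 LR) auto
    show "eval2 (B * DD A - A * (DD B + H * ([:[:of_nat r:]:] * B))) a1 a2 = 0"
      using s0 by (simp add: AB(3,4) deriv_sol[OF a(1)] h_def del: mult_pCons_left mult_pCons_right)
  qed
  then have AB_eq: "B * DD A - A * DD B = [:[:of_nat r:]:] * H * A * B"
    by (simp add: algebra_simps del: mult_pCons_left mult_pCons_right)
  \<comment> \<open>A common factor contributes nothing to the logarithmic derivative of
    \<open>A / B\<close>. Coprimality then makes \<open>A1\<close> and \<open>B1\<close> divide
    their own images under \<open>DD\<close>.\<close>
  define G where "G = gcd A B"
  have "G \<noteq> 0" using \<open>A \<noteq> 0\<close> by (simp add: G_def)
  then obtain A1 B1 where "A = A1 * G" "B = B1 * G" and cop: "coprime A1 B1"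
    using gcd_coprime_exists[of A B] unfolding G_def by blast
  then have A1: "A = G * A1" and B1: "B = G * B1"
    unfolding mult.commute[of G] by blast+
  have "G * G * (B1 * DD A1 - A1 * DD B1) = G * G * ([:[:of_nat r:]:] * H * A1 * B1)"
    using AB_eq unfolding A1 B1 DD_mult
    by (simp add: algebra_simps del: mult_pCons_left mult_pCons_right)
  then have eq: "B1 * DD A1 - A1 * DD B1 = [:[:of_nat r:]:] * H * A1 * B1"
    using \<open>G \<noteq> 0\<close> by (simp del: mult_pCons_left mult_pCons_right)
  then have "B1 * DD A1 = A1 * (DD B1 + [:[:of_nat r:]:] * H * B1)"
    "A1 * DD B1 = B1 * (DD A1 - [:[:of_nat r:]:] * H * A1)"
    by (simp_all add: algebra_simps del: mult_pCons_left mult_pCons_right)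
  then have "A1 dvd B1 * DD A1" "B1 dvd A1 * DD B1" by simp_all
  then have "A1 dvd DD A1" "B1 dvd DD B1"
    using cop by (simp_all add: coprime_dvd_mult_right_iff coprime_commute)
  moreover have "A1 \<noteq> 0" "B1 \<noteq> 0" using \<open>A \<noteq> 0\<close> \<open>B \<noteq> 0\<close> A1 B1 by auto
  ultimately obtain \<alpha> \<beta> where \<alpha>: "A1 = [:[:\<alpha>:]:]" "\<alpha> \<noteq> 0" and \<beta>: "B1 = [:[:\<beta>:]:]" "\<beta> \<noteq> 0"
    using no_invariant_curve[of A1] no_invariant_curve[of B1] by metis
  \<comment> \<open>With \<open>A1\<close> and \<open>B1\<close> constant, \<open>H\<close> is
    constant too. The coefficient of \<open>x^(d-1)\<close> in the divergence is
    \<open>of_nat d * cf (False, d, 0) + cf (True, d - 1, 1)\<close>, which independence prevents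
    from vanishing.\<close>
  from arg_cong[OF eq, of "\<lambda>P. coeff (coeff P 0) (d - 1)"] have "coeff (coeff H 0) (d - 1) = 0"
    using d \<alpha> \<beta> \<open>r \<noteq> 0\<close> by (auto simp: DD_const coeff_pCons mult_ac split: nat.splits)
  then have "coeff (coeff divp 0) (d - 1) = 0"
    using d by (auto simp: H_def coeff_pCons split: nat.splits)
  then have zero: "of_nat d * cf (False, d, 0) + cf (True, d - 1, 1) = 0"
    using d by (simp add: divp_def coeff_map_poly coeff_pderiv coeff_vp of_nat_poly del: of_nat_Suc) simp
  define b :: "bool \<times> nat \<times> nat \<Rightarrow> 'a" where "b k = (if k = (False, d, 0) then 1 else 0)" for k
  obtain D where D: "ring_derivation D" "\<And>k. k \<in> vf_index d \<Longrightarrow> D (cf k) = b k"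
    using cf_der by blast
  have "D (cf (False, d, 0)) = 1" "D (cf (True, d - 1, 1)) = 0"
    using d by (simp_all add: D(2) vf_index_def b_def)
  then have "D (of_nat d * cf (False, d, 0) + cf (True, d - 1, 1)) = of_nat d"
    by (simp add: deriv_add[OF D(1)] deriv_mult[OF D(1)] deriv_of_nat[OF D(1)])
  with zero d show False by (simp add: deriv_0[OF D(1)])
qed

theorem two_solutions_disintegrated:
  assumes L: "dclosed L" and a: "sol a1 a2" and b: "sol b1 b2" and z: "sol z1 z2"
    and mem: "{z1, z2} \<subseteq> alg_closure (L \<union> {a1, a2} \<union> {b1, b2})"
  shows "{z1, z2} \<subseteq> alg_closure (L \<union> {a1, a2}) \<or> {z1, z2} \<subseteq> alg_closure (L \<union> {b1, b2})"
proof (rule ccontr)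
  let ?A = "alg_closure (L \<union> {a1, a2})" and ?B = "alg_closure (L \<union> {b1, b2})"
  let ?C = "alg_closure (L \<union> {a1, a2} \<union> {b1, b2})"
  assume neg: "\<not> ({z1, z2} \<subseteq> ?A \<or> {z1, z2} \<subseteq> ?B)"
  have CB: "alg_closure (?B \<union> {a1, a2}) = ?C" and CA: "alg_closure (?A \<union> {b1, b2}) = ?C"
    by (simp_all only: alg_closure_Un) (simp add: Un_ac)
  have dA: "dclosed ?A" and dB: "dclosed ?B"
    using dclosed_adjoin[OF L] a b by auto
  have zA: "\<not> (z1 \<in> ?A \<and> z2 \<in> ?A)" and zB: "\<not> (z1 \<in> ?B \<and> z2 \<in> ?B)"
    using neg by auto
  have aB: "\<not> (a1 \<in> ?B \<and> a2 \<in> ?B)"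
  proof
    assume "a1 \<in> ?B \<and> a2 \<in> ?B"
    then have "?C \<subseteq> ?B"
      using CB alg_closure_idem[of "L \<union> {b1, b2}"] alg_closure_least[of "?B \<union> {a1, a2}" "L \<union> {b1, b2}"] by auto
    with mem zB show False by auto
  qed
  have bA: "\<not> (b1 \<in> ?A \<and> b2 \<in> ?A)"
  proof
    assume "b1 \<in> ?A \<and> b2 \<in> ?A"
    then have "?C \<subseteq> ?A"
      using CA alg_closure_idem[of "L \<union> {a1, a2}"] alg_closure_least[of "?A \<union> {b1, b2}" "L \<union> {a1, a2}"] by auto
    with mem zA show False by auto
  qed
  obtain m where m: "m \<noteq> 0" "m \<in> ?C" "\<delta> m = (divergence z1 z2 - divergence a1 a2) * m"
    using jacobian_determinant[OF dB a aB z zB] mem unfolding CB by auto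
  obtain n where n: "n \<noteq> 0" "n \<in> ?C" "\<delta> n = (divergence z1 z2 - divergence b1 b2) * n"
    using jacobian_determinant[OF dA b bA z zA] mem unfolding CA by auto
  have "\<delta> (m / n) = (divergence b1 b2 - divergence a1 a2) * (m / n)"
    using n(1) by (simp add: deriv_divide[OF \<delta>] m(3) n(3) field_simps)
  moreover have "divergence b1 b2 \<in> ?B"
  proof -
    have "map_poly pderiv (vp False) + pderiv (vp True) \<in> over2 L"
      using L by (intro over2_add pderiv_over2 vp_over2 dclosed_pair_ring)
    then show ?thesis
      unfolding divergence_def using alg_closure_base[of "L \<union> {b1, b2}"]
      by (intro eval2_over_alg_closure) auto
  qed
  moreover have "m / n \<in> alg_closure (?B \<union> {a1, a2})"
    unfolding CB using m n by (intro alg_closure_divide)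
  ultimately show False
    using no_divergence_logarithm[OF dB a aB] m(1) n(1) by fastforce
qed

text \<open>The differential-algebraic closure, not the definable closure that the name suggests.
  For points of the solution set it is shown below to agree with model-theoretic algebraic
  closure.\<close>

definition dcl :: "'a set \<Rightarrow> 'a set" where
  "dcl C = alg_closure {(\<delta> ^^ i) c | c i. c \<in> C}"

lemma dcl_base: "C \<subseteq> dcl C"
proof
  fix c assume "c \<in> C"
  then have "(\<delta> ^^ 0) c \<in> {(\<delta> ^^ i) c | c i. c \<in> C}" by blast
  then have "c \<in> {(\<delta> ^^ i) c | c i. c \<in> C}" unfolding funpow_0 .
  then show "c \<in> dcl C" unfolding dcl_def by (rule subsetD[OF alg_closure_base])
qed

lemma dcl_deriv: "x \<in> dcl C \<Longrightarrow> \<delta> x \<in> dcl C"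
  unfolding dcl_def
proof (erule alg_closure_deriv_closed[OF \<delta>, rotated])
  fix s assume "s \<in> {(\<delta> ^^ i) c | c i. c \<in> C}"
  then obtain c i where "c \<in> C" "s = (\<delta> ^^ i) c" by blast
  then have "\<delta> s = (\<delta> ^^ Suc i) c" by simp
  then have "\<delta> s \<in> {(\<delta> ^^ i) c | c i. c \<in> C}" using \<open>c \<in> C\<close> by blast
  then show "\<delta> s \<in> alg_closure {(\<delta> ^^ i) c | c i. c \<in> C}"
    by (rule subsetD[OF alg_closure_base])
qed

lemma dcl_least:
  assumes "C \<subseteq> L" "alg_closure L = L" "\<delta> ` L \<subseteq> L"
  shows "dcl C \<subseteq> L"
proof -
  have "(\<delta> ^^ i) c \<in> L" if "c \<in> C" for c i
    by (induction i) (use assms that in auto)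
  then have "{(\<delta> ^^ i) c | c i. c \<in> C} \<subseteq> alg_closure L"
    using assms(2) by auto
  from alg_closure_least[OF this] show ?thesis
    by (simp add: dcl_def assms(2))
qed

lemma alg_closure_dcl: "alg_closure (dcl C) = dcl C"
  by (simp add: dcl_def alg_closure_idem)

lemma dcl_subset: "C \<subseteq> dcl E \<Longrightarrow> dcl C \<subseteq> dcl E"
  by (rule dcl_least) (auto simp: alg_closure_dcl dcl_deriv)

lemma dcl_mono: "C \<subseteq> E \<Longrightarrow> dcl C \<subseteq> dcl E"
  using dcl_base by (intro dcl_subset) blast

lemma dclosed_dcl: "cf ` vf_index d \<subseteq> C \<Longrightarrow> dclosed (dcl C)"
  using dcl_base by (auto simp: dclosed_def alg_closure_dcl dcl_deriv)

lemma dcl_adjoin: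
  assumes "cf ` vf_index d \<subseteq> C" "sol x y"
  shows "dcl (C \<union> {x, y}) = alg_closure (dcl C \<union> {x, y})"
proof (rule subset_antisym)
  have "dclosed (alg_closure (dcl C \<union> {x, y}))"
    by (intro dclosed_adjoin dclosed_dcl assms)
  then show "dcl (C \<union> {x, y}) \<subseteq> alg_closure (dcl C \<union> {x, y})"
    using dcl_base[of C] alg_closure_base[of "dcl C \<union> {x, y}"]
    by (intro dcl_least) (auto simp: dclosed_def)
  have "dcl C \<union> {x, y} \<subseteq> dcl (C \<union> {x, y})"
    using dcl_base[of "C \<union> {x, y}"] dcl_mono[of C "C \<union> {x, y}"] by auto
  then show "alg_closure (dcl C \<union> {x, y}) \<subseteq> dcl (C \<union> {x, y})"
    using alg_closure_mono[of "dcl C \<union> {x, y}" "dcl (C \<union> {x, y})"] by (simp add: alg_closure_dcl)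
qed

text \<open>The new solution is first moved into the parameters, which is why \<open>C\<close> is
  generalized in the induction; this leaves one other solution, and the statement for two solutions
  decides.\<close>

theorem solutions_disintegrated:
  assumes "finite A" "A \<noteq> {}" and "\<And>a. a \<in> A \<Longrightarrow> \<exists>x y. a = [x, y] \<and> sol x y"
    and "sol z1 z2" "{z1, z2} \<subseteq> dcl ((\<Union>a\<in>A. set a) \<union> C)" "cf ` vf_index d \<subseteq> C"
  shows "\<exists>a\<in>A. {z1, z2} \<subseteq> dcl (set a \<union> C)"
  using assms
proof (induction A arbitrary: C rule: finite_ne_induct)
  case (singleton a)
  then show ?case by simp
next
  case (insert a A)
  obtain x y where a: "a = [x, y]" "sol x y" using insert.prems(1) by blast
  have cfC: "cf ` vf_index d \<subseteq> set a \<union> C" using insert.prems(4) by blast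
  have "(\<Union>a\<in>insert a A. set a) \<union> C = (\<Union>a\<in>A. set a) \<union> (set a \<union> C)" by auto
  then obtain b where b: "b \<in> A" "{z1, z2} \<subseteq> dcl (set b \<union> (set a \<union> C))"
    using insert.IH[of "set a \<union> C"] insert.prems(1-3) cfC by auto
  obtain u v where uv: "b = [u, v]" "sol u v" using insert.prems(1) b(1) by blast
  have "dcl (C \<union> {x, y} \<union> {u, v}) = alg_closure (dcl C \<union> {x, y} \<union> {u, v})"
  proof -
    have "dcl (C \<union> {x, y} \<union> {u, v}) = alg_closure (dcl (C \<union> {x, y}) \<union> {u, v})"
      using insert.prems(4) uv(2) by (intro dcl_adjoin) auto
    also have "dcl (C \<union> {x, y}) = alg_closure (dcl C \<union> {x, y})"
      using insert.prems(4) a(2) by (intro dcl_adjoin) auto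
    also have "alg_closure (alg_closure (dcl C \<union> {x, y}) \<union> {u, v}) = alg_closure (dcl C \<union> {x, y} \<union> {u, v})"
      by (rule alg_closure_Un)
    finally show ?thesis .
  qed
  moreover have "set b \<union> (set a \<union> C) = C \<union> {x, y} \<union> {u, v}"
    by (auto simp: a uv)
  ultimately have "{z1, z2} \<subseteq> alg_closure (dcl C \<union> {x, y} \<union> {u, v})" using b(2) by simp
  then have "{z1, z2} \<subseteq> dcl (C \<union> {x, y}) \<or> {z1, z2} \<subseteq> dcl (C \<union> {u, v})"
    using two_solutions_disintegrated[OF dclosed_dcl a(2) uv(2) insert.prems(2)]
    unfolding dcl_adjoin[OF insert.prems(4) a(2)] dcl_adjoin[OF insert.prems(4) uv(2)]
    using insert.prems(4) by blast
  moreover have "set a \<union> C = C \<union> {x, y}" "set b \<union> C = C \<union> {u, v}" by (auto simp: a uv)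
  ultimately have "{z1, z2} \<subseteq> dcl (set a \<union> C) \<or> {z1, z2} \<subseteq> dcl (set b \<union> C)"
    by simp
  then show ?case using b(1) by blast
qed

end


section \<open>Ultrapowers\<close>

text \<open>A maximal proper filter. Being finer than \<open>sequentially\<close> makes it
  nonprincipal; both saturation and the passage from infinite sets to new points use this.\<close>

lemma ex_ultrafilter:
  "\<exists>F. F \<le> sequentially \<and> F \<noteq> bot \<and> (\<forall>P. eventually P F \<or> eventually (\<lambda>n. \<not> P n) F)"
proof -
  define \<A> where "\<A> = {A :: nat set set. {} \<notin> A \<and> (\<forall>X\<in>A. \<forall>Y\<in>A. X \<inter> Y \<in> A) \<and>
    (\<forall>X\<in>A. \<forall>Y. X \<subseteq> Y \<longrightarrow> Y \<in> A) \<and> (\<forall>k. {k..} \<in> A)}"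
  have "\<exists>M\<in>\<A>. \<forall>X\<in>\<A>. M \<subseteq> X \<longrightarrow> X = M"
  proof (rule subset_Zorn_nonempty)
    have "{X. \<exists>k. {k..} \<subseteq> X} \<in> \<A>"
      unfolding \<A>_def
    proof (intro CollectI conjI ballI allI impI; (elim CollectE exE)?)
      show "{} \<notin> {X. \<exists>k::nat. {k..} \<subseteq> X}" by auto
      fix X Y and k l :: nat assume "{k..} \<subseteq> X" "{l..} \<subseteq> Y"
      then have "{max k l..} \<subseteq> X \<inter> Y" by auto
      then show "\<exists>k. {k..} \<subseteq> X \<inter> Y" by blast
    qed auto
    then show "\<A> \<noteq> {}" by blast
    fix C assume "C \<noteq> {}" and C: "subset.chain \<A> C"
    then have in\<A>: "\<And>A. A \<in> C \<Longrightarrow> A \<in> \<A>" and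
      tot: "\<And>A B. A \<in> C \<Longrightarrow> B \<in> C \<Longrightarrow> A \<subseteq> B \<or> B \<subseteq> A"
      by (auto simp: subset.chain_def)
    have "X \<inter> Y \<in> \<Union>C" if "X \<in> \<Union>C" "Y \<in> \<Union>C" for X Y
    proof -
      from that obtain A where "A \<in> C" "X \<in> A" "Y \<in> A" using tot by blast
      then show ?thesis using in\<A>[of A] by (auto simp: \<A>_def)
    qed
    moreover have "{} \<notin> \<Union>C"
      using in\<A> by (auto simp: \<A>_def)
    moreover have "Y \<in> \<Union>C" if "X \<in> \<Union>C" "X \<subseteq> Y" for X Y
    proof -
      from that obtain A where "A \<in> C" "X \<in> A" by blast
      moreover from this have "Y \<in> A" using in\<A>[of A] that(2) unfolding \<A>_def by blast
      ultimately show ?thesis by blast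
    qed
    moreover have "{k..} \<in> \<Union>C" for k
    proof -
      from \<open>C \<noteq> {}\<close> obtain A where "A \<in> C" by blast
      then show ?thesis using in\<A>[of A] by (auto simp: \<A>_def)
    qed
    ultimately show "\<Union>C \<in> \<A>"
      by (simp add: \<A>_def)
  qed
  then obtain A where A: "A \<in> \<A>" and max: "\<And>B. B \<in> \<A> \<Longrightarrow> A \<subseteq> B \<Longrightarrow> B = A" by blast
  have "{0..} \<in> A" using A unfolding \<A>_def by blast
  then have UNIV: "UNIV \<in> A" by (simp add: atLeast_0)
  have ultra: "X \<in> A \<or> - X \<in> A" for X
  proof (rule disjCI)
    assume "- X \<notin> A"
    define B where "B = {Y. \<exists>Z\<in>A. Z \<inter> X \<subseteq> Y}"
    have "B \<in> \<A>"
      unfolding \<A>_def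
    proof (intro CollectI conjI ballI allI impI)
      show "{} \<notin> B"
      proof
        assume "{} \<in> B"
        then obtain Z where "Z \<in> A" "Z \<subseteq> - X" by (auto simp: B_def)
        with A \<open>- X \<notin> A\<close> show False by (auto simp: \<A>_def)
      qed
      fix Y Z assume "Y \<in> B" "Z \<in> B"
      then obtain U V where "U \<in> A" "V \<in> A" "U \<inter> X \<subseteq> Y" "V \<inter> X \<subseteq> Z" by (auto simp: B_def)
      moreover have "U \<inter> V \<in> A" using A calculation by (auto simp: \<A>_def)
      ultimately show "Y \<inter> Z \<in> B" by (auto simp: B_def intro!: bexI[of _ "U \<inter> V"])
    qed (use A in \<open>auto simp: \<A>_def B_def\<close>)
    moreover have "A \<subseteq> B" by (auto simp: B_def)
    ultimately have "B = A" by (rule max)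
    moreover have "X \<in> B" using UNIV by (auto simp: B_def intro!: bexI[of _ UNIV])
    ultimately show "X \<in> A" by simp
  qed
  define F where "F = Abs_filter (\<lambda>P. {n. P n} \<in> A)"
  have "is_filter (\<lambda>P. {n. P n} \<in> A)"
  proof
    show "{n. True} \<in> A" using UNIV by simp
    show "{n. P n \<and> Q n} \<in> A" if "{n. P n} \<in> A" "{n. Q n} \<in> A" for P Q
      using A that unfolding \<A>_def Collect_conj_eq by blast
    show "{n. Q n} \<in> A" if "\<forall>n. P n \<longrightarrow> Q n" "{n. P n} \<in> A" for P Q
      using A that(2) Collect_mono[of P Q] that(1) unfolding \<A>_def by blast
  qed
  then have F: "eventually P F \<longleftrightarrow> {n. P n} \<in> A" for P
    unfolding F_def by (rule eventually_Abs_filter)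
  have "F \<le> sequentially"
  proof (rule filter_leI)
    fix P :: "nat \<Rightarrow> bool" assume "eventually P sequentially"
    then obtain k where "{k..} \<subseteq> {n. P n}" by (auto simp: eventually_sequentially)
    then show "eventually P F" using A unfolding F \<A>_def by blast
  qed
  moreover have "F \<noteq> bot"
    using A by (auto simp: trivial_limit_def F \<A>_def)
  moreover have "eventually P F \<or> eventually (\<lambda>n. \<not> P n) F" for P
    using ultra[of "{n. P n}"] by (simp add: F Collect_neg_eq)
  ultimately show ?thesis by blast
qed

section \<open>The ultrapower as a field\<close>

definition ultra :: "nat filter" where
  "ultra = (SOME F. F \<le> sequentially \<and> F \<noteq> bot \<and> (\<forall>P. eventually P F \<or> eventually (\<lambda>n. \<not> P n) F))"

lemma
  shows ultra_le: "ultra \<le> sequentially" and ultra_not_bot: "ultra \<noteq> bot"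
    and ultra_or: "eventually P ultra \<or> eventually (\<lambda>n. \<not> P n) ultra"
  using someI_ex[OF ex_ultrafilter] unfolding ultra_def by blast+

lemma eventually_ultra_not: "eventually (\<lambda>n. \<not> P n) ultra \<longleftrightarrow> \<not> eventually P ultra"
  using ultra_or[of P] eventually_conj[of P ultra "\<lambda>n. \<not> P n"] ultra_not_bot
  by (auto simp: trivial_limit_def)

lemma eventually_ultra_conj: "eventually (\<lambda>n. P n \<and> Q n) ultra \<longleftrightarrow> eventually P ultra \<and> eventually Q ultra"
  by (rule eventually_conj_iff)

lemma eventually_ultra_disj: "eventually (\<lambda>n. P n \<or> Q n) ultra \<longleftrightarrow> eventually P ultra \<or> eventually Q ultra"
  using eventually_ultra_not[of "\<lambda>n. \<not> P n \<and> \<not> Q n"] eventually_ultra_not[of P] eventually_ultra_not[of Q]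
  by (simp add: eventually_conj_iff)

lemma eventually_ultra_const [simp]: "eventually (\<lambda>n. P) ultra \<longleftrightarrow> P"
  using ultra_not_bot by (cases P) (auto simp: trivial_limit_def)

lemma eventually_ultra_large: "eventually (\<lambda>n. k \<le> n) ultra"
  using ultra_le eventually_ge_at_top[of k] by (simp add: le_filter_def)

quotient_type 'a upow = "nat \<Rightarrow> 'a" / "\<lambda>f g. eventually (\<lambda>n. f n = g n) ultra"
proof (rule equivpI)
  show "reflp (\<lambda>f g. eventually (\<lambda>n. f n = g n) ultra)" by (simp add: reflp_def)
  show "symp (\<lambda>f g. eventually (\<lambda>n. f n = g n) ultra)" by (simp add: symp_def eq_commute)
  show "transp (\<lambda>f g. eventually (\<lambda>n. f n = g n) ultra)"
    by (auto simp: transp_def elim: eventually_elim2)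
qed

lemma abs_upow_eq_iff: "abs_upow f = abs_upow g \<longleftrightarrow> eventually (\<lambda>n. f n = g n) ultra"
  by (simp add: upow.abs_eq_iff)

lemma abs_rep_upow [simp]: "abs_upow (rep_upow x) = x"
  by (rule Quotient_abs_rep[OF Quotient_upow])

instantiation upow :: (field_char_0) comm_ring_1
begin

lift_definition zero_upow :: "'a upow" is "\<lambda>n. 0" .
lift_definition one_upow :: "'a upow" is "\<lambda>n. 1" .
lift_definition plus_upow :: "'a upow \<Rightarrow> 'a upow \<Rightarrow> 'a upow" is "\<lambda>f g n. f n + g n"
  by (auto elim: eventually_elim2)
lift_definition minus_upow :: "'a upow \<Rightarrow> 'a upow \<Rightarrow> 'a upow" is "\<lambda>f g n. f n - g n"
  by (auto elim: eventually_elim2)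
lift_definition uminus_upow :: "'a upow \<Rightarrow> 'a upow" is "\<lambda>f n. - f n"
  by (auto elim: eventually_mono)
lift_definition times_upow :: "'a upow \<Rightarrow> 'a upow \<Rightarrow> 'a upow" is "\<lambda>f g n. f n * g n"
  by (auto elim: eventually_elim2)

instance
  by (standard; transfer) (simp_all add: algebra_simps)

end

instantiation upow :: (field_char_0) field
begin

lift_definition inverse_upow :: "'a upow \<Rightarrow> 'a upow" is "\<lambda>f n. inverse (f n)"
  by (auto elim: eventually_mono)
lift_definition divide_upow :: "'a upow \<Rightarrow> 'a upow \<Rightarrow> 'a upow" is "\<lambda>f g n. f n / g n"
  by (auto elim: eventually_elim2)

instance
  by (standard; transfer)
    (auto simp: divide_inverse eventually_ultra_not[symmetric] elim: eventually_mono)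

end

instance upow :: (field_char_0) field_char_0
proof
  have "of_nat k = abs_upow (\<lambda>n. of_nat k :: 'a)" for k
    by (induction k) (simp_all add: zero_upow_def one_upow_def plus_upow.abs_eq)
  then show "inj (of_nat :: nat \<Rightarrow> 'a upow)"
    by (auto simp: inj_def abs_upow_eq_iff)
qed

text \<open>The Euclidean structure of a field, supplied because contents and gcds of polynomials
  over the ultrapower require the class \<open>field_gcd\<close>.\<close>

instantiation upow :: (field_char_0)
  "{unique_euclidean_ring, normalization_euclidean_semiring, normalization_semidom_multiplicative}"
begin

definition [simp]: "normalize_upow = (normalize_field :: 'a upow \<Rightarrow> _)"
definition [simp]: "unit_factor_upow = (unit_factor_field :: 'a upow \<Rightarrow> _)"
definition [simp]: "modulo_upow = (mod_field :: 'a upow \<Rightarrow> _)"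
definition [simp]: "euclidean_size_upow = (euclidean_size_field :: 'a upow \<Rightarrow> _)"
definition [simp]: "division_segment (x :: 'a upow) = 1"

instance
  by standard (simp_all add: dvd_field_iff field_split_simps split: if_splits)

end

instantiation upow :: (field_char_0) euclidean_ring_gcd
begin

definition gcd_upow :: "'a upow \<Rightarrow> 'a upow \<Rightarrow> 'a upow" where
  "gcd_upow = Euclidean_Algorithm.gcd"
definition lcm_upow :: "'a upow \<Rightarrow> 'a upow \<Rightarrow> 'a upow" where
  "lcm_upow = Euclidean_Algorithm.lcm"
definition Gcd_upow :: "'a upow set \<Rightarrow> 'a upow" where
  "Gcd_upow = Euclidean_Algorithm.Gcd"
definition Lcm_upow :: "'a upow set \<Rightarrow> 'a upow" where
  "Lcm_upow = Euclidean_Algorithm.Lcm"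

instance
  by standard (simp_all add: gcd_upow_def lcm_upow_def Gcd_upow_def Lcm_upow_def)

end

instance upow :: (field_char_0) field_gcd ..

lift_definition map_upow :: "('a \<Rightarrow> 'a) \<Rightarrow> 'a upow \<Rightarrow> 'a upow" is "\<lambda>\<sigma> f n. \<sigma> (f n)"
  by (auto elim: eventually_mono)

lemma Los_tm:
  "tm_val (map_upow \<sigma>) (\<lambda>i. abs_upow (S i)) (map_tm abs_upow t) =
    abs_upow (\<lambda>n. tm_val \<sigma> (\<lambda>i. S i n) (map_tm (\<lambda>c. c n) t))"
  by (induction t)
    (simp_all add: zero_upow_def one_upow_def uminus_upow.abs_eq plus_upow.abs_eq times_upow.abs_eq map_upow.abs_eq)

text \<open>The parameters of \<open>\<phi>\<close> are sequences: their classes give the formula in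
  the ultrapower, their \<open>n\<close>-th entries the formula at index \<open>n\<close>. Only the
  existential quantifier needs work; witnesses are chosen index by index.\<close>

theorem Los:
  "sat (map_upow \<sigma>) (\<lambda>i. abs_upow (S i)) (map_fm abs_upow \<phi>) \<longleftrightarrow>
    eventually (\<lambda>n. sat \<sigma> (\<lambda>i. S i n) (map_fm (\<lambda>c. c n) \<phi>)) ultra"
proof (induction \<phi> arbitrary: S)
  case (FEq t u)
  then show ?case by (simp add: Los_tm abs_upow_eq_iff)
next
  case (FNot \<phi>)
  then show ?case by (simp add: eventually_ultra_not)
next
  case (FAnd \<phi> \<psi>)
  then show ?case by (simp add: eventually_conj_iff)
next
  case (FEx i \<phi>)
  have upd: "(\<lambda>j. abs_upow (S j))(i := abs_upow f) = (\<lambda>j. abs_upow ((S(i := f)) j))"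
    "(\<lambda>j. (S(i := f)) j n) = (\<lambda>j. S j n)(i := f n)" for f n
    by auto
  have ex_abs: "(\<exists>x. P x) \<longleftrightarrow> (\<exists>f. P (abs_upow f))" for P :: "'a upow \<Rightarrow> bool"
    by (metis abs_rep_upow)
  have "sat (map_upow \<sigma>) (\<lambda>i. abs_upow (S i)) (map_fm abs_upow (FEx i \<phi>)) \<longleftrightarrow>
      (\<exists>f. sat (map_upow \<sigma>) ((\<lambda>i. abs_upow (S i))(i := abs_upow f)) (map_fm abs_upow \<phi>))"
    unfolding fm.map sat.simps by (rule ex_abs)
  also have "\<dots> \<longleftrightarrow> (\<exists>f. eventually (\<lambda>n. sat \<sigma> ((\<lambda>j. S j n)(i := f n)) (map_fm (\<lambda>c. c n) \<phi>)) ultra)"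
    by (simp only: upd FEx.IH)
  also have "\<dots> \<longleftrightarrow> eventually (\<lambda>n. \<exists>a. sat \<sigma> ((\<lambda>j. S j n)(i := a)) (map_fm (\<lambda>c. c n) \<phi>)) ultra"
    (is "?L \<longleftrightarrow> ?R")
  proof
    assume ?L
    then obtain f where "eventually (\<lambda>n. sat \<sigma> ((\<lambda>j. S j n)(i := f n)) (map_fm (\<lambda>c. c n) \<phi>)) ultra" ..
    then show ?R by (rule eventually_mono) blast
  next
    assume ?R
    then have "eventually (\<lambda>n. sat \<sigma> ((\<lambda>j. S j n)(i := SOME a. sat \<sigma> ((\<lambda>j. S j n)(i := a))
        (map_fm (\<lambda>c. c n) \<phi>))) (map_fm (\<lambda>c. c n) \<phi>)) ultra"
      by (rule eventually_mono) (rule someI_ex)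
    then show ?L by (intro exI)
  qed
  finally show ?case by simp
qed

definition const_upow :: "'a \<Rightarrow> 'a upow" where
  "const_upow a = abs_upow (\<lambda>n. a)"

lemma elementary_const_upow:
  fixes \<sigma> :: "'a::field_char_0 \<Rightarrow> 'a"
  shows "elementary_embedding \<sigma> (map_upow \<sigma>) const_upow"
  unfolding elementary_embedding_def
proof (intro allI)
  fix \<phi> :: "'a fm" and s :: "nat \<Rightarrow> 'a"
  have "const_upow \<circ> s = (\<lambda>i. abs_upow (\<lambda>n. s i))" "map_fm const_upow \<phi> = map_fm abs_upow (map_fm (\<lambda>a n. a) \<phi>)"
    by (simp_all add: const_upow_def[abs_def] fm.map_comp o_def)
  then show "sat (map_upow \<sigma>) (const_upow \<circ> s) (map_fm const_upow \<phi>) = sat \<sigma> s \<phi>"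
    by (simp only: Los) (simp add: fm.map_comp o_def fm.map_ident)
qed

text \<open>The \<open>n\<close>-th entry of the solution satisfies the longest jointly satisfiable
  initial segment, of length at most \<open>n\<close>, of an enumeration of \<open>\<Phi>\<close>.
  By finite satisfiability and \<open>Los\<close>, each formula lies in that segment for almost all
  \<open>n\<close>. All variables are read as \<open>x\<close>, which suits formulas in one free
  variable.\<close>

theorem saturation:
  fixes \<sigma> :: "'a::field_char_0 \<Rightarrow> 'a"
  assumes "countable \<Phi>"
    and fin: "\<And>\<Psi>. finite \<Psi> \<Longrightarrow> \<Psi> \<subseteq> \<Phi> \<Longrightarrow> \<exists>x. \<forall>\<phi>\<in>\<Psi>. sat (map_upow \<sigma>) (\<lambda>_. x) \<phi>"
  shows "\<exists>x. \<forall>\<phi>\<in>\<Phi>. sat (map_upow \<sigma>) (\<lambda>_. x) \<phi>"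
proof (cases "\<Phi> = {}")
  case False
  define \<psi> where "\<psi> k = map_fm rep_upow (from_nat_into \<Phi> k)" for k
  have \<Phi>: "\<Phi> = range (\<lambda>k. map_fm abs_upow (\<psi> k))"
    using range_from_nat_into[OF False assms(1)] by (simp add: \<psi>_def fm.map_comp o_def fm.map_ident)
  define T where "T k n y \<longleftrightarrow> sat \<sigma> (\<lambda>_. y) (map_fm (\<lambda>c. c n) (\<psi> k))" for k n y
  have T: "sat (map_upow \<sigma>) (\<lambda>_. abs_upow f) (map_fm abs_upow (\<psi> k)) \<longleftrightarrow> eventually (\<lambda>n. T k n (f n)) ultra" for f k
    using Los[of \<sigma> "\<lambda>_. f"] by (simp add: T_def)
  define U where "U N n \<longleftrightarrow> (\<exists>y. \<forall>k<N. T k n y)" for N n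
  have U: "eventually (U N) ultra" for N
  proof -
    have "\<exists>x. \<forall>\<phi>\<in>(\<lambda>k. map_fm abs_upow (\<psi> k)) ` {..<N}. sat (map_upow \<sigma>) (\<lambda>_. x) \<phi>"
      by (rule fin) (auto simp: \<Phi>)
    then obtain x where x: "\<And>k. k < N \<Longrightarrow> sat (map_upow \<sigma>) (\<lambda>_. x) (map_fm abs_upow (\<psi> k))" by auto
    then have "\<And>k. k < N \<Longrightarrow> eventually (\<lambda>n. T k n (rep_upow x n)) ultra"
      using T[of "rep_upow x"] by simp
    then have "eventually (\<lambda>n. \<forall>k\<in>{..<N}. T k n (rep_upow x n)) ultra"
      by (intro eventually_ball_finite) auto
    then show ?thesis by (rule eventually_mono) (auto simp: U_def)
  qed
  define g where "g n = (GREATEST N. N \<le> n \<and> U N n)" for n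
  have g: "U (g n) n" and g_max: "N \<le> n \<Longrightarrow> U N n \<Longrightarrow> N \<le> g n" for N n
  proof -
    have "0 \<le> n \<and> U 0 n" by (simp add: U_def)
    then show "U (g n) n"
      unfolding g_def using GreatestI_nat[of "\<lambda>N. N \<le> n \<and> U N n" 0 n] by blast
    show "N \<le> n \<Longrightarrow> U N n \<Longrightarrow> N \<le> g n"
      unfolding g_def by (rule Greatest_le_nat[where b = n]) auto
  qed
  have "\<exists>f. \<forall>n k. k < g n \<longrightarrow> T k n (f n)"
    using g unfolding U_def by (intro choice allI)
  then obtain f where f: "\<And>n k. k < g n \<Longrightarrow> T k n (f n)" by blast
  have "eventually (\<lambda>n. T k n (f n)) ultra" for k
    using eventually_conj[OF U[of "Suc k"] eventually_ultra_large[of "Suc k"]]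
  proof (rule eventually_mono)
    fix n assume "U (Suc k) n \<and> Suc k \<le> n"
    then have "k < g n" using g_max[of "Suc k" n] by simp
    then show "T k n (f n)" by (rule f)
  qed
  then have "\<forall>\<phi>\<in>\<Phi>. sat (map_upow \<sigma>) (\<lambda>_. abs_upow f) \<phi>"
    by (auto simp: \<Phi> T)
  then show ?thesis by blast
qed simp


section \<open>Evaluating multivariate polynomials\<close>

definition mon_val :: "('v \<Rightarrow> 'b::comm_semiring_1) \<Rightarrow> ('v \<Rightarrow>\<^sub>0 nat) \<Rightarrow> 'b" where
  "mon_val x m = (\<Prod>i\<in>Poly_Mapping.keys m. x i ^ Poly_Mapping.lookup m i)"

lemma mpoly_eval_superset:
  assumes "finite A" "Poly_Mapping.keys p \<subseteq> A" "h 0 = 0"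
  shows "mpoly_eval h x p = (\<Sum>m\<in>A. h (Poly_Mapping.lookup p m) * mon_val x m)"
  unfolding mpoly_eval_def mon_val_def using assms
  by (intro sum.mono_neutral_left) (auto simp: in_keys_iff)

lemma mon_val_superset:
  assumes "finite A" "Poly_Mapping.keys m \<subseteq> A"
  shows "mon_val x m = (\<Prod>i\<in>A. x i ^ Poly_Mapping.lookup m i)"
  unfolding mon_val_def using assms
  by (intro prod.mono_neutral_left) (auto simp: in_keys_iff)

lemma mon_val_add: "mon_val x (m + n) = mon_val x m * mon_val x n"
proof -
  let ?A = "Poly_Mapping.keys m \<union> Poly_Mapping.keys n"
  have "Poly_Mapping.keys (m + n) \<subseteq> ?A" by (rule keys_add)
  then show ?thesis
    by (simp add: mon_val_superset[of ?A] lookup_add power_add prod.distrib)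
qed

lemma mon_val_single: "mon_val x (Poly_Mapping.single i k) = x i ^ k"
  by (cases "k = 0") (simp_all add: mon_val_def)

lemma mon_val_0 [simp]: "mon_val x 0 = 1"
  by (simp add: mon_val_def)

lemma mpoly_eval_single: "h 0 = 0 \<Longrightarrow> mpoly_eval h x (Poly_Mapping.single m a) = h a * mon_val x m"
  using mpoly_eval_superset[of "{m}" "Poly_Mapping.single m a" h x] by (simp split: if_splits)

lemma mpoly_eval_add:
  assumes "h 0 = 0" "\<And>a b. h (a + b) = h a + h b"
  shows "mpoly_eval h x (p + q) = mpoly_eval h x p + mpoly_eval h x q"
proof -
  let ?A = "Poly_Mapping.keys p \<union> Poly_Mapping.keys q"
  have "Poly_Mapping.keys (p + q) \<subseteq> ?A" by (rule keys_add)
  then show ?thesis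
    using assms by (simp add: mpoly_eval_superset[of ?A] lookup_add distrib_right sum.distrib)
qed

lemma mpoly_eval_0 [simp]: "mpoly_eval h x 0 = 0"
  by (simp add: mpoly_eval_def)

lemma mpoly_eval_sum:
  assumes "h 0 = 0" "\<And>a b. h (a + b) = h a + h b"
  shows "mpoly_eval h x (\<Sum>i\<in>I. p i) = (\<Sum>i\<in>I. mpoly_eval h x (p i))"
  by (induction I rule: infinite_finite_induct) (simp_all add: mpoly_eval_add assms)

lemma poly_mapping_sum_singles:
  "p = (\<Sum>m\<in>Poly_Mapping.keys p. Poly_Mapping.single m (Poly_Mapping.lookup p m))"
  by (rule poly_mapping_eqI) (simp add: lookup_sum lookup_single when_def in_keys_iff sum.If_cases)

lemma mpoly_eval_mult:
  fixes p q :: "('v, 'a::comm_semiring_1) mpoly"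
  assumes h: "h 0 = 0" "\<And>a b. h (a + b) = h a + h b" "\<And>a b. h (a * b) = h a * h b"
  shows "mpoly_eval h x (p * q) = mpoly_eval h x p * mpoly_eval h x q"
proof -
  let ?s = "\<lambda>p m. Poly_Mapping.single m (Poly_Mapping.lookup p m)"
  have "mpoly_eval h x (p * q) = mpoly_eval h x
      ((\<Sum>m\<in>Poly_Mapping.keys p. ?s p m) * (\<Sum>n\<in>Poly_Mapping.keys q. ?s q n))"
    using poly_mapping_sum_singles[of p] poly_mapping_sum_singles[of q] by simp
  also have "\<dots> = (\<Sum>m\<in>Poly_Mapping.keys p. \<Sum>n\<in>Poly_Mapping.keys q.
      (h (Poly_Mapping.lookup p m) * mon_val x m) * (h (Poly_Mapping.lookup q n) * mon_val x n))"
    by (simp add: sum_product mpoly_eval_sum mult_single mpoly_eval_single mon_val_add h mult_ac)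
  also have "\<dots> = mpoly_eval h x p * mpoly_eval h x q"
    by (simp add: sum_product mpoly_eval_def mon_val_def)
  finally show ?thesis .
qed

lemmas mpoly_eval_id_add = mpoly_eval_add[of id, simplified]
  and mpoly_eval_id_sum = mpoly_eval_sum[of id, simplified]
  and mpoly_eval_id_mult = mpoly_eval_mult[of id, simplified]
  and mpoly_eval_id_single = mpoly_eval_single[of id, simplified]

lemma mpoly_eval_id_diff:
  "mpoly_eval id x (p - q) = mpoly_eval id x p - mpoly_eval id x (q :: ('v, 'a::comm_ring_1) mpoly)"
  using mpoly_eval_id_add[of x "p - q" q] by (simp add: algebra_simps)

lemma mpoly_eval_id_1: "mpoly_eval id x (1 :: ('v, 'a::comm_semiring_1) mpoly) = 1"
  using mpoly_eval_id_single[of x 0 1] by simp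

lemma mpoly_eval_cong:
  assumes "\<And>i. i \<in> mpoly_vars p \<Longrightarrow> x i = y i"
  shows "mpoly_eval h x p = mpoly_eval h y p"
  unfolding mpoly_eval_def using assms
proof (intro sum.cong refl arg_cong2[where f = "(*)"] prod.cong)
  fix m i assume "m \<in> Poly_Mapping.keys p" "i \<in> Poly_Mapping.keys m"
  then have "x i = y i" using assms by (auto simp: mpoly_vars_def)
  then show "x i ^ Poly_Mapping.lookup m i = y i ^ Poly_Mapping.lookup m i" by simp
qed

lemma mpoly_vars_mult: "mpoly_vars (p * q) \<subseteq> mpoly_vars p \<union> mpoly_vars q"
proof
  fix i assume "i \<in> mpoly_vars (p * q)"
  then obtain m where "m \<in> Poly_Mapping.keys (p * q)" "i \<in> Poly_Mapping.keys m"
    by (auto simp: mpoly_vars_def)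
  then obtain a b where "a \<in> Poly_Mapping.keys p" "b \<in> Poly_Mapping.keys q" "m = a + b"
    using keys_mult by blast
  with \<open>i \<in> Poly_Mapping.keys m\<close> show "i \<in> mpoly_vars p \<union> mpoly_vars q"
    using keys_add[of a b] by (auto simp: mpoly_vars_def)
qed

lemma mpoly_vars_diff: "mpoly_vars (p - q) \<subseteq> mpoly_vars p \<union> mpoly_vars (q :: ('v, 'a::ab_group_add) mpoly)"
  using keys_diff[of p q] by (auto simp: mpoly_vars_def)

lemma mpoly_vars_1 [simp]: "mpoly_vars 1 = {}"
  by (auto simp: mpoly_vars_def)

section \<open>Differential polynomials as terms\<close>

primrec tsum :: "'a tm list \<Rightarrow> 'a tm" where
  "tsum [] = TZero"
| "tsum (t # ts) = TAdd t (tsum ts)"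

primrec tprod :: "'a tm list \<Rightarrow> 'a tm" where
  "tprod [] = TOne"
| "tprod (t # ts) = TMul t (tprod ts)"

definition tmon :: "(nat \<Rightarrow>\<^sub>0 nat) \<Rightarrow> 'a tm" where
  "tmon m = tprod (map (\<lambda>i. tprod (replicate (Poly_Mapping.lookup m i) ((TDer ^^ i) (Var 0))))
     (sorted_list_of_set (Poly_Mapping.keys m)))"

text \<open>The coefficients are arbitrary terms: parameters for a given polynomial, variables when
  the coefficients are to be quantified.\<close>

definition tpoly :: "((nat \<Rightarrow>\<^sub>0 nat) \<Rightarrow> 'a tm) \<Rightarrow> (nat \<Rightarrow>\<^sub>0 nat) list \<Rightarrow> 'a tm" where
  "tpoly c ms = tsum (map (\<lambda>m. TMul (c m) (tmon m)) ms)"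

lemma tm_val_tsum: "tm_val \<delta> s (tsum ts) = (\<Sum>t\<leftarrow>ts. tm_val \<delta> s t)"
  by (induction ts) auto

lemma tm_val_tprod: "tm_val \<delta> s (tprod ts) = (\<Prod>t\<leftarrow>ts. tm_val \<delta> s t)"
  by (induction ts) auto

lemma tm_val_tder: "tm_val \<delta> s ((TDer ^^ i) t) = (\<delta> ^^ i) (tm_val \<delta> s t)"
  by (induction i) auto

lemma tm_val_tmon: "tm_val \<delta> s (tmon m) = mon_val (\<lambda>i. (\<delta> ^^ i) (s 0)) m"
  by (simp add: tmon_def tm_val_tprod o_def tm_val_tder mon_val_def prod.distinct_set_conv_list[symmetric])

lemma tm_val_tpoly:
  "distinct ms \<Longrightarrow> tm_val \<delta> s (tpoly c ms) =
    (\<Sum>m\<in>set ms. tm_val \<delta> s (c m) * mon_val (\<lambda>i. (\<delta> ^^ i) (s 0)) m)"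
  by (simp add: tpoly_def tm_val_tsum o_def tm_val_tmon sum_list_distinct_conv_sum_set)

lemma map_tm_tmon: "map_tm e (tmon m) = tmon m"
proof -
  have "map_tm e (tprod ts) = tprod (map (map_tm e) ts)" for ts
    by (induction ts) auto
  moreover have "map_tm e ((TDer ^^ i) (Var 0)) = (TDer ^^ i) (Var 0)" for i
    by (induction i) auto
  ultimately show ?thesis by (simp add: tmon_def o_def)
qed

lemma map_tm_tpoly: "map_tm e (tpoly c ms) = tpoly (\<lambda>m. map_tm e (c m)) ms"
proof -
  have "map_tm e (tsum ts) = tsum (map (map_tm e) ts)" for ts
    by (induction ts) auto
  then show ?thesis by (simp add: tpoly_def map_tm_tmon o_def)
qed

lemma tm_params_tpoly: "tm_params (tpoly c ms) \<subseteq> (\<Union>m\<in>set ms. tm_params (c m))"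
proof -
  have "tm_params (tprod ts) = (\<Union>t\<in>set ts. tm_params t)" for ts :: "'a tm list"
    by (induction ts) auto
  moreover have "tm_params ((TDer ^^ i) (Var 0 :: 'a tm)) = {}" for i
    by (induction i) auto
  ultimately have "tm_params (tmon m :: 'a tm) = {}" for m
    by (auto simp: tmon_def split: if_splits)
  moreover have "tm_params (tsum ts) = (\<Union>t\<in>set ts. tm_params t)" for ts :: "'a tm list"
    by (induction ts) auto
  ultimately show ?thesis by (auto simp: tpoly_def)
qed

definition tm_of_mpoly :: "(nat, 'a) mpoly \<Rightarrow> 'a::zero tm" where
  "tm_of_mpoly p = tpoly (\<lambda>m. Param (Poly_Mapping.lookup p m))
     (SOME ms. distinct ms \<and> set ms = Poly_Mapping.keys p)"

lemma tm_of_mpoly: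
  shows tm_val_tm_of_mpoly: "tm_val \<delta> s (tm_of_mpoly p) = diff_eval \<delta> p (s 0)"
    and tm_params_tm_of_mpoly: "tm_params (tm_of_mpoly p) \<subseteq> Poly_Mapping.lookup p ` Poly_Mapping.keys p"
proof -
  let ?ms = "SOME ms. distinct ms \<and> set ms = Poly_Mapping.keys p"
  have "\<exists>ms. distinct ms \<and> set ms = Poly_Mapping.keys p"
    using finite_distinct_list[OF finite_keys[of p]] by blast
  from someI_ex[OF this] have ms: "distinct ?ms" "set ?ms = Poly_Mapping.keys p" by auto
  show "tm_val \<delta> s (tm_of_mpoly p) = diff_eval \<delta> p (s 0)"
    using ms by (simp add: tm_of_mpoly_def tm_val_tpoly diff_eval_def mpoly_eval_def mon_val_def)
  show "tm_params (tm_of_mpoly p) \<subseteq> Poly_Mapping.lookup p ` Poly_Mapping.keys p"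
    using tm_params_tpoly[of "\<lambda>m. Param (Poly_Mapping.lookup p m)" ?ms] ms(2)
    unfolding tm_of_mpoly_def by auto
qed

section \<open>Elementary extensions of differentially closed fields\<close>

definition fall :: "nat list \<Rightarrow> 'a fm \<Rightarrow> 'a fm" where
  "fall is \<phi> = foldr (\<lambda>i \<psi>. FNot (FEx i (FNot \<psi>))) is \<phi>"

lemma sat_fall:
  "sat \<delta> s (fall is \<phi>) \<longleftrightarrow> (\<forall>s'. (\<forall>i. i \<notin> set is \<longrightarrow> s' i = s i) \<longrightarrow> sat \<delta> s' \<phi>)"
proof (induction "is" arbitrary: s)
  case Nil
  have "(\<forall>i. s' i = s i) \<longleftrightarrow> s' = s" for s' by auto
  then show ?case by (simp add: fall_def)
next
  case (Cons i "is")
  have "sat \<delta> s (fall (i # is) \<phi>) \<longleftrightarrow> (\<forall>a. sat \<delta> (s(i := a)) (fall is \<phi>))"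
    by (simp add: fall_def)
  also have "\<dots> \<longleftrightarrow> (\<forall>s'. (\<forall>j. j \<notin> set (i # is) \<longrightarrow> s' j = s j) \<longrightarrow> sat \<delta> s' \<phi>)"
    unfolding Cons.IH
  proof (intro iffI allI impI)
    fix s' assume *: "\<forall>a s'. (\<forall>j. j \<notin> set is \<longrightarrow> s' j = (s(i := a)) j) \<longrightarrow> sat \<delta> s' \<phi>"
      and "\<forall>j. j \<notin> set (i # is) \<longrightarrow> s' j = s j"
    then show "sat \<delta> s' \<phi>" by (intro *[rule_format, of s' "s' i"]) auto
  next
    fix a s' assume *: "\<forall>s'. (\<forall>j. j \<notin> set (i # is) \<longrightarrow> s' j = s j) \<longrightarrow> sat \<delta> s' \<phi>"
      and "\<forall>j. j \<notin> set is \<longrightarrow> s' j = (s(i := a)) j"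
    then show "sat \<delta> s' \<phi>" by (intro *[rule_format]) auto
  qed
  finally show ?case .
qed

lemma map_fall: "map_fm e (fall is \<phi>) = fall is (map_fm e \<phi>)"
  by (induction "is") (simp_all add: fall_def)

lemma elementary_derivation:
  assumes e: "elementary_embedding \<delta> \<sigma> e" and "derivation \<delta>"
  shows "derivation \<sigma>"
proof -
  let ?\<phi> = "FAnd (FEq (TDer (TAdd (Var 0) (Var 1))) (TAdd (TDer (Var 0)) (TDer (Var 1))))
    (FEq (TDer (TMul (Var 0) (Var 1))) (TAdd (TMul (TDer (Var 0)) (Var 1)) (TMul (Var 0) (TDer (Var 1)))))"
  have "sat \<sigma> (e \<circ> (\<lambda>_. 0)) (map_fm e (fall [0, 1] ?\<phi>)) \<longleftrightarrow> sat \<delta> (\<lambda>_. 0) (fall [0, 1] ?\<phi>)"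
    using e unfolding elementary_embedding_def by blast
  moreover have "sat \<delta> (\<lambda>_. 0) (fall [0, 1] ?\<phi>)"
    using \<open>derivation \<delta>\<close> by (simp add: sat_fall derivation_def)
  ultimately have "\<And>s'. (\<forall>i. i \<notin> set [0, 1] \<longrightarrow> s' i = (e \<circ> (\<lambda>_. 0)) i) \<Longrightarrow> sat \<sigma> s' (map_fm e ?\<phi>)"
    unfolding map_fall sat_fall by blast
  then have *: "sat \<sigma> ((e \<circ> (\<lambda>_. 0))(0 := x, 1 := y)) (map_fm e ?\<phi>)" for x y
    by (metis fun_upd_apply insertCI list.simps(15))
  show ?thesis
    unfolding derivation_def
  proof (intro conjI allI)
    fix x y
    show "\<sigma> (x + y) = \<sigma> x + \<sigma> y" "\<sigma> (x * y) = \<sigma> x * y + x * \<sigma> y"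
      using *[of x y] by simp_all
  qed
qed

text \<open>For fixed supports of \<open>p\<close> and \<open>q\<close>, Blum's axiom is one
  first-order sentence: the coefficients become universally quantified variables. The order of
  \<open>p\<close> and \<open>q \<noteq> 0\<close> are guaranteed by two coefficients, at
  \<open>m0\<close> and \<open>l0\<close>, being nonzero.\<close>

theorem elementary_differentially_closed:
  fixes \<delta> :: "'u::field_char_0 \<Rightarrow> 'u" and \<sigma> :: "'w::field_char_0 \<Rightarrow> 'w"
  assumes e: "elementary_embedding \<delta> \<sigma> e" and dc: "differentially_closed \<delta>"
  shows "differentially_closed \<sigma>"
  unfolding differentially_closed_def
proof (intro conjI allI impI)
  show "derivation \<sigma>"
    using elementary_derivation[OF e] dc by (simp add: differentially_closed_def)
  fix n and p q :: "(nat, 'w) mpoly"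
  assume "n \<in> mpoly_vars p \<and> mpoly_vars p \<subseteq> {..n} \<and> q \<noteq> 0 \<and> mpoly_vars q \<subseteq> {..<n}"
  then obtain m0 l0 where m0: "m0 \<in> Poly_Mapping.keys p" "n \<in> Poly_Mapping.keys m0"
    and l0: "l0 \<in> Poly_Mapping.keys q"
    and vp: "mpoly_vars p \<subseteq> {..n}" and vq: "mpoly_vars q \<subseteq> {..<n}"
    unfolding mpoly_vars_def[of p] by (auto simp: poly_mapping_eq_iff fun_eq_iff in_keys_iff)
  obtain ms where ms: "distinct ms" "set ms = Poly_Mapping.keys p"
    using finite_distinct_list[OF finite_keys[of p]] by blast
  obtain ls where ls: "distinct ls" "set ls = Poly_Mapping.keys q"
    using finite_distinct_list[OF finite_keys[of q]] by blast
  obtain f :: "(nat \<Rightarrow>\<^sub>0 nat) \<Rightarrow> nat" where f: "inj_on f (Poly_Mapping.keys p \<union> Poly_Mapping.keys q)"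
    using finite_imp_inj_to_nat_seg[of "Poly_Mapping.keys p \<union> Poly_Mapping.keys q"] by auto
  \<comment> \<open>Odd variables stand for the coefficients of \<open>p\<close>, even positive ones
    for those of \<open>q\<close>, and \<open>0\<close> for the solution.\<close>
  define a where "a m = Suc (2 * f m)" for m
  define b where "b m = Suc (Suc (2 * f m))" for m
  let ?\<psi> = "FNot (FAnd (FNot (FEq (Var (a m0)) TZero)) (FAnd (FNot (FEq (Var (b l0)) TZero))
     (FNot (FEx 0 (FAnd (FEq (tpoly (\<lambda>m. Var (a m)) ms) TZero)
        (FNot (FEq (tpoly (\<lambda>m. Var (b m)) ls) TZero)))))))"
  let ?is = "map a ms @ map b ls"
  have ab: "a m \<noteq> 0" "b m \<noteq> 0" "a m \<noteq> b m'" for m m'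
    unfolding a_def b_def by (simp_all, presburger)
  have sat: "sat \<delta>' s ?\<psi> \<longleftrightarrow> (s (a m0) \<noteq> 0 \<longrightarrow> s (b l0) \<noteq> 0 \<longrightarrow>
      (\<exists>x. (\<Sum>m\<in>Poly_Mapping.keys p. s (a m) * mon_val (\<lambda>i. (\<delta>' ^^ i) x) m) = 0 \<and>
        (\<Sum>m\<in>Poly_Mapping.keys q. s (b m) * mon_val (\<lambda>i. (\<delta>' ^^ i) x) m) \<noteq> 0))"
    for \<delta>' :: "'c::field_char_0 \<Rightarrow> 'c" and s
    by (simp add: tm_val_tpoly ms ls ab) blast
  have "sat \<delta> s ?\<psi>" for s
    unfolding sat
  proof (intro impI)
    assume s: "s (a m0) \<noteq> 0" "s (b l0) \<noteq> 0"
    define p' where "p' = (\<Sum>m\<in>Poly_Mapping.keys p. Poly_Mapping.single m (s (a m)))"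
    define q' where "q' = (\<Sum>m\<in>Poly_Mapping.keys q. Poly_Mapping.single m (s (b m)))"
    have lp: "Poly_Mapping.lookup p' m = (if m \<in> Poly_Mapping.keys p then s (a m) else 0)" for m
      by (simp add: p'_def lookup_sum lookup_single when_def sum.If_cases)
    have lq: "Poly_Mapping.lookup q' m = (if m \<in> Poly_Mapping.keys q then s (b m) else 0)" for m
      by (simp add: q'_def lookup_sum lookup_single when_def sum.If_cases)
    have kp: "Poly_Mapping.keys p' \<subseteq> Poly_Mapping.keys p" and kq: "Poly_Mapping.keys q' \<subseteq> Poly_Mapping.keys q"
      by (auto simp: in_keys_iff[of _ p'] in_keys_iff[of _ q'] lp lq split: if_splits)
    have "n \<in> mpoly_vars p'"
      unfolding mpoly_vars_def using m0 s by (auto simp: in_keys_iff[of _ p'] lp intro!: bexI[of _ m0])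
    moreover have "mpoly_vars p' \<subseteq> {..n}" "mpoly_vars q' \<subseteq> {..<n}"
      using kp kq vp vq unfolding mpoly_vars_def by blast+
    moreover have "q' \<noteq> 0"
      using lq[of l0] l0 s by auto
    ultimately obtain x where "diff_eval \<delta> p' x = 0" "diff_eval \<delta> q' x \<noteq> 0"
      using dc unfolding differentially_closed_def by blast
    then show "\<exists>x. (\<Sum>m\<in>Poly_Mapping.keys p. s (a m) * mon_val (\<lambda>i. (\<delta> ^^ i) x) m) = 0 \<and>
        (\<Sum>m\<in>Poly_Mapping.keys q. s (b m) * mon_val (\<lambda>i. (\<delta> ^^ i) x) m) \<noteq> 0"
      using mpoly_eval_superset[OF finite_keys kp, of id] mpoly_eval_superset[OF finite_keys kq, of id]
      by (auto simp: diff_eval_def lp lq)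
  qed
  then have "sat \<delta> (\<lambda>_. 0) (fall ?is ?\<psi>)"
    unfolding sat_fall by blast
  then have "sat \<sigma> (e \<circ> (\<lambda>_. 0)) (fall ?is (map_fm e ?\<psi>))"
    using e unfolding elementary_embedding_def map_fall[symmetric] by blast
  moreover define s where "s i = (if i \<in> a ` Poly_Mapping.keys p then
      Poly_Mapping.lookup p (the_inv_into (Poly_Mapping.keys p) a i)
    else if i \<in> b ` Poly_Mapping.keys q then Poly_Mapping.lookup q (the_inv_into (Poly_Mapping.keys q) b i)
    else e 0)" for i
  have "\<forall>i. i \<notin> set ?is \<longrightarrow> s i = (e \<circ> (\<lambda>_. 0)) i"
    by (simp add: s_def ms ls)
  ultimately have "sat \<sigma> s (map_fm e ?\<psi>)"
    unfolding sat_fall by blast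
  moreover have "map_fm e ?\<psi> = ?\<psi>"
    by (simp add: map_tm_tpoly)
  ultimately have "sat \<sigma> s ?\<psi>" by simp
  moreover have "inj_on a (Poly_Mapping.keys p)" "inj_on b (Poly_Mapping.keys q)"
    using f by (auto simp: inj_on_def a_def b_def)
  then have "s (a m) = Poly_Mapping.lookup p m" if "m \<in> Poly_Mapping.keys p" for m
    using that by (simp add: s_def the_inv_into_f_f)
  moreover have "s (b m) = Poly_Mapping.lookup q m" if "m \<in> Poly_Mapping.keys q" for m
    using that \<open>inj_on b _\<close> ab(3)[of _ m] ab(3)[of _ m, symmetric]
    by (auto simp: s_def the_inv_into_f_f image_iff)
  ultimately show "\<exists>x. diff_eval \<sigma> p x = 0 \<and> diff_eval \<sigma> q x \<noteq> 0"
    using m0(1) l0 unfolding sat by (simp add: diff_eval_def mpoly_eval_def mon_val_def in_keys_iff)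
qed

instance tm :: (countable) countable
  by countable_datatype

instance fm :: (countable) countable
  by countable_datatype

lemma countable_tms:
  assumes "countable C"
  shows "countable {t. tm_params t \<subseteq> C}"
proof (rule countable_subset)
  show "{t. tm_params t \<subseteq> C} \<subseteq> range (map_tm (from_nat_into C))"
  proof
    fix t assume "t \<in> {t. tm_params t \<subseteq> C}"
    then have "map_tm (\<lambda>x. from_nat_into C (to_nat_on C x)) t = t"
      using assms by (intro tm.map_ident_strong) auto
    then have "t = map_tm (from_nat_into C) (map_tm (to_nat_on C) t)"
      by (simp add: tm.map_comp o_def)
    then show "t \<in> range (map_tm (from_nat_into C))" by blast
  qed
qed simp


section \<open>Back and forth\<close>

definition mpolys_over :: "('a::zero \<times> 'b::zero) set \<Rightarrow> (('v, 'a) mpoly \<times> ('v, 'b) mpoly) set" where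
  "mpolys_over \<Gamma> = {(P, P'). \<forall>m. (Poly_Mapping.lookup P m, Poly_Mapping.lookup P' m) \<in> \<Gamma>}"

lemma poly_mapping_sum_superset:
  assumes "finite A" "Poly_Mapping.keys p \<subseteq> A"
  shows "p = (\<Sum>m\<in>A. Poly_Mapping.single m (Poly_Mapping.lookup p m))"
  by (subst poly_mapping_sum_singles) (rule sum.mono_neutral_left, use assms in \<open>auto simp: in_keys_iff\<close>)

lemma pair_ring_mpolys_over:
  fixes \<Gamma> :: "('a::comm_ring_1 \<times> 'b::comm_ring_1) set"
  assumes \<Gamma>: "pair_ring \<Gamma>"
  shows "pair_ring (mpolys_over \<Gamma> :: (('v, 'a) mpoly \<times> ('v, 'b) mpoly) set)"
  unfolding pair_ring_def
proof (intro conjI allI impI; (elim conjE)?)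
  show "(1, 1) \<in> (mpolys_over \<Gamma> :: (('v, 'a) mpoly \<times> ('v, 'b) mpoly) set)"
    using pair_one[OF \<Gamma>] pair_zero[OF \<Gamma>] by (auto simp: mpolys_over_def lookup_one when_def)
  fix P Q :: "('v, 'a) mpoly" and P' Q' :: "('v, 'b) mpoly"
  assume P: "(P, P') \<in> mpolys_over \<Gamma>" and Q: "(Q, Q') \<in> mpolys_over \<Gamma>"
  show "(P - Q, P' - Q') \<in> mpolys_over \<Gamma>"
    using P Q by (auto simp: mpolys_over_def lookup_minus intro: pair_diff[OF \<Gamma>])
  let ?A = "Poly_Mapping.keys P \<union> Poly_Mapping.keys P'" and ?B = "Poly_Mapping.keys Q \<union> Poly_Mapping.keys Q'"
  have expand: "R * S = (\<Sum>m\<in>?A. \<Sum>n\<in>?B. Poly_Mapping.single (m + n) (Poly_Mapping.lookup R m * Poly_Mapping.lookup S n))"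
    if "Poly_Mapping.keys R \<subseteq> ?A" "Poly_Mapping.keys S \<subseteq> ?B" for R S :: "('v, 'c::comm_ring_1) mpoly"
    by (subst poly_mapping_sum_superset[of ?A R], simp, fact,
        subst poly_mapping_sum_superset[of ?B S], simp, fact) (simp add: sum_product mult_single)
  have "(Poly_Mapping.lookup (P * Q) k, Poly_Mapping.lookup (P' * Q') k) \<in> \<Gamma>" for k
    unfolding expand[of P Q, simplified] expand[of P' Q', simplified] lookup_sum lookup_single
    using P Q by (intro pair_sum[OF \<Gamma>])
      (auto simp: when_def mpolys_over_def intro: pair_mult[OF \<Gamma>] pair_zero[OF \<Gamma>])
  then show "(P * Q, P' * Q') \<in> mpolys_over \<Gamma>"
    by (simp add: mpolys_over_def)
qed

lemma pair_mpoly_eval: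
  assumes S: "pair_ring S" and P: "(P, P') \<in> mpolys_over S"
    and x: "\<And>i. i \<in> mpoly_vars P \<union> mpoly_vars P' \<Longrightarrow> (x i, x' i) \<in> S"
  shows "(mpoly_eval id x P, mpoly_eval id x' P') \<in> S"
proof -
  let ?A = "Poly_Mapping.keys P \<union> Poly_Mapping.keys P'"
  have "(mon_val x m, mon_val x' m) \<in> S" if "m \<in> ?A" for m
  proof -
    have "(x i, x' i) \<in> S" if "i \<in> Poly_Mapping.keys m" for i
      using x[of i] that \<open>m \<in> ?A\<close> by (auto simp: mpoly_vars_def)
    then show ?thesis
      unfolding mon_val_def by (intro pair_prod[OF S] pair_power[OF S]) auto
  qed
  moreover have "mpoly_eval id x P = (\<Sum>m\<in>?A. Poly_Mapping.lookup P m * mon_val x m)"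
    "mpoly_eval id x' P' = (\<Sum>m\<in>?A. Poly_Mapping.lookup P' m * mon_val x' m)"
    using mpoly_eval_superset[of ?A P id x] mpoly_eval_superset[of ?A P' id x'] by simp_all
  ultimately show ?thesis
    using P by (auto simp: mpolys_over_def intro!: pair_sum[OF S] pair_mult[OF S])
qed

text \<open>The coefficient of \<open>X\<^sub>i\<^sup>r\<close>, as a polynomial in the other variables.\<close>

definition cpart :: "'v \<Rightarrow> nat \<Rightarrow> ('v, 'a::zero) mpoly \<Rightarrow> ('v, 'a) mpoly" where
  "cpart i r P = Abs_poly_mapping (\<lambda>k. if Poly_Mapping.lookup k i = 0
     then Poly_Mapping.lookup P (k + Poly_Mapping.single i r) else 0)"

lemma lookup_cpart:
  "Poly_Mapping.lookup (cpart i r P) k = (if Poly_Mapping.lookup k i = 0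
     then Poly_Mapping.lookup P (k + Poly_Mapping.single i r) else 0)"
proof -
  let ?f = "\<lambda>k. if Poly_Mapping.lookup k i = 0 then Poly_Mapping.lookup P (k + Poly_Mapping.single i r) else 0"
  have "{k. ?f k \<noteq> 0} \<subseteq> (\<lambda>k. k - Poly_Mapping.single i r) ` Poly_Mapping.keys P"
  proof
    fix k assume "k \<in> {k. ?f k \<noteq> 0}"
    then have "k + Poly_Mapping.single i r \<in> Poly_Mapping.keys P"
      by (auto simp: in_keys_iff split: if_splits)
    moreover have "k = (k + Poly_Mapping.single i r) - Poly_Mapping.single i r" by simp
    ultimately show "k \<in> (\<lambda>k. k - Poly_Mapping.single i r) ` Poly_Mapping.keys P" by blast
  qed
  then have "finite {k. ?f k \<noteq> 0}" by (rule finite_subset) simp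
  then show ?thesis by (simp add: cpart_def lookup_Abs_poly_mapping)
qed

lemma split_monomial:
  fixes k :: "'v \<Rightarrow>\<^sub>0 nat"
  shows "Poly_Mapping.lookup (k - Poly_Mapping.single i (Poly_Mapping.lookup k i)) i = 0"
    "k - Poly_Mapping.single i (Poly_Mapping.lookup k i) + Poly_Mapping.single i (Poly_Mapping.lookup k i) = k"
  by (auto simp: lookup_minus lookup_add lookup_single when_def intro!: poly_mapping_eqI)

lemma mpoly_eval_cpart:
  fixes P :: "('v, 'a::comm_semiring_1) mpoly"
  assumes N: "\<And>k. k \<in> Poly_Mapping.keys P \<Longrightarrow> Poly_Mapping.lookup k i \<le> N"
  shows "mpoly_eval id x P = (\<Sum>r\<le>N. mpoly_eval id x (cpart i r P) * x i ^ r)"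
proof -
  let ?S = "SIGMA r:{..N}. Poly_Mapping.keys (cpart i r P)"
  have "(\<Sum>r\<le>N. mpoly_eval id x (cpart i r P) * x i ^ r) =
      (\<Sum>r\<le>N. \<Sum>k\<in>Poly_Mapping.keys (cpart i r P). Poly_Mapping.lookup P (k + Poly_Mapping.single i r) *
        mon_val x (k + Poly_Mapping.single i r))"
    unfolding mpoly_eval_def mon_val_def[symmetric] sum_distrib_right
    by (intro sum.cong refl) (auto simp: in_keys_iff lookup_cpart mon_val_add mon_val_single mult_ac split: if_splits)
  also have "\<dots> = (\<Sum>(r, k)\<in>?S. Poly_Mapping.lookup P (k + Poly_Mapping.single i r) *
        mon_val x (k + Poly_Mapping.single i r))"
    by (rule sum.Sigma) auto
  also have "\<dots> = (\<Sum>k\<in>Poly_Mapping.keys P. Poly_Mapping.lookup P k * mon_val x k)"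
    by (rule sum.reindex_bij_witness[of _
          "\<lambda>k. (Poly_Mapping.lookup k i, k - Poly_Mapping.single i (Poly_Mapping.lookup k i))"
          "\<lambda>(r, k). k + Poly_Mapping.single i r"])
      (auto simp: in_keys_iff lookup_cpart lookup_add split_monomial intro!: N split: if_splits)
  finally show ?thesis by (simp add: mpoly_eval_def mon_val_def)
qed

lemma mpoly_vars_cpart: "mpoly_vars (cpart i r P) \<subseteq> mpoly_vars P - {i}"
proof
  fix j assume "j \<in> mpoly_vars (cpart i r P)"
  then obtain k where k: "k \<in> Poly_Mapping.keys (cpart i r P)" "j \<in> Poly_Mapping.keys k"
    by (auto simp: mpoly_vars_def)
  then have "k + Poly_Mapping.single i r \<in> Poly_Mapping.keys P" "Poly_Mapping.lookup k i = 0"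
    by (auto simp: in_keys_iff lookup_cpart split: if_splits)
  moreover have "j \<in> Poly_Mapping.keys (k + Poly_Mapping.single i r)"
    using k(2) by (auto simp: in_keys_iff lookup_add)
  ultimately show "j \<in> mpoly_vars P - {i}"
    using k(2) by (auto simp: mpoly_vars_def in_keys_iff)
qed

lemma cpart_eq_0_imp:
  assumes "\<And>r. cpart i r P = 0"
  shows "P = 0"
proof (rule poly_mapping_eqI)
  fix k
  have "Poly_Mapping.lookup (cpart i (Poly_Mapping.lookup k i) P)
      (k - Poly_Mapping.single i (Poly_Mapping.lookup k i)) = Poly_Mapping.lookup P k"
    by (simp add: lookup_cpart split_monomial)
  then show "Poly_Mapping.lookup P k = Poly_Mapping.lookup 0 k" by (simp add: assms)
qed

text \<open>\<open>p'\<close> is only known to vanish at \<open>x'\<close>. That \<open>x'\<close>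
  satisfies no further relation follows from the minimality of \<open>p\<close>, just as an
  isomorphism carries an irreducible polynomial to an irreducible one.\<close>

lemma partial_iso_adjoin_algebraic:
  fixes \<Gamma> :: "('a::idom \<times> 'b::idom) set"
  assumes \<Gamma>: "partial_iso \<Gamma>" and p: "(p, p') \<in> polys_over \<Gamma>" "p \<noteq> 0" "poly p x = 0" "poly p' x' = 0"
    and min: "\<And>q q'. (q, q') \<in> polys_over \<Gamma> \<Longrightarrow> q \<noteq> 0 \<Longrightarrow> poly q x = 0 \<Longrightarrow> degree p \<le> degree q"
  shows "partial_iso {(poly q x, poly q' x') | q q'. (q, q') \<in> polys_over \<Gamma>}"
proof -
  note R = pair_ring_polys_over[OF partial_iso_pair_ring[OF \<Gamma>]]
  have fwd: "poly q' x' = 0" if q: "(q, q') \<in> polys_over \<Gamma>" "poly q x = 0" for q q'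
  proof -
    obtain l l' a a' r r' where *: "(l, l') \<in> \<Gamma>" "l \<noteq> 0" "(r, r') \<in> polys_over \<Gamma>"
      "smult l q = a * p + r" "smult l' q' = a' * p' + r'" "r = 0 \<or> degree r < degree p"
      using pseudo_division[OF \<Gamma> q(1) p(1,2)] by blast
    have "poly r x = 0" using arg_cong[OF *(4), of "\<lambda>s. poly s x"] q(2) p(3) by simp
    then have "r = 0" using min[OF *(3)] *(6) by fastforce
    then have "r' = 0" using polys_over_eq_0_iff[OF \<Gamma> *(3)] by simp
    then have "l' * poly q' x' = 0" using arg_cong[OF *(5), of "\<lambda>s. poly s x'"] p(4) by simp
    moreover have "l' \<noteq> 0" using \<Gamma> *(1,2) by (auto simp: partial_iso_def)
    ultimately show ?thesis by simp
  qed
  have bwd: "poly q x = 0" if q: "(q, q') \<in> polys_over \<Gamma>" "poly q' x' = 0" for q q'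
  proof (rule ccontr)
    assume "poly q x \<noteq> 0"
    \<comment> \<open>A counterexample of least degree. If it is no shorter than \<open>p\<close>,
      its remainder modulo \<open>p\<close> is a smaller one; otherwise dividing \<open>p\<close> by
      it gives a quotient that vanishes at \<open>x\<close> and has degree below that of
      \<open>p\<close>, so the quotient is zero, which is absurd.\<close>
    let ?P = "\<lambda>(n, n'). (n, n') \<in> polys_over \<Gamma> \<and> poly n' x' = 0 \<and> poly n x \<noteq> 0"
    obtain n n' where n: "(n, n') \<in> polys_over \<Gamma>" "poly n' x' = 0" "poly n x \<noteq> 0"
      and minn: "\<And>m m'. ?P (m, m') \<Longrightarrow> degree n \<le> degree m"
      using ex_has_least_nat[of ?P "(q, q')" "\<lambda>(n, n'). degree n"] q \<open>poly q x \<noteq> 0\<close> by auto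
    have "n \<noteq> 0" using n(3) by auto
    show False
    proof (cases "degree p \<le> degree n")
      case True
      obtain l l' a a' r r' where *: "(l, l') \<in> \<Gamma>" "l \<noteq> 0" "(r, r') \<in> polys_over \<Gamma>"
        "smult l n = a * p + r" "smult l' n' = a' * p' + r'" "r = 0 \<or> degree r < degree p"
        using pseudo_division[OF \<Gamma> n(1) p(1,2)] by blast
      have "poly r x \<noteq> 0" "poly r' x' = 0"
        using arg_cong[OF *(4), of "\<lambda>s. poly s x"] arg_cong[OF *(5), of "\<lambda>s. poly s x'"] n(2,3) p(3,4) *(2) by auto
      then have "degree n \<le> degree r" "r \<noteq> 0" using minn[of r r'] *(3) by auto
      with *(6) True show False by simp
    next
      case False
      obtain l l' a a' r r' where *: "(l, l') \<in> \<Gamma>" "l \<noteq> 0" "(a, a') \<in> polys_over \<Gamma>" "(r, r') \<in> polys_over \<Gamma>"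
        "smult l p = a * n + r" "smult l' p' = a' * n' + r'" "r = 0 \<or> degree r < degree n"
        using pseudo_division[OF \<Gamma> p(1) n(1) \<open>n \<noteq> 0\<close>] by blast
      have "degree n \<noteq> 0"
      proof
        assume "degree n = 0"
        then obtain c c' where c: "n = [:c:]" "n' = [:c':]"
          using polys_over_degree[OF \<Gamma> n(1)] by (metis degree_eq_zeroE)
        then have "(n, n') \<in> polys_over \<Gamma>" "n' = 0" using n by auto
        then show False using polys_over_eq_0_iff[OF \<Gamma>] \<open>n \<noteq> 0\<close> by blast
      qed
      have "poly r' x' = 0"
        using arg_cong[OF *(6), of "\<lambda>s. poly s x'"] n(2) p(4) by simp
      then have "poly r x = 0"
        using minn[of r r'] *(4,7) by fastforce
      then have "poly a x = 0"
        using arg_cong[OF *(5), of "\<lambda>s. poly s x"] p(3) n(3) by simp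
      moreover have "degree a < degree p" if "a \<noteq> 0"
      proof -
        have "degree (a * n) = degree a + degree n" using that \<open>n \<noteq> 0\<close> by (rule degree_mult_eq)
        moreover have "degree (a * n) \<le> degree p"
        proof (rule ccontr)
          assume "\<not> degree (a * n) \<le> degree p"
          moreover have "degree r < degree (a * n)" using *(7) \<open>degree n \<noteq> 0\<close> calculation \<open>degree (a * n) = _\<close> by auto
          ultimately have "degree (a * n) = degree (smult l p)"
            unfolding *(5) by (simp add: degree_add_eq_left)
          with \<open>\<not> degree (a * n) \<le> degree p\<close> show False by (simp split: if_splits)
        qed
        ultimately show ?thesis using \<open>degree n \<noteq> 0\<close> by simp
      qed
      ultimately have "a = 0" using min[OF *(3)] by fastforce
      then have "smult l p = r" using *(5) by simp
      then have "degree p = degree r" "r \<noteq> 0" using *(2) p(2) by auto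
      with *(7) False show False by simp
    qed
  qed
  show ?thesis
    unfolding partial_iso_def pair_ring_def
  proof (intro conjI allI impI; (elim conjE)?)
    show "(1, 1) \<in> {(poly q x, poly q' x') | q q'. (q, q') \<in> polys_over \<Gamma>}"
      using pair_one[OF R] by (auto intro!: exI[of _ 1])
    fix a a' b b' assume "(a, a') \<in> {(poly q x, poly q' x') | q q'. (q, q') \<in> polys_over \<Gamma>}"
      "(b, b') \<in> {(poly q x, poly q' x') | q q'. (q, q') \<in> polys_over \<Gamma>}"
    then obtain q q' r r' where *: "(q, q') \<in> polys_over \<Gamma>" "(r, r') \<in> polys_over \<Gamma>"
      "a = poly q x" "a' = poly q' x'" "b = poly r x" "b' = poly r' x'" by blast
    have "(poly (q - r) x, poly (q' - r') x') \<in> {(poly q x, poly q' x') | q q'. (q, q') \<in> polys_over \<Gamma>}"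
      "(poly (q * r) x, poly (q' * r') x') \<in> {(poly q x, poly q' x') | q q'. (q, q') \<in> polys_over \<Gamma>}"
      using pair_diff[OF R *(1,2)] pair_mult[OF R *(1,2)] by blast+
    then show "(a - b, a' - b') \<in> {(poly q x, poly q' x') | q q'. (q, q') \<in> polys_over \<Gamma>}"
      "(a * b, a' * b') \<in> {(poly q x, poly q' x') | q q'. (q, q') \<in> polys_over \<Gamma>}"
      by (simp_all add: *)
  next
    fix a a' assume "(a, a') \<in> {(poly q x, poly q' x') | q q'. (q, q') \<in> polys_over \<Gamma>}"
    then obtain q q' where "(q, q') \<in> polys_over \<Gamma>" "a = poly q x" "a' = poly q' x'" by blast
    then show "a = 0 \<longleftrightarrow> a' = 0" using fwd[of q q'] bwd[of q q'] by auto
  qed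
qed

text \<open>The derivative of an algebraic element is a quotient, so adjoining such an element leads
  to a set closed under the derivations only after passing to fractions.\<close>

definition fractions :: "('a::field \<times> 'b::field) set \<Rightarrow> ('a \<times> 'b) set" where
  "fractions \<Gamma> = {(a / b, a' / b') | a a' b b'. (a, a') \<in> \<Gamma> \<and> (b, b') \<in> \<Gamma> \<and> b \<noteq> 0}"

lemma partial_iso_fractions:
  assumes \<Gamma>: "partial_iso \<Gamma>"
  shows "partial_iso (fractions \<Gamma>)" "\<Gamma> \<subseteq> fractions \<Gamma>"
proof -
  note R = partial_iso_pair_ring[OF \<Gamma>]
  have nz: "b' \<noteq> 0" if "(b, b') \<in> \<Gamma>" "b \<noteq> 0" for b b'
    using \<Gamma> that by (auto simp: partial_iso_def)
  show sub: "\<Gamma> \<subseteq> fractions \<Gamma>"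
    using pair_one[OF R] by (force simp: fractions_def)
  show "partial_iso (fractions \<Gamma>)"
    unfolding partial_iso_def pair_ring_def
  proof (intro conjI allI impI; (elim conjE)?)
    show "(1, 1) \<in> fractions \<Gamma>" using sub pair_one[OF R] by blast
    fix u u' v v' assume "(u, u') \<in> fractions \<Gamma>" "(v, v') \<in> fractions \<Gamma>"
    then obtain a a' b b' c c' e e' where *: "(a, a') \<in> \<Gamma>" "(b, b') \<in> \<Gamma>" "b \<noteq> 0" "u = a / b" "u' = a' / b'"
      "(c, c') \<in> \<Gamma>" "(e, e') \<in> \<Gamma>" "e \<noteq> 0" "v = c / e" "v' = c' / e'"
      unfolding fractions_def by blast
    have "u - v = (a * e - c * b) / (b * e)" "u' - v' = (a' * e' - c' * b') / (b' * e')"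
      "u * v = (a * c) / (b * e)" "u' * v' = (a' * c') / (b' * e')"
      using * nz by (simp_all add: field_simps)
    moreover have "(a * e - c * b, a' * e' - c' * b') \<in> \<Gamma>" "(a * c, a' * c') \<in> \<Gamma>" "(b * e, b' * e') \<in> \<Gamma>" "b * e \<noteq> 0"
      using * by (auto intro!: pair_diff[OF R] pair_mult[OF R])
    ultimately show "(u - v, u' - v') \<in> fractions \<Gamma>" "(u * v, u' * v') \<in> fractions \<Gamma>"
      unfolding fractions_def by blast+
  next
    fix u u' assume "(u, u') \<in> fractions \<Gamma>"
    then obtain a a' b b' where *: "(a, a') \<in> \<Gamma>" "(b, b') \<in> \<Gamma>" "b \<noteq> 0" "u = a / b" "u' = a' / b'"
      unfolding fractions_def by blast
    then show "u = 0 \<longleftrightarrow> u' = 0" using nz[of b b'] \<Gamma> by (auto simp: partial_iso_def)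
  qed
qed

text \<open>Finitely many inequations are equivalent to the single one for the product, so the
  hypothesis gives finite satisfiability; countability of \<open>K\<close> keeps the set of formulas
  within reach of saturation.\<close>

lemma saturated_zero:
  fixes \<sigma> :: "'a::field_char_0 \<Rightarrow> 'a" and P :: "(nat, 'a upow) mpoly"
  assumes K: "countable K" "pair_ring (Id_on K)" and P: "\<And>m. Poly_Mapping.lookup P m \<in> K"
    and sol: "\<And>Q. (\<And>m. Poly_Mapping.lookup Q m \<in> K) \<Longrightarrow> Q \<noteq> 0 \<Longrightarrow> mpoly_vars Q \<subseteq> V \<Longrightarrow>
      \<exists>x. diff_eval (map_upow \<sigma>) P x = 0 \<and> diff_eval (map_upow \<sigma>) Q x \<noteq> 0"
  shows "\<exists>x. diff_eval (map_upow \<sigma>) P x = 0 \<and>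
    (\<forall>Q. (\<forall>m. Poly_Mapping.lookup Q m \<in> K) \<and> Q \<noteq> 0 \<and> mpoly_vars Q \<subseteq> V \<longrightarrow> diff_eval (map_upow \<sigma>) Q x \<noteq> 0)"
proof -
  let ?\<delta> = "map_upow \<sigma>"
  define \<Q> where "\<Q> = {Q :: (nat, 'a upow) mpoly. (\<forall>m. Poly_Mapping.lookup Q m \<in> K) \<and> Q \<noteq> 0 \<and> mpoly_vars Q \<subseteq> V}"
  define F where "F Q = FNot (FEq (tm_of_mpoly Q) TZero)" for Q :: "(nat, 'a upow) mpoly"
  define G where "G = FEq (tm_of_mpoly P) TZero"
  have params: "tm_params (tm_of_mpoly Q) \<subseteq> K" if "\<And>m. Poly_Mapping.lookup Q m \<in> K" for Q :: "(nat, 'a upow) mpoly"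
    using tm_params_tm_of_mpoly[of Q] that by blast
  have sat: "sat ?\<delta> (\<lambda>_. x) (F Q) \<longleftrightarrow> diff_eval ?\<delta> Q x \<noteq> 0" "sat ?\<delta> (\<lambda>_. x) G \<longleftrightarrow> diff_eval ?\<delta> P x = 0" for x Q
    by (simp_all add: F_def G_def tm_val_tm_of_mpoly)
  have mult: "Q * Q' \<in> \<Q>" if "Q \<in> \<Q>" "Q' \<in> \<Q>" for Q Q'
  proof -
    have "(Q * Q', Q * Q') \<in> mpolys_over (Id_on K)"
      using that by (intro pair_mult[OF pair_ring_mpolys_over[OF K(2)]]) (auto simp: \<Q>_def mpolys_over_def)
    then show ?thesis
      using that mpoly_vars_mult[of Q Q'] by (auto simp: \<Q>_def mpolys_over_def)
  qed
  have one: "1 \<in> \<Q>"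
    using pair_one[OF K(2)] pair_zero[OF K(2)] by (auto simp: \<Q>_def lookup_one when_def)
  have "\<exists>x. \<forall>\<phi>\<in>insert G (F ` \<Q>). sat ?\<delta> (\<lambda>_. x) \<phi>"
  proof (rule saturation)
    have "insert G (F ` \<Q>) \<subseteq> (\<lambda>t. FEq t TZero) ` {t. tm_params t \<subseteq> K} \<union> (\<lambda>t. FNot (FEq t TZero)) ` {t. tm_params t \<subseteq> K}"
      using params P by (auto simp: F_def G_def \<Q>_def)
    then show "countable (insert G (F ` \<Q>))"
      by (rule countable_subset) (simp add: countable_tms[OF K(1)])
    fix \<Psi> assume \<Psi>: "finite \<Psi>" "\<Psi> \<subseteq> insert G (F ` \<Q>)"
    then have "finite (\<Psi> - {G})" "\<Psi> - {G} \<subseteq> F ` \<Q>" by auto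
    then obtain \<R> where \<R>: "finite \<R>" "\<R> \<subseteq> \<Q>" "\<Psi> - {G} = F ` \<R>"
      using finite_subset_image by metis
    have prod: "(\<Prod>Q\<in>\<R>. Q) \<in> \<Q>"
      using \<R>(1,2) by induction (auto intro: mult one)
    then obtain x where x: "diff_eval ?\<delta> P x = 0" "diff_eval ?\<delta> (\<Prod>Q\<in>\<R>. Q) x \<noteq> 0"
      using sol unfolding \<Q>_def by blast
    have "diff_eval ?\<delta> (\<Prod>Q\<in>\<R>. Q) x = (\<Prod>Q\<in>\<R>. diff_eval ?\<delta> Q x)"
      unfolding diff_eval_def
      by (induction \<R> rule: infinite_finite_induct) (simp_all only: prod.infinite prod.empty prod.insert
          mpoly_eval_id_1 mpoly_eval_id_mult not_False_eq_True)
    with x(2) have nz: "\<And>Q. Q \<in> \<R> \<Longrightarrow> diff_eval ?\<delta> Q x \<noteq> 0"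
      using \<R>(1) by auto
    have "sat ?\<delta> (\<lambda>_. x) \<phi>" if "\<phi> \<in> \<Psi>" for \<phi>
    proof (cases "\<phi> = G")
      case True
      then show ?thesis using sat(2) x(1) by simp
    next
      case False
      then have "\<phi> \<in> \<Psi> - {G}" using that by simp
      then have "\<phi> \<in> F ` \<R>" unfolding \<R>(3) .
      then obtain Q where Q: "\<phi> = F Q" "Q \<in> \<R>" by (rule imageE)
      show ?thesis unfolding Q(1) sat(1) using Q(2) by (rule nz)
    qed
    then show "\<exists>x. \<forall>\<phi>\<in>\<Psi>. sat ?\<delta> (\<lambda>_. x) \<phi>" by blast
  qed
  then obtain x where "sat ?\<delta> (\<lambda>_. x) G" "\<And>Q. Q \<in> \<Q> \<Longrightarrow> sat ?\<delta> (\<lambda>_. x) (F Q)" by blast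
  then show ?thesis
    unfolding sat \<Q>_def by blast
qed


lemma finite_mpoly_vars: "finite (mpoly_vars p)"
  by (simp add: mpoly_vars_def)

lemma mpoly_vars_single: "mpoly_vars (Poly_Mapping.single m a) \<subseteq> Poly_Mapping.keys m"
  by (auto simp: mpoly_vars_def split: if_splits)

lemma mpoly_vars_sum: "mpoly_vars (\<Sum>i\<in>I. p i) \<subseteq> (\<Union>i\<in>I. mpoly_vars (p i))"
proof (induction I rule: infinite_finite_induct)
  case (insert i I)
  then show ?case
    using keys_add[of "p i" "\<Sum>i\<in>I. p i"] by (auto simp: mpoly_vars_def)
qed (auto simp: mpoly_vars_def)

lemma blum_generic:
  fixes \<sigma> :: "'a::field_char_0 \<Rightarrow> 'a" and P :: "(nat, 'a upow) mpoly"
  assumes dc: "differentially_closed (map_upow \<sigma>)" and K: "countable K" "pair_ring (Id_on K)"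
    and P: "\<And>k. Poly_Mapping.lookup P k \<in> K" and m: "m \<in> mpoly_vars P" "mpoly_vars P \<subseteq> {..m}"
  shows "\<exists>x. diff_eval (map_upow \<sigma>) P x = 0 \<and>
    (\<forall>Q. (\<forall>k. Poly_Mapping.lookup Q k \<in> K) \<and> Q \<noteq> 0 \<and> mpoly_vars Q \<subseteq> {..<m} \<longrightarrow> diff_eval (map_upow \<sigma>) Q x \<noteq> 0)"
  using K P
proof (rule saturated_zero)
  fix Q :: "(nat, 'a upow) mpoly" assume "Q \<noteq> 0" "mpoly_vars Q \<subseteq> {..<m}"
  then show "\<exists>x. diff_eval (map_upow \<sigma>) P x = 0 \<and> diff_eval (map_upow \<sigma>) Q x \<noteq> 0"
    using dc m unfolding differentially_closed_def by blast
qed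

lemma blum_transcendental:
  fixes \<sigma> :: "'a::field_char_0 \<Rightarrow> 'a"
  assumes dc: "differentially_closed (map_upow \<sigma>)" and K: "countable K" "pair_ring (Id_on K)"
  shows "\<exists>x. \<forall>Q. (\<forall>k. Poly_Mapping.lookup Q k \<in> K) \<and> Q \<noteq> 0 \<longrightarrow> diff_eval (map_upow \<sigma>) Q x \<noteq> 0"
proof -
  have "\<exists>x. diff_eval (map_upow \<sigma>) 0 x = 0 \<and> (\<forall>Q. (\<forall>k. Poly_Mapping.lookup Q k \<in> K) \<and> Q \<noteq> 0 \<and>
      mpoly_vars Q \<subseteq> UNIV \<longrightarrow> diff_eval (map_upow \<sigma>) Q x \<noteq> 0)"
    using K
  proof (rule saturated_zero)
    show "Poly_Mapping.lookup 0 m \<in> K" for m :: "nat \<Rightarrow>\<^sub>0 nat"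
      using pair_zero[OF K(2)] by auto
    fix Q :: "(nat, 'a upow) mpoly" assume "Q \<noteq> 0"
    obtain n where n: "mpoly_vars Q \<subseteq> {..<n}"
      using finite_mpoly_vars[of Q] finite_nat_iff_bounded by blast
    \<comment> \<open>The zero polynomial imposes no equation, so any equation of order above that
      of \<open>Q\<close> may be used to avoid \<open>Q\<close>; here it is the vanishing of the
      \<open>n\<close>-th derivative.\<close>
    let ?X = "Poly_Mapping.single (Poly_Mapping.single n 1) 1 :: (nat, 'a upow) mpoly"
    have "n \<in> mpoly_vars ?X" "mpoly_vars ?X \<subseteq> {..n}"
      by (simp_all add: mpoly_vars_def)
    then obtain x where "diff_eval (map_upow \<sigma>) Q x \<noteq> 0"
      using dc n \<open>Q \<noteq> 0\<close> unfolding differentially_closed_def by blast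
    then show "\<exists>x. diff_eval (map_upow \<sigma>) 0 x = 0 \<and> diff_eval (map_upow \<sigma>) Q x \<noteq> 0"
      by (auto simp: diff_eval_def)
  qed
  then show ?thesis by auto
qed

section \<open>Extending partial differential isomorphisms\<close>

definition evals :: "('a::comm_ring_1 \<times> 'b::comm_ring_1) set \<Rightarrow> ('v \<Rightarrow> 'a) \<Rightarrow> ('v \<Rightarrow> 'b) \<Rightarrow> 'v set \<Rightarrow> ('a \<times> 'b) set" where
  "evals \<Gamma> x y U = {(mpoly_eval id x P, mpoly_eval id y P') | P P'.
     (P, P') \<in> mpolys_over \<Gamma> \<and> mpoly_vars P \<subseteq> U \<and> mpoly_vars P' \<subseteq> U}"

lemma evalsI:
  "(P, P') \<in> mpolys_over \<Gamma> \<Longrightarrow> mpoly_vars P \<subseteq> U \<Longrightarrow> mpoly_vars P' \<subseteq> U \<Longrightarrow>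
    (mpoly_eval id x P, mpoly_eval id y P') \<in> evals \<Gamma> x y U"
  unfolding evals_def by blast

lemma mpolys_over_eq_0_iff:
  assumes "partial_iso \<Gamma>" "(P, P') \<in> mpolys_over \<Gamma>"
  shows "Poly_Mapping.keys P = Poly_Mapping.keys P'" "P = 0 \<longleftrightarrow> P' = 0" "mpoly_vars P = mpoly_vars P'"
proof -
  have "(Poly_Mapping.lookup P m, Poly_Mapping.lookup P' m) \<in> \<Gamma>" for m
    using assms(2) by (simp add: mpolys_over_def)
  then have *: "Poly_Mapping.lookup P m = 0 \<longleftrightarrow> Poly_Mapping.lookup P' m = 0" for m
    using assms(1) unfolding partial_iso_def by blast
  then show k: "Poly_Mapping.keys P = Poly_Mapping.keys P'"
    by (simp add: set_eq_iff in_keys_iff)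
  show "P = 0 \<longleftrightarrow> P' = 0"
    using * by (simp add: poly_mapping_eq_iff fun_eq_iff)
  show "mpoly_vars P = mpoly_vars P'"
    by (simp add: mpoly_vars_def k)
qed

lemma mpolys_over_single:
  "pair_ring \<Gamma> \<Longrightarrow> (a, a') \<in> \<Gamma> \<Longrightarrow> (Poly_Mapping.single m a, Poly_Mapping.single m a') \<in> mpolys_over \<Gamma>"
  by (auto simp: mpolys_over_def lookup_single when_def intro: pair_zero)

lemma evals_base:
  assumes \<Gamma>: "pair_ring \<Gamma>"
  shows "\<Gamma> \<subseteq> evals \<Gamma> x y U" "i \<in> U \<Longrightarrow> (x i, y i) \<in> evals \<Gamma> x y U"
proof -
  show "\<Gamma> \<subseteq> evals \<Gamma> x y U"
  proof
    fix z assume "z \<in> \<Gamma>"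
    then obtain a a' where z: "z = (a, a')" "(a, a') \<in> \<Gamma>" by (cases z) auto
    have "mpoly_vars (Poly_Mapping.single 0 a :: ('c, 'a) mpoly) \<subseteq> U" "mpoly_vars (Poly_Mapping.single 0 a' :: ('c, 'b) mpoly) \<subseteq> U"
      using mpoly_vars_single[of "0 :: 'c \<Rightarrow>\<^sub>0 nat" a] mpoly_vars_single[of "0 :: 'c \<Rightarrow>\<^sub>0 nat" a'] by auto
    then have "(mpoly_eval id x (Poly_Mapping.single 0 a), mpoly_eval id y (Poly_Mapping.single 0 a')) \<in> evals \<Gamma> x y U"
      using mpolys_over_single[OF \<Gamma> z(2), of 0] by (intro evalsI)
    then show "z \<in> evals \<Gamma> x y U"
      by (simp add: z mpoly_eval_single)
  qed
  let ?X = "\<lambda>a. Poly_Mapping.single (Poly_Mapping.single i 1) a"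
  assume "i \<in> U"
  then have "mpoly_vars (?X 1 :: ('c, 'a) mpoly) \<subseteq> U" "mpoly_vars (?X 1 :: ('c, 'b) mpoly) \<subseteq> U"
    by (auto simp: mpoly_vars_def)
  then have "(mpoly_eval id x (?X 1), mpoly_eval id y (?X 1)) \<in> evals \<Gamma> x y U"
    using mpolys_over_single[OF \<Gamma> pair_one[OF \<Gamma>], of "Poly_Mapping.single i 1"]
    by (intro evalsI)
  then show "(x i, y i) \<in> evals \<Gamma> x y U"
    by (simp add: mpoly_eval_single mon_val_single)
qed

lemma pair_ring_evals:
  fixes \<Gamma> :: "('a::comm_ring_1 \<times> 'b::comm_ring_1) set"
  assumes \<Gamma>: "pair_ring \<Gamma>"
  shows "pair_ring (evals \<Gamma> x y U)"
  unfolding pair_ring_def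
proof (intro conjI allI impI; (elim conjE)?)
  show "(1, 1) \<in> evals \<Gamma> x y U"
    using evals_base(1)[OF \<Gamma>] pair_one[OF \<Gamma>] by blast
  fix a a' b b' assume "(a, a') \<in> evals \<Gamma> x y U" "(b, b') \<in> evals \<Gamma> x y U"
  then obtain P P' Q Q' where *: "(P, P') \<in> mpolys_over \<Gamma>" "mpoly_vars P \<subseteq> U" "mpoly_vars P' \<subseteq> U"
    "(Q, Q') \<in> mpolys_over \<Gamma>" "mpoly_vars Q \<subseteq> U" "mpoly_vars Q' \<subseteq> U"
    "a = mpoly_eval id x P" "a' = mpoly_eval id y P'" "b = mpoly_eval id x Q" "b' = mpoly_eval id y Q'"
    unfolding evals_def by blast
  note M = pair_ring_mpolys_over[OF \<Gamma>]
  have "mpoly_vars (P - Q) \<subseteq> U" "mpoly_vars (P' - Q') \<subseteq> U" "mpoly_vars (P * Q) \<subseteq> U" "mpoly_vars (P' * Q') \<subseteq> U"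
    using * mpoly_vars_diff[of P Q] mpoly_vars_diff[of P' Q'] mpoly_vars_mult[of P Q] mpoly_vars_mult[of P' Q']
    by blast+
  then have "(mpoly_eval id x (P - Q), mpoly_eval id y (P' - Q')) \<in> evals \<Gamma> x y U"
    "(mpoly_eval id x (P * Q), mpoly_eval id y (P' * Q')) \<in> evals \<Gamma> x y U"
    using pair_diff[OF M *(1,4)] pair_mult[OF M *(1,4)] unfolding evals_def by blast+
  then show "(a - b, a' - b') \<in> evals \<Gamma> x y U" "(a * b, a' * b') \<in> evals \<Gamma> x y U"
    unfolding *(7-10) mpoly_eval_id_diff mpoly_eval_id_mult .
qed

lemma evals_subset:
  assumes "pair_ring S" "\<Gamma> \<subseteq> S" "\<And>i. i \<in> U \<Longrightarrow> (x i, y i) \<in> S"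
  shows "evals \<Gamma> x y U \<subseteq> S"
proof
  fix z assume "z \<in> evals \<Gamma> x y U"
  then obtain P P' where *: "(P, P') \<in> mpolys_over \<Gamma>" "mpoly_vars P \<subseteq> U" "mpoly_vars P' \<subseteq> U"
    "z = (mpoly_eval id x P, mpoly_eval id y P')"
    unfolding evals_def by blast
  show "z \<in> S"
    unfolding *(4)
    by (rule pair_mpoly_eval[OF assms(1)]) (use * assms(2,3) in \<open>auto simp: mpolys_over_def\<close>)
qed

lemma partial_iso_evals:
  assumes \<Gamma>: "partial_iso \<Gamma>"
    and good: "\<And>P P'. (P, P') \<in> mpolys_over \<Gamma> \<Longrightarrow> mpoly_vars P \<subseteq> U \<Longrightarrow> P \<noteq> 0 \<Longrightarrow> mpoly_eval id x P \<noteq> 0"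
    and good': "\<And>P P'. (P, P') \<in> mpolys_over \<Gamma> \<Longrightarrow> mpoly_vars P' \<subseteq> U \<Longrightarrow> P' \<noteq> 0 \<Longrightarrow> mpoly_eval id y P' \<noteq> 0"
  shows "partial_iso (evals \<Gamma> x y U)"
  unfolding partial_iso_def
proof (intro conjI allI impI)
  show "pair_ring (evals \<Gamma> x y U)"
    by (rule pair_ring_evals[OF partial_iso_pair_ring[OF \<Gamma>]])
  fix a b assume "(a, b) \<in> evals \<Gamma> x y U"
  then obtain P P' where *: "(P, P') \<in> mpolys_over \<Gamma>" "mpoly_vars P \<subseteq> U" "mpoly_vars P' \<subseteq> U"
    "a = mpoly_eval id x P" "b = mpoly_eval id y P'"
    unfolding evals_def by blast
  have "P = 0 \<longleftrightarrow> P' = 0"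
    by (rule mpolys_over_eq_0_iff[OF \<Gamma> *(1)])
  then show "a = 0 \<longleftrightarrow> b = 0"
    using good[OF *(1,2)] good'[OF *(1,3)] by (cases "P = 0") (auto simp: *(4,5))
qed

lemma pair_ring_deriv:
  assumes \<Gamma>: "pair_ring \<Gamma>" and D: "ring_derivation D" and E: "ring_derivation E"
  shows "pair_ring {(a, b). (a, b) \<in> \<Gamma> \<and> (D a, E b) \<in> \<Gamma>}"
  unfolding pair_ring_def
  by (auto simp: deriv_1[OF D] deriv_1[OF E] deriv_diff[OF D] deriv_diff[OF E] deriv_mult[OF D] deriv_mult[OF E]
      intro!: pair_one[OF \<Gamma>] pair_zero[OF \<Gamma>] pair_diff[OF \<Gamma>] pair_mult[OF \<Gamma>] pair_add[OF \<Gamma>])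

lemma fractions_divide:
  assumes \<Gamma>: "partial_iso \<Gamma>" and u: "(u, u') \<in> fractions \<Gamma>" and v: "(v, v') \<in> fractions \<Gamma>" "v \<noteq> 0"
  shows "(u / v, u' / v') \<in> fractions \<Gamma>"
proof -
  note R = partial_iso_pair_ring[OF \<Gamma>]
  obtain a a' b b' c c' e e' where *: "(a, a') \<in> \<Gamma>" "(b, b') \<in> \<Gamma>" "b \<noteq> 0" "u = a / b" "u' = a' / b'"
    "(c, c') \<in> \<Gamma>" "(e, e') \<in> \<Gamma>" "e \<noteq> 0" "v = c / e" "v' = c' / e'"
    using u v unfolding fractions_def by blast
  have "(a * e, a' * e') \<in> \<Gamma>" "(b * c, b' * c') \<in> \<Gamma>" "b * c \<noteq> 0"
    using * v(2) by (auto intro!: pair_mult[OF R])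
  then have "((a * e) / (b * c), (a' * e') / (b' * c')) \<in> fractions \<Gamma>"
    unfolding fractions_def by blast
  then show ?thesis by (simp add: *)
qed

lemma solve_linear: "0 = u + s * t \<Longrightarrow> s \<noteq> 0 \<Longrightarrow> t = - u / s" for s t u :: "'a::field"
  by (metis add.inverse_unique nonzero_mult_div_cancel_left)

text \<open>If no derivative \<open>x m\<close> of \<open>c\<close> is algebraic over the earlier
  ones, \<open>c\<close> is matched with a differentially transcendental \<open>c'\<close>.
  Otherwise \<open>m\<close> is taken least and \<open>p\<close> of least degree; Blum's axiom gives
  a \<open>c'\<close> satisfying the transported equation and none of order below \<open>m\<close>.
  Lower derivatives then correspond by genericity, \<open>x m\<close> by minimality of
  \<open>p\<close>, and higher ones are rational in these.\<close>

theorem extend_partial_iso: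
  fixes \<sigma> :: "'a::field_char_0 \<Rightarrow> 'a" and \<Gamma> :: "('b::field_char_0 \<times> 'a upow) set"
  assumes dc: "differentially_closed (map_upow \<sigma>)" and \<Delta>: "ring_derivation \<Delta>"
    and \<Gamma>: "partial_iso \<Gamma>" "countable \<Gamma>" and closed: "\<And>a b. (a, b) \<in> \<Gamma> \<Longrightarrow> (\<Delta> a, map_upow \<sigma> b) \<in> \<Gamma>"
  shows "\<exists>c' \<Gamma>'. partial_iso \<Gamma>' \<and> \<Gamma> \<subseteq> \<Gamma>' \<and> (c, c') \<in> \<Gamma>' \<and> (\<forall>a b. (a, b) \<in> \<Gamma>' \<longrightarrow> (\<Delta> a, map_upow \<sigma> b) \<in> \<Gamma>')"
proof -
  let ?\<delta> = "map_upow \<sigma>"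
  have \<delta>: "ring_derivation ?\<delta>"
    using dc by (simp add: differentially_closed_def derivation_iff)
  note R = partial_iso_pair_ring[OF \<Gamma>(1)]
  define K where "K = snd ` \<Gamma>"
  have K: "countable K" "pair_ring (Id_on K)"
  proof -
    show "countable K" using \<Gamma>(2) by (simp add: K_def)
    have "a - b \<in> K \<and> a * b \<in> K" if ab: "a \<in> K" "b \<in> K" for a b
    proof -
      obtain a' b' where "(a', a) \<in> \<Gamma>" "(b', b) \<in> \<Gamma>" using ab by (auto simp: K_def)
      then have "(a' - b', a - b) \<in> \<Gamma>" "(a' * b', a * b) \<in> \<Gamma>" using pair_diff[OF R] pair_mult[OF R] by blast+
      then show ?thesis unfolding K_def by (metis image_eqI snd_conv)
    qed
    moreover have "1 \<in> K" using pair_one[OF R] unfolding K_def by (metis image_eqI snd_conv)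
    ultimately show "pair_ring (Id_on K)" by (auto simp: pair_ring_def)
  qed
  have VK: "Poly_Mapping.lookup P' k \<in> K" if "(P, P') \<in> mpolys_over \<Gamma>" for P k and P' :: "(nat, 'a upow) mpoly"
    using that unfolding mpolys_over_def K_def by (force intro: rev_image_eqI)
  have vars_eq: "mpoly_vars P = mpoly_vars P'" if "(P, P') \<in> mpolys_over \<Gamma>"
    for P :: "(nat, 'b) mpoly" and P' :: "(nat, 'a upow) mpoly"
    by (rule mpolys_over_eq_0_iff[OF \<Gamma>(1) that])
  define x where "x i = (\<Delta> ^^ i) c" for i :: nat
  have x0: "x 0 = c" and xS: "x (Suc i) = \<Delta> (x i)" for i by (simp_all add: x_def)
  define A where "A j = {Q :: (nat, 'b) mpoly. (\<exists>Q'. (Q, Q' :: (nat, 'a upow) mpoly) \<in> mpolys_over \<Gamma>) \<and> mpoly_vars Q \<subseteq> {..<j}}" for j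
  define alg where "alg j p \<longleftrightarrow> p \<noteq> 0 \<and> (\<forall>r. \<exists>Q\<in>A j. coeff p r = mpoly_eval id x Q) \<and> poly p (x j) = 0" for j p
  \<comment> \<open>Expansion in the last variable reduces to coefficients in fewer variables: a
    vanishing value would make some \<open>x j\<close> algebraic over its predecessors or kill every
    coefficient.\<close>
  have good: "mpoly_eval id x P \<noteq> 0"
    if "\<And>j p. j < m \<Longrightarrow> \<not> alg j p" "P \<in> A m" "P \<noteq> 0" for m P
    using that
  proof (induction m arbitrary: P)
    case 0
    then have "Poly_Mapping.keys P \<subseteq> {0}"
      by (auto simp: A_def mpoly_vars_def)
    then have "mpoly_eval id x P = Poly_Mapping.lookup P 0" and "Poly_Mapping.keys P = {0}"
      using mpoly_eval_superset[of "{0}" P id x] \<open>P \<noteq> 0\<close> by (auto simp: subset_singleton_iff)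
    then have "Poly_Mapping.lookup P 0 \<noteq> 0" by (metis in_keys_iff singletonI)
    with \<open>mpoly_eval id x P = _\<close> show ?case by metis
  next
    case (Suc m)
    show ?case
    proof
      assume eq: "mpoly_eval id x P = 0"
      obtain N where N: "\<And>k. k \<in> Poly_Mapping.keys P \<Longrightarrow> Poly_Mapping.lookup k m \<le> N"
        using finite_nat_set_iff_bounded_le[of "(\<lambda>k. Poly_Mapping.lookup k m) ` Poly_Mapping.keys P"] by auto
      obtain P' :: "(nat, 'a upow) mpoly" where P': "(P, P') \<in> mpolys_over \<Gamma>" "mpoly_vars P \<subseteq> {..<Suc m}"
        using Suc.prems(2) by (auto simp: A_def)
      have cA: "cpart m r P \<in> A m" for r
      proof -
        have "(cpart m r P, cpart m r P') \<in> mpolys_over \<Gamma>"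
          using P'(1) pair_zero[OF R] by (auto simp: mpolys_over_def lookup_cpart)
        moreover have "mpoly_vars (cpart m r P) \<subseteq> {..<m}"
          using mpoly_vars_cpart[of m r P] P'(2) unfolding lessThan_Suc by blast
        ultimately show ?thesis by (auto simp: A_def)
      qed
      define p where "p = (\<Sum>r\<le>N. monom (mpoly_eval id x (cpart m r P)) r)"
      have cp: "coeff p r = (if r \<le> N then mpoly_eval id x (cpart m r P) else 0)" for r
        by (simp add: p_def coeff_sum)
      have zA: "0 \<in> A m"
        using pair_zero[OF pair_ring_mpolys_over[OF R]] by (auto simp: A_def mpoly_vars_def)
      have "poly p (x m) = 0"
        using mpoly_eval_cpart[OF N, where x = x] eq by (simp add: p_def poly_sum poly_monom)
      moreover have "\<forall>r. \<exists>Q\<in>A m. coeff p r = mpoly_eval id x Q"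
      proof
        fix r
        show "\<exists>Q\<in>A m. coeff p r = mpoly_eval id x Q"
          using cA[of r] bexI[OF _ zA, of "\<lambda>Q. coeff p r = mpoly_eval id x Q"] by (cases "r \<le> N") (auto simp: cp)
      qed
      ultimately have "p = 0"
        using Suc.prems(1)[of m p] by (auto simp: alg_def)
      have *: "cpart m r P = 0" if "r \<le> N" for r
      proof (rule ccontr)
        assume "cpart m r P \<noteq> 0"
        then have "mpoly_eval id x (cpart m r P) \<noteq> 0"
          by (intro Suc.IH cA Suc.prems(1)) simp_all
        then show False using cp[of r] \<open>p = 0\<close> that by simp
      qed
      have "cpart m r P = 0" if "\<not> r \<le> N" for r
      proof (rule poly_mapping_eqI)
        fix k
        have "k + Poly_Mapping.single m r \<notin> Poly_Mapping.keys P"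
          using N[of "k + Poly_Mapping.single m r"] that by (auto simp: lookup_add)
        then show "Poly_Mapping.lookup (cpart m r P) k = Poly_Mapping.lookup 0 k"
          by (simp add: lookup_cpart in_keys_iff)
      qed
      with * have "P = 0" by (metis cpart_eq_0_imp)
      with Suc.prems(3) show False by simp
    qed
  qed
  show ?thesis
  proof (cases "\<exists>j p. alg j p")
    case False
    obtain c' where c': "\<And>Q. (\<And>k. Poly_Mapping.lookup Q k \<in> K) \<Longrightarrow> Q \<noteq> 0 \<Longrightarrow> diff_eval ?\<delta> Q c' \<noteq> 0"
      using blum_transcendental[OF dc K] by blast
    define y where "y i = (?\<delta> ^^ i) c'" for i :: nat
    let ?E = "evals \<Gamma> x y UNIV"
    have iso: "partial_iso ?E"
    proof (rule partial_iso_evals[OF \<Gamma>(1)])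
      fix P :: "(nat, 'b) mpoly" and P' :: "(nat, 'a upow) mpoly"
      assume P: "(P, P') \<in> mpolys_over \<Gamma>"
      show "mpoly_eval id x P \<noteq> 0" if nz: "P \<noteq> 0"
      proof -
        obtain m where "mpoly_vars P \<subseteq> {..<m}"
          using finite_mpoly_vars[of P] finite_nat_iff_bounded by blast
        then show ?thesis using good[of m P] False P nz by (auto simp: A_def)
      qed
      show "mpoly_eval id y P' \<noteq> 0" if "P' \<noteq> 0"
        using c'[of P'] VK[OF P] that by (simp add: diff_eval_def y_def[abs_def])
    qed
    let ?T = "{(a, b). (a, b) \<in> ?E \<and> (\<Delta> a, ?\<delta> b) \<in> ?E}"
    note base = evals_base[OF R, where x = x and y = y and U = UNIV]
    have "?E \<subseteq> ?T"
    proof (rule evals_subset)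
      show "pair_ring ?T" by (rule pair_ring_deriv[OF pair_ring_evals[OF R] \<Delta> \<delta>])
      show "\<Gamma> \<subseteq> ?T" using base(1) closed by blast
      show "(x i, y i) \<in> ?T" for i
        using base(2)[of i] base(2)[of "Suc i"] by (simp add: x_def y_def)
    qed
    moreover have "(c, c') \<in> ?E" using base(2)[of 0] by (simp add: x_def y_def)
    ultimately show ?thesis using iso base(1) by blast
  next
    case True
    define m where "m = (LEAST j. \<exists>p. alg j p)"
    have m: "\<exists>p. alg m p" using LeastI_ex[OF True] by (simp add: m_def)
    have less_m: "\<not> alg j p" if "j < m" for j p
      using not_less_Least[of j "\<lambda>j. \<exists>p. alg j p"] that by (auto simp: m_def)
    obtain p where p: "alg m p" and min: "\<And>q. alg m q \<Longrightarrow> degree p \<le> degree q"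
      using m ex_has_least_nat[of "alg m" _ degree] by blast
    define N where "N = degree p"
    have p': "p \<noteq> 0" "poly p (x m) = 0" using p by (auto simp: alg_def)
    have "\<exists>Q Q'. (Q, Q' :: (nat, 'a upow) mpoly) \<in> mpolys_over \<Gamma> \<and> mpoly_vars Q \<subseteq> {..<m} \<and> coeff p r = mpoly_eval id x Q" for r
      using p unfolding alg_def A_def by blast
    then obtain Q and Q' :: "nat \<Rightarrow> (nat, 'a upow) mpoly" where
      Q: "\<And>r. (Q r, Q' r) \<in> mpolys_over \<Gamma>" "\<And>r. mpoly_vars (Q r) \<subseteq> {..<m}"
        "\<And>r. coeff p r = mpoly_eval id x (Q r)" by metis
    have Q'v: "mpoly_vars (Q' r) \<subseteq> {..<m}" for r using Q(2) vars_eq[OF Q(1)] by blast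
    let ?X = "\<lambda>r. Poly_Mapping.single (Poly_Mapping.single m r) 1"
    define P where "P = (\<Sum>r\<le>N. Q r * ?X r)"
    define P' where "P' = (\<Sum>r\<le>N. Q' r * ?X r)"
    note MR = pair_ring_mpolys_over[OF R]
    have PP: "(P, P') \<in> mpolys_over \<Gamma>"
      unfolding P_def P'_def
      by (intro pair_sum[OF MR] pair_mult[OF MR] Q(1) mpolys_over_single[OF R] pair_one[OF R])
    have eP: "mpoly_eval id z P = (\<Sum>r\<le>N. mpoly_eval id z (Q r) * z m ^ r)" for z
      by (simp only: P_def mpoly_eval_id_sum mpoly_eval_id_mult mpoly_eval_id_single mon_val_single mult_1)
    have eP': "mpoly_eval id z P' = (\<Sum>r\<le>N. mpoly_eval id z (Q' r) * z m ^ r)" for z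
      by (simp only: P'_def mpoly_eval_id_sum mpoly_eval_id_mult mpoly_eval_id_single mon_val_single mult_1)
    have vP: "mpoly_vars P \<subseteq> {..m}"
    proof -
      have "mpoly_vars (Q r * ?X r) \<subseteq> {..m}" for r
        using mpoly_vars_mult[of "Q r" "?X r"] Q(2)[of r] mpoly_vars_single[of "Poly_Mapping.single m r" "1::'b"]
        by (fastforce split: if_splits)
      then show ?thesis
        using mpoly_vars_sum[of "\<lambda>r. Q r * ?X r" "{..N}"] unfolding P_def by blast
    qed
    have poly_p: "poly p t = (\<Sum>r\<le>N. mpoly_eval id x (Q r) * t ^ r)" for t
      by (simp add: poly_altdef N_def Q(3))
    \<comment> \<open>Otherwise \<open>p\<close> would be constant, equal to its value
      \<open>0\<close> at \<open>x m\<close>.\<close>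
    have "m \<in> mpoly_vars P"
    proof (rule ccontr)
      assume nm: "m \<notin> mpoly_vars P"
      have "poly p t = 0" for t
      proof -
        have "mpoly_eval id (x(m := t)) (Q r) = mpoly_eval id x (Q r)" for r
          using Q(2)[of r] by (intro mpoly_eval_cong) auto
        then have "poly p t = mpoly_eval id (x(m := t)) P"
          by (simp add: poly_p eP)
        also have "\<dots> = mpoly_eval id x P"
          using nm by (intro mpoly_eval_cong) auto
        also have "\<dots> = poly p (x m)" by (simp add: poly_p eP)
        finally show ?thesis using p' by simp
      qed
      then show False using p'(1) poly_all_0_iff_0 by blast
    qed
    then obtain c' where c': "diff_eval ?\<delta> P' c' = 0"
      "\<And>Q. (\<And>k. Poly_Mapping.lookup Q k \<in> K) \<Longrightarrow> Q \<noteq> 0 \<Longrightarrow> mpoly_vars Q \<subseteq> {..<m} \<Longrightarrow> diff_eval ?\<delta> Q c' \<noteq> 0"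
      using blum_generic[OF dc K VK[OF PP], of m] vP unfolding vars_eq[OF PP] by blast
    define y where "y i = (?\<delta> ^^ i) c'" for i :: nat
    have y0: "y 0 = c'" and yS: "y (Suc i) = ?\<delta> (y i)" for i by (simp_all add: y_def)
    let ?E = "evals \<Gamma> x y {..<m}"
    note base = evals_base[OF R, where x = x and y = y and U = "{..<m}"]
    have iso: "partial_iso ?E"
    proof (rule partial_iso_evals[OF \<Gamma>(1)])
      fix S :: "(nat, 'b) mpoly" and S' :: "(nat, 'a upow) mpoly"
      assume S: "(S, S') \<in> mpolys_over \<Gamma>"
      show "mpoly_eval id x S \<noteq> 0" if "mpoly_vars S \<subseteq> {..<m}" "S \<noteq> 0"
        using good[of m S] less_m S that by (auto simp: A_def)
      show "mpoly_eval id y S' \<noteq> 0" if "mpoly_vars S' \<subseteq> {..<m}" "S' \<noteq> 0"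
        using c'(2)[of S'] VK[OF S] that by (simp add: diff_eval_def y_def[abs_def])
    qed
    define p1 where "p1 = (\<Sum>r\<le>N. monom (mpoly_eval id y (Q' r)) r)"
    have pp: "(p, p1) \<in> polys_over ?E"
    proof -
      have "(coeff p r, coeff p1 r) \<in> ?E" for r
      proof (cases "r \<le> N")
        case True
        then have "coeff p1 r = mpoly_eval id y (Q' r)" by (simp add: p1_def coeff_sum)
        then show ?thesis using Q(1)[of r] Q(2)[of r] Q'v[of r] Q(3)[of r] unfolding evals_def by auto
      next
        case False
        then have "coeff p r = 0" "coeff p1 r = 0"
          by (simp_all add: N_def coeff_eq_0 p1_def coeff_sum)
        then show ?thesis using pair_zero[OF pair_ring_evals[OF R]] by simp
      qed
      then show ?thesis by (simp add: polys_over_def)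
    qed
    have p1: "poly p1 (y m) = 0"
      using c'(1) unfolding diff_eval_def y_def[abs_def, symmetric] by (simp add: eP' p1_def poly_sum poly_monom)
    have minE: "degree p \<le> degree q" if q: "(q, q') \<in> polys_over ?E" "q \<noteq> 0" "poly q (x m) = 0" for q q'
    proof (rule min)
      have "\<exists>Q\<in>A m. coeff q r = mpoly_eval id x Q" for r
        using q(1) unfolding polys_over_def evals_def A_def by blast
      then show "alg m q" using q by (auto simp: alg_def)
    qed
    define \<Gamma>1 where "\<Gamma>1 = {(poly q (x m), poly q' (y m)) | q q'. (q, q') \<in> polys_over ?E}"
    have iso1: "partial_iso \<Gamma>1"
      unfolding \<Gamma>1_def by (rule partial_iso_adjoin_algebraic[OF iso pp p'(1,2) p1 minE])
    define \<Gamma>2 where "\<Gamma>2 = fractions \<Gamma>1"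
    have iso2: "partial_iso \<Gamma>2" and sub12: "\<Gamma>1 \<subseteq> \<Gamma>2"
      unfolding \<Gamma>2_def by (rule partial_iso_fractions[OF iso1])+
    note R2 = partial_iso_pair_ring[OF iso2]
    have E1: "?E \<subseteq> \<Gamma>1"
    proof
      fix z assume "z \<in> ?E"
      then obtain a b where z: "z = (a, b)" "(a, b) \<in> ?E" by (cases z) auto
      have "(poly [:a:] (x m), poly [:b:] (y m)) \<in> \<Gamma>1"
        unfolding \<Gamma>1_def using polys_over_const[OF pair_ring_evals[OF R] z(2)] by blast
      then show "z \<in> \<Gamma>1" by (simp add: z)
    qed
    have xm: "(x m, y m) \<in> \<Gamma>1"
    proof -
      have "(poly (monom 1 1) (x m), poly (monom 1 1) (y m)) \<in> \<Gamma>1"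
        unfolding \<Gamma>1_def
        using polys_over_monom[OF pair_ring_evals[OF R] pair_one[OF pair_ring_evals[OF R]]] by blast
      then show ?thesis by (simp add: poly_monom)
    qed
    have xi: "(x i, y i) \<in> \<Gamma>1" if "i \<le> m" for i
      using that base(2)[of i] E1 xm by (cases "i = m") auto
    \<comment> \<open>\<open>T\<close> is a ring, so it suffices to check on generators of
      \<open>\<Gamma>1\<close> that their derivatives stay in \<open>\<Gamma>2\<close>. Only
      \<open>x m\<close> is critical: its derivative comes from differentiating its equation and
      dividing by the separant.\<close>
    define T where "T = {(a, b). (a, b) \<in> \<Gamma>2 \<and> (\<Delta> a, ?\<delta> b) \<in> \<Gamma>2}"
    have RT: "pair_ring T"
      unfolding T_def by (rule pair_ring_deriv[OF R2 \<Delta> \<delta>])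
    have "?E \<subseteq> T"
    proof (rule evals_subset[OF RT])
      show "\<Gamma> \<subseteq> T" 
      proof -
        have "\<Gamma> \<subseteq> \<Gamma>2" using base(1) E1 sub12 by (meson subset_trans)
        then show ?thesis using closed unfolding T_def by blast
      qed
      show "(x i, y i) \<in> T" if "i \<in> {..<m}" for i
        using xi[of i] xi[of "Suc i"] that sub12 by (auto simp: T_def xS yS)
    qed
    have "(x m, y m) \<in> T"
    proof -
      let ?s = "poly (pderiv p) (x m)" and ?s' = "poly (pderiv p1) (y m)"
      let ?u = "poly (map_poly \<Delta> p) (x m)" and ?u' = "poly (map_poly ?\<delta> p1) (y m)"
      have pd: "(pderiv p, pderiv p1) \<in> polys_over ?E"
        by (rule polys_over_pderiv[OF pair_ring_evals[OF R] pp])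
      have "degree p \<noteq> 0" using degree_pos_if_root[OF p'] by simp
      then have s: "?s \<noteq> 0"
        using minE[OF pd] by (auto simp: pderiv_eq_0_iff degree_pderiv)
      have ss: "(?s, ?s') \<in> \<Gamma>1" unfolding \<Gamma>1_def using pd by blast
      then have s': "?s' \<noteq> 0" using s iso1 by (auto simp: partial_iso_def)
      have "(map_poly \<Delta> p, map_poly ?\<delta> p1) \<in> polys_over \<Gamma>2"
        using pp \<open>?E \<subseteq> T\<close> by (auto simp: polys_over_def T_def coeff_map_deriv[OF \<Delta>] coeff_map_deriv[OF \<delta>])
      then have uu: "(?u, ?u') \<in> \<Gamma>2"
        using xm sub12 by (intro pair_poly[OF R2]) auto
      have "0 = ?u + ?s * x (Suc m)"
        using deriv_poly[OF \<Delta>, of p "x m"] p'(2) by (simp add: deriv_0[OF \<Delta>] xS)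
      moreover have "0 = ?u' + ?s' * y (Suc m)"
        using deriv_poly[OF \<delta>, of p1 "y m"] p1 by (simp add: deriv_0[OF \<delta>] yS)
      ultimately have "x (Suc m) = - ?u / ?s" "y (Suc m) = - ?u' / ?s'"
        using s s' by (blast intro: solve_linear)+
      moreover have "(- ?u / ?s, - ?u' / ?s') \<in> \<Gamma>2"
        unfolding \<Gamma>2_def
        using fractions_divide[OF iso1, of "- ?u" "- ?u'" ?s ?s'] pair_uminus[OF R2 uu] ss sub12 s by (auto simp: \<Gamma>2_def)
      ultimately show ?thesis
        using xm sub12 by (auto simp: T_def xS[symmetric] yS[symmetric])
    qed
    have "\<Gamma>1 \<subseteq> T"
    proof
      fix z assume "z \<in> \<Gamma>1"
      then obtain q q' where z: "z = (poly q (x m), poly q' (y m))" "(q, q') \<in> polys_over ?E"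
        unfolding \<Gamma>1_def by blast
      then show "z \<in> T"
        using \<open>?E \<subseteq> T\<close> \<open>(x m, y m) \<in> T\<close> pair_poly[OF RT, of q q' "x m" "y m"]
        by (auto simp: polys_over_def)
    qed
    have "(\<Delta> u, ?\<delta> u') \<in> \<Gamma>2" if uu: "(u, u') \<in> \<Gamma>2" for u u'
    proof -
      obtain a a' b b' where *: "(a, a') \<in> \<Gamma>1" "(b, b') \<in> \<Gamma>1" "b \<noteq> 0" "u = a / b" "u' = a' / b'"
        using uu unfolding \<Gamma>2_def fractions_def by blast
      have b': "b' \<noteq> 0" using *(2,3) iso1 by (auto simp: partial_iso_def)
      have in2: "(a, a') \<in> \<Gamma>2" "(b, b') \<in> \<Gamma>2" "(\<Delta> a, ?\<delta> a') \<in> \<Gamma>2" "(\<Delta> b, ?\<delta> b') \<in> \<Gamma>2"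
        using *(1,2) \<open>\<Gamma>1 \<subseteq> T\<close> by (auto simp: T_def)
      have "((\<Delta> a * b - a * \<Delta> b) / (b * b), (?\<delta> a' * b' - a' * ?\<delta> b') / (b' * b')) \<in> \<Gamma>2"
        unfolding \<Gamma>2_def using in2 *(3)
        by (intro fractions_divide[OF iso1]) (auto simp: \<Gamma>2_def[symmetric] intro!: pair_diff[OF R2] pair_mult[OF R2])
      then show ?thesis
        using *(3) b' by (simp add: *(4,5) deriv_divide[OF \<Delta>] deriv_divide[OF \<delta>])
    qed
    moreover have "(c, c') \<in> \<Gamma>2" using xi[of 0] sub12 by (auto simp: x0 y0)
    moreover have "\<Gamma> \<subseteq> \<Gamma>2" using base(1) E1 sub12 by blast
    ultimately show ?thesis using iso2 by blast
  qed
qed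

text \<open>Equality of quantifier-free types; an equation reduces to the vanishing of a difference.
  The two derivations may differ, which later allows a point to be constructed for a modified
  derivation and then copied.\<close>

definition same_type :: "('b::field \<Rightarrow> 'b) \<Rightarrow> ('b \<Rightarrow> 'b) \<Rightarrow> 'b set \<Rightarrow> (nat \<Rightarrow> 'b) \<Rightarrow> (nat \<Rightarrow> 'b) \<Rightarrow> bool" where
  "same_type \<Delta> \<delta> C s s' \<longleftrightarrow> (\<forall>t. tm_params t \<subseteq> C \<longrightarrow> (tm_val \<Delta> s t = 0 \<longleftrightarrow> tm_val \<delta> s' t = 0))"

text \<open>The pairs of values of all terms form a countable partial isomorphism closed under the
  derivations.\<close>

lemma same_type_extend:
  fixes \<sigma> :: "'a::field_char_0 \<Rightarrow> 'a"
  assumes dc: "differentially_closed (map_upow \<sigma>)" and \<Delta>: "ring_derivation \<Delta>"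
    and C: "countable C" and st: "same_type \<Delta> (map_upow \<sigma>) C s s'"
  shows "\<exists>c'. same_type \<Delta> (map_upow \<sigma>) C (s(i := c)) (s'(i := c'))"
proof -
  let ?\<delta> = "map_upow \<sigma>"
  define \<Gamma> where "\<Gamma> = (\<lambda>t. (tm_val \<Delta> s t, tm_val ?\<delta> s' t)) ` {t. tm_params t \<subseteq> C}"
  have mem: "(tm_val \<Delta> s t, tm_val ?\<delta> s' t) \<in> \<Gamma>" if "tm_params t \<subseteq> C" for t
    using that by (auto simp: \<Gamma>_def)
  have "pair_ring \<Gamma>"
    unfolding pair_ring_def
  proof (intro conjI allI impI; (elim conjE)?)
    show "(1, 1) \<in> \<Gamma>" using mem[of TOne] by simp
    fix a a' b b' assume "(a, a') \<in> \<Gamma>" "(b, b') \<in> \<Gamma>"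
    then obtain t u where *: "tm_params t \<subseteq> C" "tm_params u \<subseteq> C" "a = tm_val \<Delta> s t" "a' = tm_val ?\<delta> s' t"
      "b = tm_val \<Delta> s u" "b' = tm_val ?\<delta> s' u" by (auto simp: \<Gamma>_def)
    show "(a - b, a' - b') \<in> \<Gamma>" "(a * b, a' * b') \<in> \<Gamma>"
      using mem[of "TAdd t (TNeg u)"] mem[of "TMul t u"] * by simp_all
  qed
  moreover have "a = 0 \<longleftrightarrow> b = 0" if "(a, b) \<in> \<Gamma>" for a b
    using that st by (auto simp: \<Gamma>_def same_type_def)
  ultimately have "partial_iso \<Gamma>" by (simp add: partial_iso_def)
  moreover have "countable \<Gamma>"
    unfolding \<Gamma>_def by (intro countable_image countable_tms C)
  moreover have "(\<Delta> a, ?\<delta> b) \<in> \<Gamma>" if ab: "(a, b) \<in> \<Gamma>" for a b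
  proof -
    obtain t where "tm_params t \<subseteq> C" "a = tm_val \<Delta> s t" "b = tm_val ?\<delta> s' t"
      using ab unfolding \<Gamma>_def by blast
    then show ?thesis using mem[of "TDer t"] by simp
  qed
  ultimately obtain c' \<Gamma>' where *: "partial_iso \<Gamma>'" "\<Gamma> \<subseteq> \<Gamma>'" "(c, c') \<in> \<Gamma>'"
    "\<And>a b. (a, b) \<in> \<Gamma>' \<Longrightarrow> (\<Delta> a, ?\<delta> b) \<in> \<Gamma>'"
    using extend_partial_iso[OF dc \<Delta>, of \<Gamma> c] by blast
  note R = partial_iso_pair_ring[OF *(1)]
  have "(tm_val \<Delta> (s(i := c)) t, tm_val ?\<delta> (s'(i := c')) t) \<in> \<Gamma>'" if "tm_params t \<subseteq> C" for t
    using that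
  proof (induction t)
    case (Var j)
    then show ?case using *(2,3) mem[of "Var j"] by auto
  next
    case (Param a)
    then show ?case using *(2) mem[of "Param a"] by auto
  qed (use pair_zero[OF R] pair_one[OF R] pair_uminus[OF R] pair_add[OF R] pair_mult[OF R] *(4) in auto)
  then have "same_type \<Delta> ?\<delta> C (s(i := c)) (s'(i := c'))"
    using *(1) by (auto simp: same_type_def partial_iso_def)
  then show ?thesis ..
qed

text \<open>Elimination of quantifiers by back and forth: a witness for one tuple is matched by
  extending the isomorphism, in either direction.\<close>

theorem same_type_sat:
  fixes \<sigma> :: "'a::field_char_0 \<Rightarrow> 'a"
  assumes dc: "differentially_closed (map_upow \<sigma>)" and C: "countable C"
    and "same_type (map_upow \<sigma>) (map_upow \<sigma>) C s s'" "fm_params \<phi> \<subseteq> C"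
  shows "sat (map_upow \<sigma>) s \<phi> \<longleftrightarrow> sat (map_upow \<sigma>) s' \<phi>"
  using assms(3,4)
proof (induction \<phi> arbitrary: s s')
  case (FEq t u)
  then have "tm_val (map_upow \<sigma>) s (TAdd t (TNeg u)) = 0 \<longleftrightarrow> tm_val (map_upow \<sigma>) s' (TAdd t (TNeg u)) = 0"
    unfolding same_type_def by (auto simp del: tm_val.simps)
  then show ?case by simp
next
  case (FNot \<phi>)
  then show ?case by simp
next
  case (FAnd \<phi> \<psi>)
  then show ?case by simp
next
  case (FEx i \<phi>)
  have \<delta>: "ring_derivation (map_upow \<sigma>)"
    using dc by (simp add: differentially_closed_def derivation_iff)
  have step: "\<exists>c'. sat (map_upow \<sigma>) (s2(i := c')) \<phi>"
    if "same_type (map_upow \<sigma>) (map_upow \<sigma>) C s1 s2" "sat (map_upow \<sigma>) (s1(i := c)) \<phi>" for s1 s2 c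
    using same_type_extend[OF dc \<delta> C that(1), of i c] FEx.IH FEx.prems(2) that(2) by fastforce
  have "same_type (map_upow \<sigma>) (map_upow \<sigma>) C s' s"
    using FEx.prems(1) by (auto simp: same_type_def)
  then show ?case using step FEx.prems(1) by (auto; blast)
qed


section \<open>Independent constants\<close>

lemma differentially_closed_imp_alg_closed:
  fixes \<delta> :: "'a::field_char_0 \<Rightarrow> 'a"
  assumes "differentially_closed \<delta>"
  shows "alg_closed TYPE('a)"
  unfolding alg_closed_def
proof (intro allI impI)
  fix p :: "'a poly" assume "0 < degree p"
  let ?m = "\<lambda>i. Poly_Mapping.single (0::nat) i"
  define P where "P = (\<Sum>i\<le>degree p. Poly_Mapping.single (?m i) (coeff p i))"
  have inj: "?m i = ?m j \<longleftrightarrow> i = j" for i j :: nat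
    by (metis lookup_single_eq)
  have "Poly_Mapping.lookup P (?m (degree p)) = lead_coeff p"
    by (simp add: P_def lookup_sum lookup_single when_def inj)
  moreover have "lead_coeff p \<noteq> 0" using \<open>0 < degree p\<close> by auto
  ultimately have "?m (degree p) \<in> Poly_Mapping.keys P" by (simp add: in_keys_iff)
  moreover have "0 \<in> Poly_Mapping.keys (?m (degree p))"
    using \<open>0 < degree p\<close> by simp
  ultimately have "0 \<in> mpoly_vars P" unfolding mpoly_vars_def by blast
  moreover have "mpoly_vars P \<subseteq> {..0}"
  proof -
    have "mpoly_vars (Poly_Mapping.single (?m i) (coeff p i)) \<subseteq> {..0}" for i
      using mpoly_vars_single[of "?m i" "coeff p i"] by (auto split: if_splits)
    then show ?thesis
      using mpoly_vars_sum[of "\<lambda>i. Poly_Mapping.single (?m i) (coeff p i)" "{..degree p}"] unfolding P_def by blast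
  qed
  ultimately obtain x where "diff_eval \<delta> P x = 0"
    using assms[unfolded differentially_closed_def, THEN conjunct2, rule_format, of 0 P 1] by auto
  then have "poly p x = 0"
    by (simp add: diff_eval_def P_def mpoly_eval_id_sum mpoly_eval_id_single mon_val_single poly_altdef)
  then show "\<exists>x. poly p x = 0" ..
qed

lemma pair_mpoly_eval_hom:
  assumes S: "pair_ring S" and h: "\<And>a. (h a, h' a) \<in> S" and x: "\<And>i. i \<in> mpoly_vars p \<Longrightarrow> (x i, x' i) \<in> S"
  shows "(mpoly_eval h x p, mpoly_eval h' x' p) \<in> S"
  unfolding mpoly_eval_def
  by (intro pair_sum[OF S] pair_mult[OF S] h pair_prod[OF S] pair_power[OF S] x) (auto simp: mpoly_vars_def)

definition subfield_hom :: "'a::field set \<Rightarrow> ('a \<Rightarrow> 'b::field) \<Rightarrow> bool" where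
  "subfield_hom K \<kappa> \<longleftrightarrow> is_subfield K \<and> \<kappa> 1 = 1 \<and>
     (\<forall>x\<in>K. \<forall>y\<in>K. \<kappa> (x + y) = \<kappa> x + \<kappa> y \<and> \<kappa> (x * y) = \<kappa> x * \<kappa> y)"

context
  fixes K :: "'a::field set" and \<kappa> :: "'a \<Rightarrow> 'b::field"
  assumes K: "subfield_hom K \<kappa>"
begin

lemma subfield_hom_0: "\<kappa> 0 = 0"
proof -
  have "0 \<in> K" using K by (simp add: subfield_hom_def is_subfield_def)
  then have "\<kappa> (0 + 0) = \<kappa> 0 + \<kappa> 0" using K unfolding subfield_hom_def by blast
  then show ?thesis by (metis add.right_neutral add_left_cancel)
qed

lemma subfield_hom_eq_0_iff:
  assumes "x \<in> K"
  shows "\<kappa> x = 0 \<longleftrightarrow> x = 0"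
proof
  assume "\<kappa> x = 0"
  show "x = 0"
  proof (rule ccontr)
    assume "x \<noteq> 0"
    have "inverse x \<in> K" using K assms by (simp add: subfield_hom_def is_subfield_def)
    then have "\<kappa> (x * inverse x) = \<kappa> x * \<kappa> (inverse x)" using K assms unfolding subfield_hom_def by blast
    then show False using \<open>\<kappa> x = 0\<close> \<open>x \<noteq> 0\<close> K by (simp add: subfield_hom_def)
  qed
qed (simp add: subfield_hom_0)

lemma subfield_hom_diff:
  assumes "x \<in> K" "y \<in> K"
  shows "x - y \<in> K" "\<kappa> (x - y) = \<kappa> x - \<kappa> y"
proof -
  have "- y \<in> K" using K assms by (simp add: subfield_hom_def is_subfield_def)
  then have "x + (- y) \<in> K" using K assms unfolding subfield_hom_def is_subfield_def by blast
  then show *: "x - y \<in> K" by simp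
  have "\<kappa> (x - y + y) = \<kappa> (x - y) + \<kappa> y" using K * assms unfolding subfield_hom_def by blast
  then show "\<kappa> (x - y) = \<kappa> x - \<kappa> y" by simp
qed

lemma subfield_hom_mult:
  assumes "x \<in> K" "y \<in> K"
  shows "x * y \<in> K" "\<kappa> (x * y) = \<kappa> x * \<kappa> y"
  using K assms by (simp_all add: subfield_hom_def is_subfield_def)

lemma subfield_hom_1: "1 \<in> K" "\<kappa> 1 = 1"
  using K by (simp_all add: subfield_hom_def is_subfield_def)

lemma pair_ring_graph: "pair_ring {(x, y). x \<in> K \<and> y = \<kappa> x}"
  by (auto simp: pair_ring_def subfield_hom_1 subfield_hom_diff subfield_hom_mult)

lemma pair_ring_graph_poly: "pair_ring {(x, q). x \<in> K \<and> coeff q 0 = \<kappa> x}"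
  by (auto simp: pair_ring_def subfield_hom_1 subfield_hom_diff subfield_hom_mult coeff_mult)

end

lemma subfield_hom_of_rat:
  fixes \<kappa> :: "'a::field_char_0 \<Rightarrow> 'b::field_char_0"
  assumes K: "subfield_hom K \<kappa>"
  shows "of_rat r \<in> K" "\<kappa> (of_rat r) = of_rat r"
proof -
  note G = pair_ring_graph[OF K]
  have int: "of_int k \<in> K \<and> \<kappa> (of_int k) = of_int k" for k
  proof (cases k)
    case (nonneg n)
    then show ?thesis using pair_of_nat[OF G, of n] by simp
  next
    case (neg n)
    then show ?thesis using pair_uminus[OF G pair_of_nat[OF G, of "Suc n"]] by (simp del: of_nat_Suc)
  qed
  obtain a b where "quotient_of r = (a, b)" by (cases "quotient_of r")
  then have r: "r = of_int a / of_int b" "b > 0"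
    by (rule quotient_of_div, rule quotient_of_denom_pos)
  then have ab: "of_rat r = (of_int a / of_int b :: 'a)" "of_rat r = (of_int a / of_int b :: 'b)"
    by (simp_all add: of_rat_divide)
  have "inverse (of_int b) \<in> K" using int[of b] K by (simp add: subfield_hom_def is_subfield_def)
  then show rK: "of_rat r \<in> K"
    unfolding ab divide_inverse using subfield_hom_mult[OF K] int by blast
  have "\<kappa> (of_rat r * of_int b) = \<kappa> (of_rat r) * \<kappa> (of_int b)"
    using subfield_hom_mult(2)[OF K rK] int by blast
  then have "of_int a = \<kappa> (of_rat r) * (of_int b :: 'b)"
    using int r(2) by (simp add: ab(1))
  then show "\<kappa> (of_rat r) = of_rat r"
    using r(2) by (simp add: ab(2) field_simps)
qed

text \<open>The derivation \<open>c\<^sub>k \<mapsto> b\<^sub>k\<close> on \<open>\<rat>[c]\<close> is evaluation at \<open>c\<^sub>k + b\<^sub>k \<epsilon>\<close>. Here the dual numbers are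
  replaced by polynomials in \<open>\<epsilon>\<close>, of which only the coefficients \<open>0\<close> and \<open>1\<close> are used.\<close>

lemma independent_imp_derivation:
  fixes c :: "'i \<Rightarrow> complex" and \<kappa> :: "complex \<Rightarrow> 'b::field_char_0"
  assumes indep: "algebraically_independent_over_Q I c" and K: "subfield_hom K \<kappa>" "c ` I \<subseteq> K"
  shows "\<exists>D. ring_derivation D \<and> (\<forall>k\<in>I. D (\<kappa> (c k)) = b k)"
proof -
  let ?h = "\<lambda>r. [:of_rat r:] :: 'b poly" and ?X = "\<lambda>j. [:\<kappa> (c j), b j:]"
  define ev where "ev p = mpoly_eval ?h ?X p" for p :: "('i, rat) mpoly"
  define G where "G = {(coeff (ev p) 0, coeff (ev p) 1) | p. mpoly_vars p \<subseteq> I}"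
  have h: "?h 0 = 0" "?h (a + b) = ?h a + ?h b" "?h (a * b) = ?h a * ?h b" for a b
    by (simp_all add: of_rat_add of_rat_mult)
  have ev_diff: "ev (p - q) = ev p - ev q" for p q
    using mpoly_eval_add[of ?h ?X "p - q" q] h by (simp add: ev_def)
  have ev_mult: "ev (p * q) = ev p * ev q" for p q
    unfolding ev_def by (rule mpoly_eval_mult) (use h in auto)
  have "ev 1 = 1"
    using mpoly_eval_single[of ?h ?X 0 1] by (simp add: ev_def one_pCons)
  have G: "dual_ring G"
    unfolding dual_ring_def
  proof (intro conjI allI impI; (elim conjE)?)
    have "(coeff (ev 1) 0, coeff (ev 1) 1) \<in> G"
      unfolding G_def by (intro CollectI exI[of _ 1] conjI refl) simp
    then show "(1, 0) \<in> G" by (simp add: \<open>ev 1 = 1\<close>)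
    fix a a' b b' assume "(a, a') \<in> G" "(b, b') \<in> G"
    then obtain p q where *: "mpoly_vars p \<subseteq> I" "mpoly_vars q \<subseteq> I" "a = coeff (ev p) 0" "a' = coeff (ev p) 1"
      "b = coeff (ev q) 0" "b' = coeff (ev q) 1"
      unfolding G_def by blast
    have "mpoly_vars (p - q) \<subseteq> I" "mpoly_vars (p * q) \<subseteq> I"
      using *(1,2) mpoly_vars_diff[of p q] mpoly_vars_mult[of p q] by blast+
    then have "(coeff (ev (p - q)) 0, coeff (ev (p - q)) 1) \<in> G" "(coeff (ev (p * q)) 0, coeff (ev (p * q)) 1) \<in> G"
      unfolding G_def by blast+
    then show "(a - b, a' - b') \<in> G" "(a * b, a' * b + a * b') \<in> G"
      by (simp_all add: * ev_diff ev_mult coeff_mult add.commute)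
  qed
  have funct: "b' = 0" if b': "(0, b') \<in> G" for b'
  proof -
    obtain p where p: "mpoly_vars p \<subseteq> I" "coeff (ev p) 0 = 0" "b' = coeff (ev p) 1"
      using b' unfolding G_def by auto
    \<comment> \<open>The constant term of \<open>ev p\<close> is the image under
      \<open>\<kappa>\<close> of the value of \<open>p\<close> at \<open>c\<close>; it vanishes only
      if that value does, and then independence makes \<open>p\<close> zero.\<close>
    have "(mpoly_eval of_rat c p, ev p) \<in> {(x, q). x \<in> K \<and> coeff q 0 = \<kappa> x}"
      unfolding ev_def using p(1) K(2)
      by (intro pair_mpoly_eval_hom pair_ring_graph_poly[OF K(1)]) (auto simp: subfield_hom_of_rat[OF K(1)])
    then have "mpoly_eval of_rat c p = 0"
      using p(2) subfield_hom_eq_0_iff[OF K(1)] by auto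
    then have "p = 0"
      using indep p(1) unfolding algebraically_independent_over_Q_def by blast
    then show ?thesis by (simp add: p(3) ev_def)
  qed
  obtain D where D: "ring_derivation D" "\<And>a b. (a, b) \<in> G \<Longrightarrow> D a = b"
    using extend_derivation[OF G funct] by blast
  have "D (\<kappa> (c k)) = b k" if "k \<in> I" for k
  proof -
    let ?x = "Poly_Mapping.single (Poly_Mapping.single k 1) 1 :: ('i, rat) mpoly"
    have "mpoly_vars ?x \<subseteq> I" using that mpoly_vars_single[of "Poly_Mapping.single k 1" "1::rat"] by auto
    then have "(coeff (ev ?x) 0, coeff (ev ?x) 1) \<in> G" unfolding G_def by blast
    moreover have "ev ?x = ?X k"
      by (simp add: ev_def mpoly_eval_single mon_val_single)
    ultimately show ?thesis using D(2) by simp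
  qed
  with D(1) show ?thesis by blast
qed

section \<open>The vector field as a formula\<close>

definition tpow :: "nat \<Rightarrow> nat \<Rightarrow> 'a tm" where
  "tpow v i = tprod (replicate i (Var v))"

definition tupoly :: "nat \<Rightarrow> (nat \<Rightarrow> 'a tm) \<Rightarrow> nat \<Rightarrow> 'a tm" where
  "tupoly v ts n = tsum (map (\<lambda>i. TMul (ts i) (tpow v i)) [0..<Suc n])"

lemma tm_val_tpow: "tm_val \<delta> s (tpow v i) = s v ^ i"
  by (simp add: tpow_def tm_val_tprod)

lemma sum_list_upt: "(\<Sum>i\<leftarrow>[0..<Suc n]. h i) = (\<Sum>i\<le>n. h i)"
  by (simp add: interv_sum_list_conv_sum_set_nat atLeast0LessThan lessThan_Suc_atMost del: upt_Suc)

lemma tm_val_tupoly: "tm_val \<delta> s (tupoly v ts n) = (\<Sum>i\<le>n. tm_val \<delta> s (ts i) * s v ^ i)"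
  by (simp add: tupoly_def tm_val_tsum o_def tm_val_tpow sum_list_upt del: upt_Suc)

lemma tm_params_tsum: "tm_params (tsum ts) = (\<Union>t\<in>set ts. tm_params t)"
  by (induction ts) auto

lemma tm_params_tpow [simp]: "tm_params (tpow v i) = {}"
  by (induction i) (auto simp: tpow_def)

lemma tm_params_tupoly: "tm_params (tupoly v ts n) = (\<Union>i\<le>n. tm_params (ts i))"
  by (simp add: tupoly_def tm_params_tsum atLeast0LessThan lessThan_Suc_atMost del: upt_Suc)

lemma map_tm_tsum: "map_tm e (tsum ts) = tsum (map (map_tm e) ts)"
  by (induction ts) auto

lemma map_tm_tpow [simp]: "map_tm e (tpow v i) = tpow v i"
  by (induction i) (auto simp: tpow_def)

lemma map_tm_tupoly: "map_tm e (tupoly v ts n) = tupoly v (\<lambda>i. map_tm e (ts i)) n"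
  by (simp add: tupoly_def map_tm_tsum o_def del: upt_Suc)

definition vf_tm :: "nat \<Rightarrow> (bool \<times> nat \<times> nat \<Rightarrow> 'a) \<Rightarrow> bool \<Rightarrow> 'a tm" where
  "vf_tm d k c = tupoly 1 (\<lambda>j. tupoly 0 (\<lambda>i. Param (k (c, i, j))) (d - j)) d"

definition vf_fm :: "nat \<Rightarrow> (bool \<times> nat \<times> nat \<Rightarrow> 'a) \<Rightarrow> 'a fm" where
  "vf_fm d k = FAnd (FEq (TDer (Var 0)) (vf_tm d k False)) (FEq (TDer (Var 1)) (vf_tm d k True))"

lemma tm_val_vf_tm:
  "tm_val \<delta> s (vf_tm d k c) = (\<Sum>j\<le>d. (\<Sum>i\<le>d - j. k (c, i, j) * s 0 ^ i) * s 1 ^ j)"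
  by (simp add: vf_tm_def tm_val_tupoly)

lemma tm_params_vf_tm: "tm_params (vf_tm d k c) \<subseteq> k ` vf_index d"
  by (auto simp: vf_tm_def tm_params_tupoly vf_index_def)

lemma fm_params_vf_fm: "fm_params (vf_fm d k) \<subseteq> k ` vf_index d"
  using tm_params_vf_tm[of d k False] tm_params_vf_tm[of d k True] by (auto simp: vf_fm_def)

lemma map_fm_vf_fm: "map_fm e (vf_fm d k) = vf_fm d (e \<circ> k)"
  by (simp add: vf_fm_def vf_tm_def map_tm_tupoly)

lemma mpoly_eval_bivariate:
  assumes f: "bivariate_of_degree_le d f" and "\<iota> 0 = 0"
  shows "mpoly_eval \<iota> ((!) [x, y]) f = (\<Sum>j\<le>d. (\<Sum>i\<le>d - j. \<iota> (coeff_xy f i j) * x ^ i) * y ^ j)"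
proof -
  let ?m = "\<lambda>(j, i). Poly_Mapping.single (0::nat) i + Poly_Mapping.single 1 (j::nat)"
  let ?T = "SIGMA j:{..d}. {..d - j}"
  have inj: "inj_on ?m ?T"
  proof (rule inj_onI, clarify)
    fix j i j' i' assume "Poly_Mapping.single (0::nat) i + Poly_Mapping.single 1 (j::nat) =
      Poly_Mapping.single 0 i' + Poly_Mapping.single 1 j'"
    from arg_cong[OF this, of Poly_Mapping.lookup] have
      *: "\<And>v. Poly_Mapping.lookup (Poly_Mapping.single (0::nat) i + Poly_Mapping.single 1 (j::nat)) v =
      Poly_Mapping.lookup (Poly_Mapping.single 0 i' + Poly_Mapping.single 1 j') v" by simp
    show "j = j' \<and> i = i'" using *[of 0] *[of 1] by (simp add: lookup_add lookup_single when_def)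
  qed
  have "Poly_Mapping.keys f \<subseteq> ?m ` ?T"
  proof
    fix m assume m: "m \<in> Poly_Mapping.keys f"
    then have vars: "Poly_Mapping.keys m \<subseteq> {0, 1}" and deg: "Poly_Mapping.lookup m 0 + Poly_Mapping.lookup m 1 \<le> d"
      using f unfolding bivariate_of_degree_le_def mpoly_vars_def by blast+
    have "m = Poly_Mapping.single 0 (Poly_Mapping.lookup m 0) + Poly_Mapping.single 1 (Poly_Mapping.lookup m 1)"
    proof (rule poly_mapping_eqI)
      fix v
      have "Poly_Mapping.lookup m v = 0" if "v \<noteq> 0" "v \<noteq> 1"
        using vars that by (metis empty_iff in_keys_iff insert_iff subsetD)
      then show "Poly_Mapping.lookup m v = Poly_Mapping.lookup
          (Poly_Mapping.single 0 (Poly_Mapping.lookup m 0) + Poly_Mapping.single 1 (Poly_Mapping.lookup m 1)) v"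
        by (auto simp: lookup_add lookup_single when_def)
    qed
    then show "m \<in> ?m ` ?T"
      using deg by (intro image_eqI[of _ _ "(Poly_Mapping.lookup m 1, Poly_Mapping.lookup m 0)"]) auto
  qed
  then have "mpoly_eval \<iota> ((!) [x, y]) f = (\<Sum>m\<in>?m ` ?T. \<iota> (Poly_Mapping.lookup f m) * mon_val ((!) [x, y]) m)"
    using \<open>\<iota> 0 = 0\<close> by (intro mpoly_eval_superset) auto
  also have "\<dots> = (\<Sum>(j, i)\<in>?T. \<iota> (coeff_xy f i j) * (x ^ i * y ^ j))"
    by (subst sum.reindex[OF inj]) (auto intro!: sum.cong simp: coeff_xy_def mon_val_add mon_val_single)
  also have "\<dots> = (\<Sum>j\<le>d. \<Sum>i\<le>d - j. \<iota> (coeff_xy f i j) * (x ^ i * y ^ j))"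
    by (rule sum.Sigma[symmetric]) auto
  finally show ?thesis by (simp add: sum_distrib_right mult.assoc)
qed

lemma vf_solutions_eq_defset:
  assumes "planar_vector_field d f g" and "\<iota> 0 = 0"
  shows "vf_solutions \<iota> f g \<delta> = defset \<delta> 2 (vf_fm d (\<iota> \<circ> vf_coeff f g))"
proof (rule set_eqI)
  fix z
  have ev: "mpoly_eval \<iota> ((!) [x, y]) f = tm_val \<delta> (\<lambda>i. if i < 2 then [x, y] ! i else 0) (vf_tm d (\<iota> \<circ> vf_coeff f g) False)"
    "mpoly_eval \<iota> ((!) [x, y]) g = tm_val \<delta> (\<lambda>i. if i < 2 then [x, y] ! i else 0) (vf_tm d (\<iota> \<circ> vf_coeff f g) True)" for x y
    using assms mpoly_eval_bivariate[of d _ \<iota> x y] by (simp_all add: planar_vector_field_def tm_val_vf_tm)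
  show "z \<in> vf_solutions \<iota> f g \<delta> \<longleftrightarrow> z \<in> defset \<delta> 2 (vf_fm d (\<iota> \<circ> vf_coeff f g))"
  proof (cases "length z = 2")
    case True
    then obtain x y where "z = [x, y]" by (auto simp: numeral_2_eq_2 length_Suc_conv)
    then show ?thesis by (simp add: vf_solutions_def defset_def vf_fm_def ev)
  qed (auto simp: vf_solutions_def defset_def)
qed


section \<open>Countable differential subrings and generic solutions\<close>

text \<open>\<open>K\<close> consists of the values of the countably many terms with parameters in
  \<open>S\<close>, with all variables read as \<open>0\<close>.\<close>

lemma ex_countable_subring:
  fixes \<delta> :: "'a::field \<Rightarrow> 'a"
  assumes "countable S"
  obtains K where "countable K" "S \<subseteq> K" "pair_ring (Id_on K)" "\<delta> ` K \<subseteq> K"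
proof
  let ?K = "tm_val \<delta> (\<lambda>_. 0) ` {t. tm_params t \<subseteq> S}"
  show "countable ?K" using countable_tms[OF assms] by (rule countable_image)
  have mem: "tm_val \<delta> (\<lambda>_. 0) t \<in> ?K" if "tm_params t \<subseteq> S" for t
    using that by blast
  show "S \<subseteq> ?K"
  proof
    fix c assume "c \<in> S"
    then show "c \<in> ?K" using mem[of "Param c"] by simp
  qed
  show "pair_ring (Id_on ?K)"
    unfolding pair_ring_def
  proof (intro conjI allI impI; (elim conjE)?)
    have "1 \<in> ?K" using mem[of TOne] by simp
    then show "(1, 1) \<in> Id_on ?K" by (rule Id_onI)
    fix a a' b b' assume "(a, a') \<in> Id_on ?K" "(b, b') \<in> Id_on ?K"
    then obtain t u where *: "tm_params t \<subseteq> S" "tm_params u \<subseteq> S" "a = tm_val \<delta> (\<lambda>_. 0) t" "a' = a"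
      "b = tm_val \<delta> (\<lambda>_. 0) u" "b' = b" by blast
    have "a - b \<in> ?K" "a * b \<in> ?K"
      using mem[of "TAdd t (TNeg u)"] mem[of "TMul t u"] * by simp_all
    then show "(a - b, a' - b') \<in> Id_on ?K" "(a * b, a' * b') \<in> Id_on ?K"
      unfolding *(4,6) by - (rule Id_onI, assumption)+
  qed
  show "\<delta> ` ?K \<subseteq> ?K"
  proof
    fix b assume "b \<in> \<delta> ` ?K"
    then obtain t where "tm_params t \<subseteq> S" "b = \<delta> (tm_val \<delta> (\<lambda>_. 0) t)" by blast
    then show "b \<in> ?K" using mem[of "TDer t"] by simp
  qed
qed

lemma ring_gen_subset:
  assumes "pair_ring (Id_on K)" "S \<subseteq> K"
  shows "ring_gen S \<subseteq> K"
proof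
  fix x assume "x \<in> ring_gen S"
  then have "(x, x) \<in> Id_on K"
    by induction (use assms pair_one[OF assms(1)] pair_diff[OF assms(1)] pair_mult[OF assms(1)] in auto)
  then show "x \<in> K" by blast
qed

text \<open>A bivariate polynomial at \<open>(x, \<delta> x)\<close> is a differential polynomial of
  order at most one; distinct exponent pairs give distinct monomials, so nonzero stays
  nonzero.\<close>

lemma generic_eval2_nonzero:
  fixes P :: "'a::field poly poly"
  assumes gen: "\<And>Q. (\<And>k. Poly_Mapping.lookup Q k \<in> K) \<Longrightarrow> Q \<noteq> 0 \<Longrightarrow> diff_eval \<delta> Q x \<noteq> 0"
    and K: "pair_ring (Id_on K)" and P: "P \<in> over2 K" "P \<noteq> 0"
  shows "eval2 P x (\<delta> x) \<noteq> 0"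
proof -
  let ?m = "\<lambda>i j. Poly_Mapping.single (0::nat) i + Poly_Mapping.single 1 (j::nat)"
  define c where "c i j = coeff (coeff P j) i" for i j
  define Q where "Q = (\<Sum>j\<le>degree P. \<Sum>i\<le>degree (coeff P j). Poly_Mapping.single (?m i j) (c i j))"
  have "0 \<in> K" using pair_zero[OF K] by auto
  have inj: "?m i j = ?m i' j' \<longleftrightarrow> i = i' \<and> j = j'" for i j i' j'
  proof
    assume eq: "?m i j = ?m i' j'"
    have "Poly_Mapping.lookup (?m i j) v = Poly_Mapping.lookup (?m i' j') v" for v by (simp only: eq)
    from this[of 0] this[of 1] show "i = i' \<and> j = j'" by (simp add: lookup_add lookup_single when_def)
  qed simp
  have look: "Poly_Mapping.lookup Q k =
      (\<Sum>j\<le>degree P. \<Sum>i\<le>degree (coeff P j). if ?m i j = k then c i j else 0)" for k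
    by (simp add: Q_def lookup_sum lookup_single when_def)
  have "Poly_Mapping.lookup Q k \<in> K" for k
  proof -
    have "(Poly_Mapping.lookup Q k, Poly_Mapping.lookup Q k) \<in> Id_on K"
      unfolding look using P(1) \<open>0 \<in> K\<close> by (intro pair_sum[OF K]) (auto simp: c_def over2_iff)
    then show ?thesis by blast
  qed
  moreover have "Q \<noteq> 0"
  proof
    assume "Q = 0"
    let ?n = "degree P" and ?l = "degree (lead_coeff P)"
    have "Poly_Mapping.lookup Q (?m ?l ?n) = (\<Sum>j\<le>?n. \<Sum>i\<le>degree (coeff P j). if i = ?l \<and> j = ?n then c i j else 0)"
      unfolding look inj ..
    also have "\<dots> = (\<Sum>j\<le>?n. if j = ?n then c ?l ?n else 0)"
    proof (rule sum.cong[OF refl])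
      fix j
      show "(\<Sum>i\<le>degree (coeff P j). if i = ?l \<and> j = ?n then c i j else 0) = (if j = ?n then c ?l ?n else 0)"
        by (cases "j = ?n") simp_all
    qed
    also have "\<dots> = c ?l ?n" by simp
    finally show False using \<open>Q = 0\<close> P(2) by (simp add: c_def)
  qed
  ultimately have "diff_eval \<delta> Q x \<noteq> 0" by (rule gen)
  moreover have "diff_eval \<delta> Q x = (\<Sum>j\<le>degree P. \<Sum>i\<le>degree (coeff P j). c i j * (x ^ i * \<delta> x ^ j))"
    by (simp add: Q_def diff_eval_def mpoly_eval_id_sum mpoly_eval_id_single mon_val_add mon_val_single)
  also have "\<dots> = eval2 P x (\<delta> x)"
  proof -
    have "eval2 P x (\<delta> x) = (\<Sum>j\<le>degree P. poly (coeff P j) x * \<delta> x ^ j)"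
      unfolding eval2_def poly_altdef[of P] by (simp add: poly_sum poly_power)
    then show ?thesis
      by (simp add: poly_altdef[of "coeff P _"] c_def sum_distrib_right mult.assoc)
  qed
  finally show ?thesis by simp
qed

section \<open>Passing between a structure and its ultrapower\<close>

lemma eventually_ultra_finite:
  assumes "finite A" "eventually (\<lambda>n. f n \<in> A) ultra"
  shows "abs_upow f \<in> const_upow ` A"
  using assms
proof (induction A rule: finite_induct)
  case (insert a A)
  then have "eventually (\<lambda>n. f n = a) ultra \<or> eventually (\<lambda>n. f n \<in> A) ultra"
    by (simp add: eventually_ultra_disj)
  then show ?case
    using insert.IH by (auto simp: const_upow_def abs_upow_eq_iff)
qed simp

lemma Los_const:
  "sat (map_upow \<sigma>) (\<lambda>i. abs_upow (S i)) (map_fm const_upow \<phi>) \<longleftrightarrow>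
    eventually (\<lambda>n. sat \<sigma> (\<lambda>i. S i n) \<phi>) ultra"
proof -
  have "map_fm const_upow \<phi> = map_fm abs_upow (map_fm (\<lambda>a n. a) \<phi>)"
    by (simp add: const_upow_def[abs_def] fm.map_comp o_def)
  then show ?thesis unfolding \<open>map_fm const_upow \<phi> = _\<close> Los by (simp add: fm.map_comp o_def fm.map_ident)
qed

lemma const_upow_hom:
  "const_upow 0 = 0" "const_upow 1 = 1" "const_upow (a + b) = const_upow a + const_upow b"
  "const_upow (a - b) = const_upow a - const_upow b" "const_upow (a * b) = const_upow a * const_upow b"
  "map_upow \<sigma> (const_upow a) = const_upow (\<sigma> a)" "const_upow a = const_upow b \<longleftrightarrow> a = b"
  by (simp_all add: const_upow_def zero_upow_def one_upow_def plus_upow.abs_eq minus_upow.abs_eq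
      times_upow.abs_eq map_upow.abs_eq abs_upow_eq_iff)

lemma poly_const_upow: "poly (map_poly const_upow q) (abs_upow f) = abs_upow (\<lambda>n. poly q (f n))"
  by (induction q)
    (simp_all add: zero_upow_def[symmetric] map_poly_pCons const_upow_hom,
      simp add: zero_upow_def const_upow_def plus_upow.abs_eq times_upow.abs_eq)

definition assign :: "'a::zero list \<Rightarrow> nat \<Rightarrow> 'a" where
  "assign xs i = (if i < 2 then xs ! i else 0)"

lemma assign_simps: "assign [x, y] 0 = x" "assign [x, y] 1 = y" "assign [x, y] (Suc 0) = y"
  by (simp_all add: assign_def)

lemma mem_defset: "[x, y] \<in> defset \<delta> 2 \<phi> \<longleftrightarrow> sat \<delta> (assign [x, y]) \<phi>"
  by (simp add: defset_def assign_def[abs_def])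

lemma length_2_cases:
  assumes "z \<in> defset \<delta> 2 \<phi>"
  obtains x y where "z = [x, y]"
  using assms by (auto simp: defset_def numeral_2_eq_2 length_Suc_conv)

lemma assign_const: "const_upow \<circ> assign [x, y] = assign [const_upow x, const_upow y]"
  by (auto simp: assign_def const_upow_hom less_2_cases_iff)

lemma assign_abs: "assign [abs_upow f, abs_upow g] = (\<lambda>i. abs_upow (\<lambda>n. assign [f n, g n] i))"
  by (auto simp: assign_def zero_upow_def less_2_cases_iff)

text \<open>Two structures at once: the solution set under study lives in the carrier of
  \<open>\<sigma>\<close>, while generic points are found in its ultrapower, where
  \<open>generic_vf\<close> holds for the constant images of the coefficients.\<close>

locale ultra_vf = generic_vf "map_upow \<sigma>" d "\<lambda>k. const_upow (c0 k)"
  for \<sigma> :: "'w::field_char_0 \<Rightarrow> 'w" and d c0 +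
  assumes dc: "differentially_closed \<sigma>"
begin

abbreviation "\<delta>M \<equiv> map_upow \<sigma>"
abbreviation "idx \<equiv> vf_index d"

lemma dcM: "differentially_closed \<delta>M"
  by (rule elementary_differentially_closed[OF elementary_const_upow dc])

lemma eval2_vp: "eval2 (vp c) x y = (\<Sum>j\<le>d. (\<Sum>i\<le>d - j. const_upow (c0 (c, i, j)) * x ^ i) * y ^ j)"
  unfolding vp_def eval2_def by (simp add: poly_sum poly_monom poly_power)

lemma sat_vf_fm: "sat \<delta>M s (vf_fm d (const_upow \<circ> c0)) \<longleftrightarrow> sol (s 0) (s 1)"
  by (simp add: vf_fm_def tm_val_vf_tm sol_def eval2_vp)

lemma const_solution_iff: "[x, y] \<in> defset \<sigma> 2 (vf_fm d c0) \<longleftrightarrow> sol (const_upow x) (const_upow y)"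
proof -
  have "sat \<delta>M (const_upow \<circ> assign [x, y]) (map_fm const_upow (vf_fm d c0)) \<longleftrightarrow> sat \<sigma> (assign [x, y]) (vf_fm d c0)"
    using elementary_const_upow unfolding elementary_embedding_def by blast
  then show ?thesis
    by (simp add: mem_defset assign_const map_fm_vf_fm sat_vf_fm assign_simps)
qed

text \<open>At a solution every term is a polynomial in the two coordinates, with \<open>DD\<close>
  in place of the derivation. Further variables are read as \<open>0\<close>, in accordance with
  \<open>assign\<close>.\<close>

primrec poly_of_tm :: "'w upow tm \<Rightarrow> 'w upow poly poly" where
  "poly_of_tm (Var i) = (if i = 0 then [:[:0, 1:]:] else if i = 1 then [:0, 1:] else 0)"
| "poly_of_tm (Param c) = [:[:c:]:]"
| "poly_of_tm TZero = 0"
| "poly_of_tm TOne = 1"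
| "poly_of_tm (TNeg t) = 0 - poly_of_tm t"
| "poly_of_tm (TAdd t u) = poly_of_tm t + poly_of_tm u"
| "poly_of_tm (TMul t u) = poly_of_tm t * poly_of_tm u"
| "poly_of_tm (TDer t) = DD (poly_of_tm t)"

lemma eval2_minus [simp]: "eval2 (- P) x y = - eval2 P x y"
  by (simp add: eval2_def)

lemma eval2_poly_of_tm: "sol x y \<Longrightarrow> eval2 (poly_of_tm t) x y = tm_val \<delta>M (assign [x, y]) t"
  by (induction t) (auto simp: assign_def deriv_sol[symmetric] less_2_cases_iff
      simp del: mult_pCons_left mult_pCons_right)

lemma poly_of_tm_over2: "dclosed L \<Longrightarrow> tm_params t \<subseteq> L \<Longrightarrow> poly_of_tm t \<in> over2 L"
proof (induction t)
  case TZero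
  then show ?case using over2_diff[OF dclosed_pair_ring over2_1 over2_1] dclosed_pair_ring by fastforce
next
  case (Var i)
  then show ?case
    using over2_x[OF dclosed_pair_ring] over2_y[OF dclosed_pair_ring] dclosed_0
    by (auto simp: over2_iff[of 0])
next
  case (TNeg t)
  then show ?case
    unfolding poly_of_tm.simps by (intro over2_diff[OF dclosed_pair_ring]) (auto simp: over2_iff[of 0] dclosed_0)
qed (auto intro: over2_1[OF dclosed_pair_ring] over2_const[OF dclosed_pair_ring] over2_add[OF dclosed_pair_ring]
    over2_mult[OF dclosed_pair_ring] DD_over2)

text \<open>A term vanishes at a generic solution exactly if its polynomial is zero, a condition
  that does not mention the solution; so the quantifier-free types agree.\<close>

theorem generic_solutions_same_formulas:
  assumes C: "countable C" "(\<lambda>k. const_upow (c0 k)) ` idx \<subseteq> C"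
    and x: "sol x1 x2" "\<not> {x1, x2} \<subseteq> dcl C" and y: "sol y1 y2" "\<not> {y1, y2} \<subseteq> dcl C"
    and "fm_params \<phi> \<subseteq> C"
  shows "sat \<delta>M (assign [x1, x2]) \<phi> \<longleftrightarrow> sat \<delta>M (assign [y1, y2]) \<phi>"
proof (rule same_type_sat[OF dcM C(1) _ assms(7)])
  have L: "dclosed (dcl C)" by (rule dclosed_dcl[OF C(2)])
  show "same_type \<delta>M \<delta>M C (assign [x1, x2]) (assign [y1, y2])"
    unfolding same_type_def
  proof (intro allI impI)
    fix t assume "tm_params t \<subseteq> C"
    then have P: "poly_of_tm t \<in> over2 (dcl C)"
      using dcl_base[of C] by (intro poly_of_tm_over2[OF L]) blast
    have "tm_val \<delta>M (assign [z1, z2]) t = 0 \<longleftrightarrow> poly_of_tm t = 0" if "sol z1 z2" "\<not> {z1, z2} \<subseteq> dcl C" for z1 z2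
      using generic_over[OF L that(1) _ P] that(2) eval2_poly_of_tm[OF that(1), of t] by auto
    then show "tm_val \<delta>M (assign [x1, x2]) t = 0 \<longleftrightarrow> tm_val \<delta>M (assign [y1, y2]) t = 0"
      using x y by blast
  qed
qed

text \<open>On \<open>K(\<xi>, \<delta> \<xi>)\<close> with \<open>\<xi>\<close> differentially transcendental over \<open>K\<close>, a new derivation \<open>\<Delta>\<close> makes the
  pair \<open>(\<xi>, \<delta> \<xi>)\<close> a solution. Back and forth realizes its type in the original structure.\<close>

lemma ex_generic_solution:
  assumes S: "countable S" "(\<lambda>k. const_upow (c0 k)) ` idx \<subseteq> S"
  obtains x y where "sol x y" "\<not> {x, y} \<subseteq> dcl S"
proof -
  obtain K where K: "countable K" "S \<subseteq> K" "pair_ring (Id_on K)" "\<delta>M ` K \<subseteq> K"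
    using ex_countable_subring[OF S(1)] by blast
  obtain \<xi> where \<xi>: "\<And>Q. (\<And>k. Poly_Mapping.lookup Q k \<in> K) \<Longrightarrow> Q \<noteq> 0 \<Longrightarrow> diff_eval \<delta>M Q \<xi> \<noteq> 0"
    using blum_transcendental[OF dcM K(1,3)] by blast
  define \<eta> where "\<eta> = \<delta>M \<xi>"
  have nz: "P = 0" if "P \<in> over2 K" "eval2 P \<xi> \<eta> = 0" for P
    using generic_eval2_nonzero[OF \<xi> K(3), of P] that unfolding \<eta>_def by blast
  define G where "G = {(eval2 P \<xi> \<eta>, eval2 (DD P) \<xi> \<eta>) | P. P \<in> over2 K}"
  have GI: "(eval2 P \<xi> \<eta>, eval2 (DD P) \<xi> \<eta>) \<in> G" if "P \<in> over2 K" for P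
    using that unfolding G_def by blast
  have G: "dual_ring G"
    unfolding dual_ring_def
  proof (intro conjI allI impI; (elim conjE)?)
    show "(1, 0) \<in> G"
      using GI[OF over2_1[OF K(3)]] by (simp add: deriv_1[OF ring_derivation_DD])
    fix a a' b b' assume "(a, a') \<in> G" "(b, b') \<in> G"
    then obtain P Q where *: "P \<in> over2 K" "Q \<in> over2 K" "a = eval2 P \<xi> \<eta>" "a' = eval2 (DD P) \<xi> \<eta>"
      "b = eval2 Q \<xi> \<eta>" "b' = eval2 (DD Q) \<xi> \<eta>"
      unfolding G_def by blast
    show "(a - b, a' - b') \<in> G" "(a * b, a' * b + a * b') \<in> G"
      using GI[OF over2_diff[OF K(3) *(1,2)]] GI[OF over2_mult[OF K(3) *(1,2)]]
      by (simp_all add: * deriv_diff[OF ring_derivation_DD] DD_mult)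
  qed
  have funct: "b = 0" if b: "(0, b) \<in> G" for b
  proof -
    obtain P where "P \<in> over2 K" "eval2 P \<xi> \<eta> = 0" "b = eval2 (DD P) \<xi> \<eta>"
      using b unfolding G_def by auto
    then show ?thesis using nz[of P] by (simp add: deriv_0[OF ring_derivation_DD])
  qed
  obtain \<Delta> where \<Delta>: "ring_derivation \<Delta>" "\<And>a b. (a, b) \<in> G \<Longrightarrow> \<Delta> a = b"
    using extend_derivation[OF G funct] by blast
  have \<Delta>K: "\<Delta> a = \<delta>M a" if "a \<in> K" for a
    using \<Delta>(2)[OF GI[OF over2_const[OF K(3) that]]] by (simp add: DD_const)
  have \<Delta>\<xi>: "\<Delta> \<xi> = eval2 (vp False) \<xi> \<eta>" and \<Delta>\<eta>: "\<Delta> \<eta> = eval2 (vp True) \<xi> \<eta>"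
    using \<Delta>(2)[OF GI[OF over2_x[OF K(3)]]] \<Delta>(2)[OF GI[OF over2_y[OF K(3)]]] by (simp_all add: DD_x DD_y)
  have "tm_val \<delta>M (\<lambda>_. 0) t \<in> K \<and> tm_val \<Delta> (\<lambda>_. 0) t = tm_val \<delta>M (\<lambda>_. 0) t" if "tm_params t \<subseteq> K" for t
  proof -
    have "tm_params t \<subseteq> K \<Longrightarrow> (tm_val \<Delta> (\<lambda>_. 0) t, tm_val \<delta>M (\<lambda>_. 0) t) \<in> Id_on K"
    proof (induction t)
      case (TDer t)
      then have "tm_val \<delta>M (\<lambda>_. 0) t \<in> K" "tm_val \<Delta> (\<lambda>_. 0) t = tm_val \<delta>M (\<lambda>_. 0) t" by auto
      then show ?case using \<Delta>K K(4) by auto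
    next
      case (Param c)
      then show ?case by (simp add: Id_onI)
    qed (use pair_zero[OF K(3)] pair_one[OF K(3)] pair_uminus[OF K(3)] pair_add[OF K(3)] pair_mult[OF K(3)] in \<open>simp_all\<close>)
    then show ?thesis using that by auto
  qed
  \<comment> \<open>The starting point of back and forth: \<open>\<Delta>\<close> and
    \<open>\<delta>M\<close> agree on \<open>K\<close>, and all variables are still
    \<open>0\<close>.\<close>
  then have "same_type \<Delta> \<delta>M K (\<lambda>_. 0) (\<lambda>_. 0)"
    unfolding same_type_def by metis
  from same_type_extend[OF dcM \<Delta>(1) K(1) this, of 0 \<xi>] obtain x where
    "same_type \<Delta> \<delta>M K ((\<lambda>_. 0)(0 := \<xi>)) ((\<lambda>_. 0)(0 := x))" ..
  from same_type_extend[OF dcM \<Delta>(1) K(1) this, of 1 \<eta>] obtain y where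
    "same_type \<Delta> \<delta>M K ((\<lambda>_. 0)(0 := \<xi>, 1 := \<eta>)) ((\<lambda>_. 0)(0 := x, 1 := y))" ..
  then have st: "tm_val \<Delta> (assign [\<xi>, \<eta>]) t = 0 \<longleftrightarrow> tm_val \<delta>M (assign [x, y]) t = 0" if "tm_params t \<subseteq> K" for t
  proof -
    have "(\<lambda>_. 0)(0 := u, 1 := v) = assign [u, v]" for u v :: "'w upow"
      by (auto simp: assign_def less_2_cases_iff)
    then show ?thesis using that \<open>same_type \<Delta> \<delta>M K ((\<lambda>_. 0)(0 := \<xi>, 1 := \<eta>)) _\<close> by (simp add: same_type_def)
  qed
  have cK: "tm_params (vf_tm d (const_upow \<circ> c0) c) \<subseteq> K" for c
    using tm_params_vf_tm[of d "const_upow \<circ> c0" c] S(2) K(2) by (auto simp: image_image)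
  have "sol x y"
    using st[of "TAdd (TDer (Var 0)) (TNeg (vf_tm d (const_upow \<circ> c0) False))"]
      st[of "TAdd (TDer (Var 1)) (TNeg (vf_tm d (const_upow \<circ> c0) True))"] cK \<Delta>\<xi> \<Delta>\<eta>
    by (simp add: assign_simps sol_def eval2_vp tm_val_vf_tm)
  \<comment> \<open>A nontrivial polynomial relation for \<open>x\<close> over \<open>K\<close>
    would carry over to \<open>\<xi>\<close>, which satisfies none.\<close>
  moreover have "x \<notin> dcl S"
  proof
    assume "x \<in> dcl S"
    then obtain p where p: "p \<noteq> 0" "\<And>i. coeff p i \<in> ring_gen {(\<delta>M ^^ i) c | c i. c \<in> S}" "poly p x = 0"
      unfolding dcl_def using alg_closure_imp_algebraic by blast
    have "(\<delta>M ^^ i) c \<in> K" if "c \<in> S" for c i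
      by (induction i) (use that K(2,4) in auto)
    then have "{(\<delta>M ^^ i) c | c i. c \<in> S} \<subseteq> K" by blast
    then have pK: "coeff p i \<in> K" for i
      using p(2) ring_gen_subset[OF K(3)] by blast
    let ?t = "tupoly 0 (\<lambda>i. Param (coeff p i)) (degree p)"
    have "tm_val \<delta>M (assign [x, y]) ?t = poly p x" "tm_val \<Delta> (assign [\<xi>, \<eta>]) ?t = poly p \<xi>"
      by (simp_all add: tm_val_tupoly assign_simps poly_altdef)
    moreover have "tm_params ?t \<subseteq> K" using pK by (auto simp: tm_params_tupoly)
    ultimately have "eval2 [:p:] \<xi> \<eta> = 0" using st[of ?t] p(3) by simp
    moreover have "[:p:] \<in> over2 K"
      using pK pair_zero[OF K(3)] by (auto simp: over2_iff coeff_pCons split: nat.splits)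
    ultimately show False using nz[of "[:p:]"] p(1) by simp
  qed
  ultimately show ?thesis using that by blast
qed

end


section \<open>Strong minimality and algebraic closure\<close>

lemma acl_mono: "C \<subseteq> E \<Longrightarrow> acl \<delta> n C \<subseteq> acl \<delta> n E"
  unfolding acl_def definable_over_def by blast

lemma finite_subset_UN_Un:
  assumes "finite P" "P \<subseteq> (\<Union>a\<in>A. F a) \<union> B" "A \<noteq> {}"
  shows "\<exists>A0\<subseteq>A. finite A0 \<and> A0 \<noteq> {} \<and> P \<subseteq> (\<Union>a\<in>A0. F a) \<union> B"
  using assms(1,2)
proof (induction P rule: finite_induct)
  case empty
  obtain a where "a \<in> A" using assms(3) by blast
  then show ?case by (intro exI[of _ "{a}"]) auto
next
  case (insert p P)
  then obtain A0 where A0: "A0 \<subseteq> A" "finite A0" "A0 \<noteq> {}" "P \<subseteq> (\<Union>a\<in>A0. F a) \<union> B" by blast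
  show ?case
  proof (cases "p \<in> B")
    case True
    then show ?thesis using A0 by blast
  next
    case False
    then obtain a where "a \<in> A" "p \<in> F a" using insert.prems by blast
    then show ?thesis using A0 by (intro exI[of _ "insert a A0"]) auto
  qed
qed

lemma finite_fm_params: "finite (fm_params \<phi>)"
proof -
  have "finite (tm_params t)" for t :: "'a tm" by (induction t) auto
  then show ?thesis by (induction \<phi>) auto
qed

lemma poly_eq_map_const:
  assumes "\<And>i. coeff p i = const_upow (q i)"
  shows "p = map_poly const_upow (\<Sum>i\<le>degree p. monom (q i) i)"
proof (rule poly_eqI)
  fix i
  have "q i = 0" if "\<not> i \<le> degree p"
    using assms[of i] that by (metis coeff_eq_0 const_upow_hom(1,7) not_le)
  then show "coeff p i = coeff (map_poly const_upow (\<Sum>i\<le>degree p. monom (q i) i)) i"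
    by (simp add: coeff_map_poly const_upow_hom assms coeff_sum)
qed

context ultra_vf
begin

abbreviation "W \<equiv> range const_upow :: 'w upow set"

text \<open>A root of a polynomial with constant coefficients is, at almost every index, one of
  finitely many elements; the ultrafilter selects one of them.\<close>

lemma alg_closure_consts: "alg_closure W = W"
proof (rule subset_antisym[OF subsetI alg_closure_base])
  fix x assume "x \<in> alg_closure W"
  then obtain p where p: "p \<noteq> 0" "\<And>i. coeff p i \<in> ring_gen W" "poly p x = 0"
    using alg_closure_imp_algebraic by blast
  have W: "a - b \<in> W" "a * b \<in> W" if ab: "a \<in> W" "b \<in> W" for a b
  proof -
    obtain a' b' where "a = const_upow a'" "b = const_upow b'" using ab by blast
    then have "a - b = const_upow (a' - b')" "a * b = const_upow (a' * b')" by (simp_all add: const_upow_hom)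
    then show "a - b \<in> W" "a * b \<in> W" by blast+
  qed
  have "1 \<in> W" by (metis const_upow_hom(2) rangeI)
  have "a \<in> ring_gen W \<Longrightarrow> a \<in> W" for a
    by (induction rule: ring_gen.induct) (rule \<open>1 \<in> W\<close> W | assumption)+
  then have "\<forall>i. \<exists>c. coeff p i = const_upow c" using p(2) by blast
  then obtain q where q: "\<And>i. coeff p i = const_upow (q i)" by metis
  define r where "r = (\<Sum>i\<le>degree p. monom (q i) i)"
  have pr: "p = map_poly const_upow r"
    unfolding r_def by (rule poly_eq_map_const) (rule q)
  then have "r \<noteq> 0" using p(1) by auto
  have "abs_upow (\<lambda>n. poly r (rep_upow x n)) = abs_upow (\<lambda>n. 0)"
    using p(3) poly_const_upow[of r "rep_upow x"] by (simp add: pr zero_upow_def)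
  then have "eventually (\<lambda>n. rep_upow x n \<in> {a. poly r a = 0}) ultra"
    by (simp add: abs_upow_eq_iff)
  from eventually_ultra_finite[OF poly_roots_finite[OF \<open>r \<noteq> 0\<close>] this]
  show "x \<in> W" by auto
qed

lemma dcl_consts: "C \<subseteq> W \<Longrightarrow> dcl C \<subseteq> W"
  by (rule dcl_least) (auto simp: alg_closure_consts const_upow_hom)

lemma finite_set_coordinates:
  assumes "finite X" and "eventually (\<lambda>n. [f n, g n] \<in> X) ultra"
  shows "{abs_upow f, abs_upow g} \<subseteq> const_upow ` (\<Union>z\<in>X. set z)"
proof -
  have "finite (\<Union>z\<in>X. set z)" using assms(1) by auto
  moreover have "eventually (\<lambda>n. f n \<in> (\<Union>z\<in>X. set z)) ultra" "eventually (\<lambda>n. g n \<in> (\<Union>z\<in>X. set z)) ultra"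
    by (rule eventually_mono[OF assms(2)]; force)+
  ultimately show ?thesis by (simp add: eventually_ultra_finite)
qed

lemma sat_extension:
  "sat \<delta>M (assign [abs_upow f, abs_upow g]) (map_fm const_upow \<phi>) \<longleftrightarrow>
    eventually (\<lambda>n. [f n, g n] \<in> defset \<sigma> 2 \<phi>) ultra"
  unfolding assign_abs Los_const mem_defset ..

lemma finite_vf_index: "finite idx"
  by (rule finite_subset[of _ "UNIV \<times> {..d} \<times> {..d}"]) (auto simp: vf_index_def)

text \<open>If the set were finite, every solution in the ultrapower would have coordinates among
  the constants coming from it, but some solution is generic over these.\<close>

lemma infinite_solutions: "infinite (defset \<sigma> 2 (vf_fm d c0))"
proof
  let ?X = "defset \<sigma> 2 (vf_fm d c0)"
  assume fin: "finite ?X"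
  let ?S = "(\<lambda>k. const_upow (c0 k)) ` idx \<union> const_upow ` (\<Union>z\<in>?X. set z)"
  have "countable ?S" using fin finite_vf_index by (intro countable_finite) auto
  then obtain x y where xy: "sol x y" "\<not> {x, y} \<subseteq> dcl ?S"
    using ex_generic_solution[of ?S] by blast
  have "sat \<delta>M (assign [abs_upow (rep_upow x), abs_upow (rep_upow y)]) (map_fm const_upow (vf_fm d c0))"
    using xy(1) by (simp add: map_fm_vf_fm sat_vf_fm assign_simps)
  then have "{x, y} \<subseteq> const_upow ` (\<Union>z\<in>?X. set z)"
    unfolding sat_extension using finite_set_coordinates[OF fin, of "rep_upow x" "rep_upow y"] by simp
  then show False using xy(2) dcl_base[of ?S] by blast
qed

text \<open>The class of an injective sequence in the set is not constant, because a nonprincipal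
  ultrafilter does not concentrate on a single index.\<close>

lemma infinite_definable_point:
  assumes "infinite (defset \<sigma> 2 \<phi>)"
  obtains x y where "\<not> {x, y} \<subseteq> W" "sat \<delta>M (assign [x, y]) (map_fm const_upow \<phi>)"
proof -
  obtain u :: "nat \<Rightarrow> 'w list" where u: "inj u" "range u \<subseteq> defset \<sigma> 2 \<phi>"
    using assms unfolding infinite_iff_countable_subset by blast
  have u2: "[u n ! 0, u n ! 1] = u n" "u n \<in> defset \<sigma> 2 \<phi>" for n
  proof -
    show un: "u n \<in> defset \<sigma> 2 \<phi>" using u(2) by blast
    obtain x y where "u n = [x, y]" by (rule length_2_cases[OF un])
    then show "[u n ! 0, u n ! 1] = u n" by simp
  qed
  let ?x = "abs_upow (\<lambda>n. u n ! 0)" and ?y = "abs_upow (\<lambda>n. u n ! 1)"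
  have "sat \<delta>M (assign [?x, ?y]) (map_fm const_upow \<phi>)"
    unfolding sat_extension u2(1) by (simp add: u2(2))
  moreover have "\<not> {?x, ?y} \<subseteq> W"
  proof
    assume "{?x, ?y} \<subseteq> W"
    then obtain a b where "?x = const_upow a" "?y = const_upow b" by auto
    then have "eventually (\<lambda>n. u n ! 0 = a \<and> u n ! 1 = b) ultra"
      by (simp add: const_upow_def abs_upow_eq_iff eventually_ultra_conj)
    then have ev: "eventually (\<lambda>n. u n = [a, b]) ultra"
      by (rule eventually_mono) (metis u2(1))
    then obtain n where n: "u n = [a, b]"
      using eventually_happens'[OF ultra_not_bot] by blast
    obtain m where "u m = [a, b]" "Suc n \<le> m"
      using eventually_happens'[OF ultra_not_bot eventually_conj[OF ev eventually_ultra_large[of "Suc n"]]] by blast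
    then show False using n injD[OF u(1), of n m] by simp
  qed
  ultimately show ?thesis using that by blast
qed

text \<open>If both parts were infinite, each would contain a nonconstant solution in the
  ultrapower. The parameters are constants, so both solutions are generic over them and cannot be
  separated by \<open>\<phi>\<close>.\<close>

theorem definable_subset_finite_or_cofinite:
  assumes "X \<subseteq> defset \<sigma> 2 (vf_fm d c0)" "definable_over \<sigma> 2 UNIV X"
  shows "finite X \<or> finite (defset \<sigma> 2 (vf_fm d c0) - X)"
proof (rule ccontr)
  assume neg: "\<not> ?thesis"
  obtain \<phi> where X: "X = defset \<sigma> 2 \<phi>"
    using assms(2) by (auto simp: definable_over_def)
  let ?D = "vf_fm d c0"
  have "X = defset \<sigma> 2 (FAnd ?D \<phi>)" "defset \<sigma> 2 ?D - X = defset \<sigma> 2 (FAnd ?D (FNot \<phi>))"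
    using assms(1) unfolding X by (auto simp: defset_def)
  then have "infinite (defset \<sigma> 2 (FAnd ?D \<phi>))" "infinite (defset \<sigma> 2 (FAnd ?D (FNot \<phi>)))"
    using neg by simp_all
  then obtain x1 x2 y1 y2 where x: "\<not> {x1, x2} \<subseteq> W" "sat \<delta>M (assign [x1, x2]) (map_fm const_upow (FAnd ?D \<phi>))"
    and y: "\<not> {y1, y2} \<subseteq> W" "sat \<delta>M (assign [y1, y2]) (map_fm const_upow (FAnd ?D (FNot \<phi>)))"
    by (meson infinite_definable_point)
  let ?C = "(\<lambda>k. const_upow (c0 k)) ` idx \<union> fm_params (map_fm const_upow \<phi>)"
  have "countable ?C" using finite_vf_index finite_fm_params by (intro countable_finite) auto
  moreover have "dcl ?C \<subseteq> W" by (rule dcl_consts) (auto simp: fm.set_map)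
  ultimately have "sat \<delta>M (assign [x1, x2]) (map_fm const_upow \<phi>) \<longleftrightarrow> sat \<delta>M (assign [y1, y2]) (map_fm const_upow \<phi>)"
    using x y by (intro generic_solutions_same_formulas[of ?C])
      (auto simp: map_fm_vf_fm sat_vf_fm assign_simps)
  then show False using x(2) y(2) by simp
qed

lemma closed_term:
  assumes "x \<in> ring_gen {(\<delta>M ^^ i) c | c i. c \<in> const_upow ` C}"
  shows "\<exists>t. tm_params t \<subseteq> C \<and> (\<forall>s. const_upow (tm_val \<sigma> s t) = x)"
  using assms
proof induction
  case (base x)
  then obtain c i where c: "x = (\<delta>M ^^ i) (const_upow c)" "c \<in> C" by blast
  have "tm_params ((TDer ^^ i) (Param c)) \<subseteq> C" for i
    by (induction i) (use c in auto)
  moreover have "(\<delta>M ^^ i) (const_upow c) = const_upow ((\<sigma> ^^ i) c)" for i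
    by (induction i) (simp_all add: const_upow_hom)
  ultimately show ?case
    unfolding c(1) by (intro exI[of _ "(TDer ^^ i) (Param c)"]) (simp add: tm_val_tder)
next
  case one
  show ?case by (intro exI[of _ TOne]) (simp add: const_upow_hom)
next
  case (diff x y)
  then obtain t u where tu: "tm_params t \<subseteq> C" "\<And>s. const_upow (tm_val \<sigma> s t) = x"
    "tm_params u \<subseteq> C" "\<And>s. const_upow (tm_val \<sigma> s u) = y" by blast
  have "const_upow (tm_val \<sigma> s (TAdd t (TNeg u))) = x - y" for s
    using const_upow_hom(4)[of "tm_val \<sigma> s t" "tm_val \<sigma> s u"] tu by simp
  then show ?case
    using tu(1,3) by (intro exI[of _ "TAdd t (TNeg u)"]) simp
next
  case (mult x y)
  then obtain t u where tu: "tm_params t \<subseteq> C" "\<And>s. const_upow (tm_val \<sigma> s t) = x"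
    "tm_params u \<subseteq> C" "\<And>s. const_upow (tm_val \<sigma> s u) = y" by blast
  then show ?case
    by (intro exI[of _ "TMul t u"]) (simp add: const_upow_hom(5))
qed

text \<open>The coefficients of a relation for \<open>z\<close> are values of terms independent of
  the assignment, so the relation is itself a term over \<open>C\<close>; \<open>v\<close> is the
  variable in which it is written.\<close>

lemma dcl_imp_algebraic_term:
  assumes "const_upow z \<in> dcl (const_upow ` C)"
  obtains t q where "tm_params t \<subseteq> C" "q \<noteq> 0" "poly q z = 0" "\<And>s. tm_val \<sigma> s t = poly q (s v)"
proof -
  obtain p where p: "p \<noteq> 0" "\<And>i. coeff p i \<in> ring_gen {(\<delta>M ^^ i) c | c i. c \<in> const_upow ` C}"
    "poly p (const_upow z) = 0"
    using assms alg_closure_imp_algebraic unfolding dcl_def by blast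
  have "\<forall>i. \<exists>t. tm_params t \<subseteq> C \<and> (\<forall>s. const_upow (tm_val \<sigma> s t) = coeff p i)"
    using closed_term[OF p(2)] by blast
  then obtain ts where ts: "\<And>i. tm_params (ts i) \<subseteq> C" "\<And>i s. const_upow (tm_val \<sigma> s (ts i)) = coeff p i"
    by metis
  define c where "c i = tm_val \<sigma> (\<lambda>_. 0) (ts i)" for i
  have c: "tm_val \<sigma> s (ts i) = c i" "coeff p i = const_upow (c i)" for s i
    unfolding c_def using ts(2) by (metis const_upow_hom(7))+
  define q where "q = (\<Sum>i\<le>degree p. monom (c i) i)"
  have pq: "p = map_poly const_upow q"
    unfolding q_def by (rule poly_eq_map_const) (rule c(2))
  have "const_upow (poly q z) = const_upow 0"
    using p(3) poly_const_upow[of q "\<lambda>_. z"] unfolding pq const_upow_hom(1) by (simp add: const_upow_def)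
  show ?thesis
  proof
    show "tm_params (tupoly v ts (degree p)) \<subseteq> C" using ts(1) by (auto simp: tm_params_tupoly)
    show "q \<noteq> 0" using p(1) pq by auto
    show "poly q z = 0" using \<open>const_upow (poly q z) = _\<close> const_upow_hom(7) by blast
    show "tm_val \<sigma> s (tupoly v ts (degree p)) = poly q (s v)" for s
      by (simp add: tm_val_tupoly c(1) q_def poly_sum poly_monom)
  qed
qed

text \<open>From right to left, polynomial relations for the two coordinates define a finite set
  over \<open>C\<close>. From left to right, a solution generic over the parameters shares its
  formulas with all other such solutions, so no finite definable set contains it.\<close>

theorem acl_iff_dcl:
  assumes z: "[z1, z2] \<in> defset \<sigma> 2 (vf_fm d c0)" and C: "c0 ` idx \<subseteq> C"
  shows "[z1, z2] \<in> acl \<sigma> 2 C \<longleftrightarrow> {const_upow z1, const_upow z2} \<subseteq> dcl (const_upow ` C)"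
proof
  assume "[z1, z2] \<in> acl \<sigma> 2 C"
  then obtain \<phi> where \<phi>: "fm_params \<phi> \<subseteq> C" "finite (defset \<sigma> 2 \<phi>)" "[z1, z2] \<in> defset \<sigma> 2 \<phi>"
    by (auto simp: acl_def definable_over_def)
  show "{const_upow z1, const_upow z2} \<subseteq> dcl (const_upow ` C)"
  proof (rule ccontr)
    assume neg: "\<not> {const_upow z1, const_upow z2} \<subseteq> dcl (const_upow ` C)"
    \<comment> \<open>\<open>C\<close> may be uncountable, whereas equality of types is available
      over countable sets; only the coefficients and the parameters of \<open>\<phi>\<close>
      matter.\<close>
    define C0 where "C0 = const_upow ` (c0 ` idx \<union> fm_params \<phi>)"
    let ?X = "const_upow ` (\<Union>z\<in>defset \<sigma> 2 \<phi>. set z)"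
    have "C0 \<subseteq> const_upow ` C" using C \<phi>(1) by (auto simp: C0_def)
    then have neg0: "\<not> {const_upow z1, const_upow z2} \<subseteq> dcl C0"
      using neg dcl_mono by blast
    have fin: "finite C0" "finite (C0 \<union> ?X)"
      using finite_vf_index finite_fm_params \<phi>(2) by (auto simp: C0_def)
    have cf: "(\<lambda>k. const_upow (c0 k)) ` idx \<subseteq> C0" by (auto simp: C0_def)
    \<comment> \<open>This solution is generic even over the coordinates of the finite set. Equality
      of types makes it satisfy \<open>\<phi>\<close>, and \<open>Los\<close> then places it among
      those coordinates.\<close>
    obtain x y where xy: "sol x y" "\<not> {x, y} \<subseteq> dcl (C0 \<union> ?X)"
      by (rule ex_generic_solution[OF countable_finite[OF fin(2)] le_supI1[OF cf]])
    then have xy0: "\<not> {x, y} \<subseteq> dcl C0" using dcl_mono[of C0 "C0 \<union> ?X"] by blast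
    have "sat \<delta>M (assign [const_upow z1, const_upow z2]) (map_fm const_upow \<phi>)"
      using \<phi>(3) elementary_const_upow[of \<sigma>] unfolding mem_defset elementary_embedding_def assign_const[symmetric] by blast
    then have "sat \<delta>M (assign [x, y]) (map_fm const_upow \<phi>)"
      using generic_solutions_same_formulas[OF countable_finite[OF fin(1)] cf _ neg0 xy(1) xy0, of "map_fm const_upow \<phi>"]
        z const_solution_iff by (auto simp: C0_def fm.set_map)
    then have "eventually (\<lambda>n. [rep_upow x n, rep_upow y n] \<in> defset \<sigma> 2 \<phi>) ultra"
      using sat_extension[of "rep_upow x" "rep_upow y" \<phi>] by simp
    then have "{x, y} \<subseteq> ?X"
      using finite_set_coordinates[OF \<phi>(2), of "rep_upow x" "rep_upow y"] by simp
    then show False using xy(2) dcl_base[of "C0 \<union> ?X"] by blast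
  qed
next
  assume alg: "{const_upow z1, const_upow z2} \<subseteq> dcl (const_upow ` C)"
  obtain t1 q1 where 1: "tm_params t1 \<subseteq> C" "q1 \<noteq> 0" "poly q1 z1 = 0" "\<And>s. tm_val \<sigma> s t1 = poly q1 (s 0)"
    using dcl_imp_algebraic_term[of z1 C] alg by blast
  obtain t2 q2 where 2: "tm_params t2 \<subseteq> C" "q2 \<noteq> 0" "poly q2 z2 = 0" "\<And>s. tm_val \<sigma> s t2 = poly q2 (s 1)"
    using dcl_imp_algebraic_term[of z2 C] alg by blast
  let ?\<phi> = "FAnd (FEq t1 TZero) (FEq t2 TZero)"
  have mem: "[x, y] \<in> defset \<sigma> 2 ?\<phi> \<longleftrightarrow> poly q1 x = 0 \<and> poly q2 y = 0" for x y
    by (simp add: mem_defset 1(4) 2(4) assign_simps)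
  have "defset \<sigma> 2 ?\<phi> \<subseteq> (\<lambda>(x, y). [x, y]) ` ({x. poly q1 x = 0} \<times> {y. poly q2 y = 0})"
  proof
    fix z assume z: "z \<in> defset \<sigma> 2 ?\<phi>"
    obtain x y where "z = [x, y]" by (rule length_2_cases[OF z])
    then show "z \<in> (\<lambda>(x, y). [x, y]) ` ({x. poly q1 x = 0} \<times> {y. poly q2 y = 0})"
      using z mem by (intro image_eqI[of _ _ "(x, y)"]) auto
  qed
  then have "finite (defset \<sigma> 2 ?\<phi>)"
    by (rule finite_subset) (intro finite_imageI finite_cartesian_product poly_roots_finite 1(2) 2(2))
  moreover have "definable_over \<sigma> 2 C (defset \<sigma> 2 ?\<phi>)"
    unfolding definable_over_def using 1(1) 2(1) by (intro exI[of _ ?\<phi>]) simp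
  ultimately have "defset \<sigma> 2 ?\<phi> \<subseteq> acl \<sigma> 2 C"
    unfolding acl_def by blast
  then show "[z1, z2] \<in> acl \<sigma> 2 C" using mem[of z1 z2] 1(3) 2(3) by blast
qed

text \<open>A formula has finitely many parameters, so a finite nonempty \<open>A0\<close> inside
  \<open>A\<close> suffices and the algebraic statement about finitely many solutions
  applies.\<close>

theorem acl_solutions:
  assumes A: "A \<subseteq> defset \<sigma> 2 (vf_fm d c0)" "A \<noteq> {}" and B: "c0 ` idx \<subseteq> B"
  shows "acl \<sigma> 2 ((\<Union>a\<in>A. set a) \<union> B) \<inter> defset \<sigma> 2 (vf_fm d c0) =
    (\<Union>a\<in>A. acl \<sigma> 2 (set a \<union> B) \<inter> defset \<sigma> 2 (vf_fm d c0))" (is "?L = ?R")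
proof (rule subset_antisym)
  show "?R \<subseteq> ?L"
  proof
    fix z assume "z \<in> ?R"
    then obtain a where a: "a \<in> A" "z \<in> acl \<sigma> 2 (set a \<union> B)" "z \<in> defset \<sigma> 2 (vf_fm d c0)" by blast
    have "set a \<union> B \<subseteq> (\<Union>a\<in>A. set a) \<union> B" using a(1) by blast
    from acl_mono[OF this, of \<sigma> 2] show "z \<in> ?L" using a(2,3) by blast
  qed
  show "?L \<subseteq> ?R"
  proof
    fix z assume z: "z \<in> ?L"
    then have zD: "z \<in> defset \<sigma> 2 (vf_fm d c0)" by blast
    obtain \<phi> where \<phi>: "fm_params \<phi> \<subseteq> (\<Union>a\<in>A. set a) \<union> B" "finite (defset \<sigma> 2 \<phi>)" "z \<in> defset \<sigma> 2 \<phi>"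
      using z by (auto simp: acl_def definable_over_def)
    obtain A0 where A0: "A0 \<subseteq> A" "finite A0" "A0 \<noteq> {}" "fm_params \<phi> \<subseteq> (\<Union>a\<in>A0. set a) \<union> B"
      using finite_subset_UN_Un[OF finite_fm_params \<phi>(1) A(2)] by blast
    obtain z1 z2 where zz: "z = [z1, z2]" by (rule length_2_cases[OF zD])
    have "z \<in> acl \<sigma> 2 ((\<Union>a\<in>A0. set a) \<union> B)"
      unfolding acl_def definable_over_def using \<phi>(2,3) A0(4) by blast
    then have "{const_upow z1, const_upow z2} \<subseteq> dcl (const_upow ` ((\<Union>a\<in>A0. set a) \<union> B))"
      using acl_iff_dcl zD B unfolding zz by blast
    also have "const_upow ` ((\<Union>a\<in>A0. set a) \<union> B) = (\<Union>a\<in>map const_upow ` A0. set a) \<union> const_upow ` B"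
      by (simp add: image_Un image_UN)
    finally have mem: "{const_upow z1, const_upow z2} \<subseteq> dcl ((\<Union>a\<in>map const_upow ` A0. set a) \<union> const_upow ` B)" .
    have sols: "\<exists>x y. a = [x, y] \<and> sol x y" if a: "a \<in> map const_upow ` A0" for a
    proof -
      obtain b where b: "b \<in> A0" "a = map const_upow b" using a by blast
      then have "b \<in> defset \<sigma> 2 (vf_fm d c0)" using A0(1) A(1) by blast
      moreover obtain x y where "b = [x, y]" by (rule length_2_cases[OF calculation])
      ultimately show ?thesis using const_solution_iff b(2) by auto
    qed
    have "sol (const_upow z1) (const_upow z2)" using zD const_solution_iff by (simp add: zz)
    from solutions_disintegrated[OF _ _ sols this mem]
    have "\<exists>a\<in>map const_upow ` A0. {const_upow z1, const_upow z2} \<subseteq> dcl (set a \<union> const_upow ` B)"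
      using A0(2,3) B by blast
    then obtain a where a: "a \<in> A0" "{const_upow z1, const_upow z2} \<subseteq> dcl (set (map const_upow a) \<union> const_upow ` B)"
      by blast
    have "set (map const_upow a) \<union> const_upow ` B = const_upow ` (set a \<union> B)" by (simp add: image_Un)
    moreover have "c0 ` idx \<subseteq> set a \<union> B" using B by blast
    ultimately have "z \<in> acl \<sigma> 2 (set a \<union> B)"
      using acl_iff_dcl[of z1 z2 "set a \<union> B"] a(2) zD unfolding zz by simp
    then show "z \<in> ?R" using a(1) A0(1) zD by blast
  qed
qed

end

lemma elementary_hom:
  assumes e: "elementary_embedding \<delta> \<sigma> e"
  shows "e 1 = 1" "e (x + y) = e x + e y" "e (x * y) = e x * e y" "e (\<delta> x) = \<sigma> (e x)"
proof -
  have *: "sat \<sigma> (e \<circ> s) (map_fm e \<phi>) \<longleftrightarrow> sat \<delta> s \<phi>" for s \<phi>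
    using e by (simp add: elementary_embedding_def)
  let ?s = "\<lambda>i. if i = 0 then x else if i = 1 then y else if i = 2 then x + y else if i = 3 then x * y else \<delta> x"
  show "e 1 = 1" using *[of "\<lambda>_. 1" "FEq (Var 0) TOne"] by simp
  show "e (x + y) = e x + e y" using *[of ?s "FEq (Var 2) (TAdd (Var 0) (Var 1))"] by simp
  show "e (x * y) = e x * e y" using *[of ?s "FEq (Var 3) (TMul (Var 0) (Var 1))"] by simp
  show "e (\<delta> x) = \<sigma> (e x)" using *[of ?s "FEq (Var 4) (TDer (Var 0))"] by simp
qed

text \<open>The coefficients reach the ultrapower through \<open>\<iota>\<close>, \<open>e\<close>
  and \<open>const_upow\<close>; the composite is a field homomorphism on \<open>K\<close>, which is
  what is needed to vary their images independently there.\<close>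

lemma ultra_vf_elementary:
  fixes \<delta> :: "'u::field_char_0 \<Rightarrow> 'u" and \<sigma> :: "'w::field_char_0 \<Rightarrow> 'w"
  assumes "3 \<le> d" "Q_independent_coefficients d f g" "differentially_closed \<delta>"
    and \<iota>: "embeds_into_constants K \<iota> \<delta>" "vf_coeff f g ` vf_index d \<subseteq> K"
    and e: "elementary_embedding \<delta> \<sigma> e"
  shows "ultra_vf \<sigma> d (e \<circ> \<iota> \<circ> vf_coeff f g)"
proof -
  have dc: "differentially_closed \<sigma>"
    by (rule elementary_differentially_closed[OF e assms(3)])
  have dcM: "differentially_closed (map_upow \<sigma>)"
    by (rule elementary_differentially_closed[OF elementary_const_upow dc])
  have \<sigma>: "ring_derivation \<sigma>" using dc by (simp add: differentially_closed_def derivation_iff)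
  have K: "subfield_hom K (const_upow \<circ> e \<circ> \<iota>)"
    using \<iota>(1) by (simp add: subfield_hom_def embeds_into_constants_def elementary_hom[OF e] const_upow_hom)
  have "e 0 = 0" using elementary_hom(2)[OF e, of 0 0] by simp
  have cK: "vf_coeff f g k \<in> K" if "k \<in> vf_index d" for k
    using \<iota>(2) that by blast
  have "generic_vf (map_upow \<sigma>) d (\<lambda>k. const_upow ((e \<circ> \<iota> \<circ> vf_coeff f g) k))"
  proof
    show "ring_derivation (map_upow \<sigma>)"
      using dcM by (simp add: differentially_closed_def derivation_iff)
    show "alg_closed TYPE('w upow)" by (rule differentially_closed_imp_alg_closed[OF dcM])
    fix k assume k: "k \<in> vf_index d"
    have "\<sigma> (e (\<iota> (vf_coeff f g k))) = e (\<delta> (\<iota> (vf_coeff f g k)))" by (simp add: elementary_hom[OF e])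
    then show "map_upow \<sigma> (const_upow ((e \<circ> \<iota> \<circ> vf_coeff f g) k)) = 0"
      using cK[OF k] \<iota>(1) \<open>e 0 = 0\<close> by (simp add: const_upow_hom embeds_into_constants_def)
    have "vf_coeff f g k \<noteq> 0"
      using assms(2) k by (simp add: Q_independent_coefficients_def)
    then show "const_upow ((e \<circ> \<iota> \<circ> vf_coeff f g) k) \<noteq> 0"
      using subfield_hom_eq_0_iff[OF K cK[OF k]] by simp
  next
    fix b
    show "\<exists>D. ring_derivation D \<and> (\<forall>k\<in>vf_index d. D (const_upow ((e \<circ> \<iota> \<circ> vf_coeff f g) k)) = b k)"
      using independent_imp_derivation[OF _ K \<iota>(2), of b] assms(2)
      by (simp add: Q_independent_coefficients_def)
  qed (rule assms(1))
  then show ?thesis using dc by (simp add: ultra_vf_def ultra_vf_axioms_def)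
qed

theorem theorem3p1p4:
  fixes d :: nat
    and f g :: "(nat, complex) mpoly"
    and \<delta> :: "'u::field_char_0 \<Rightarrow> 'u"
    and K :: "complex set"
    and \<iota> :: "complex \<Rightarrow> 'u"
  assumes "3 \<le> d"
    and "planar_vector_field d f g"
    and "Q_independent_coefficients d f g"
    and "differentially_closed \<delta>"
    and "embeds_into_constants K \<iota> \<delta>"
    and "vf_coeff f g ` vf_index d \<subseteq> K"
  shows "strongly_minimal TYPE('w::field_char_0) \<delta> 2 (vf_solutions \<iota> f g \<delta>) \<and>
         disintegrated TYPE('w) \<delta> 2 (\<iota> ` vf_coeff f g ` vf_index d) (vf_solutions \<iota> f g \<delta>)"
proof -
  let ?\<phi> = "vf_fm d (\<iota> \<circ> vf_coeff f g)"
  have "subfield_hom K \<iota>"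
    using assms(5) by (simp add: subfield_hom_def embeds_into_constants_def)
  then have D: "vf_solutions \<iota> f g \<delta> = defset \<delta> 2 ?\<phi>"
    by (intro vf_solutions_eq_defset assms(2) subfield_hom_0)
  \<comment> \<open>An arbitrary extension is itself taken as the base of an ultrapower, so the
    results for \<open>ultra_vf\<close> speak about it directly.\<close>
  have vf: "ultra_vf \<sigma> d (e \<circ> \<iota> \<circ> vf_coeff f g)" "map_fm e ?\<phi> = vf_fm d (e \<circ> \<iota> \<circ> vf_coeff f g)"
    if "elementary_embedding \<delta> \<sigma> e" for \<sigma> :: "'w \<Rightarrow> 'w" and e
    using ultra_vf_elementary[OF assms(1,3-6) that] by (simp_all add: map_fm_vf_fm o_assoc)
  have "strongly_minimal TYPE('w) \<delta> 2 (vf_solutions \<iota> f g \<delta>)"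
    unfolding strongly_minimal_def Let_def D
  proof (intro exI[of _ ?\<phi>] conjI refl allI impI; (elim conjE)?)
    fix \<sigma> :: "'w \<Rightarrow> 'w" and e
    assume e: "elementary_embedding \<delta> \<sigma> e"
    show "infinite (defset \<sigma> 2 (map_fm e ?\<phi>))"
      unfolding vf(2)[OF e] by (rule ultra_vf.infinite_solutions[OF vf(1)[OF e]])
    fix X assume "X \<subseteq> defset \<sigma> 2 (map_fm e ?\<phi>)" "definable_over \<sigma> 2 UNIV X"
    then show "finite X \<or> finite (defset \<sigma> 2 (map_fm e ?\<phi>) - X)"
      unfolding vf(2)[OF e] by (rule ultra_vf.definable_subset_finite_or_cofinite[OF vf(1)[OF e]])
  qed
  moreover have "disintegrated TYPE('w) \<delta> 2 (\<iota> ` vf_coeff f g ` vf_index d) (vf_solutions \<iota> f g \<delta>)"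
    unfolding disintegrated_def Let_def D
  proof (intro exI[of _ ?\<phi>] conjI refl allI impI; (elim conjE)?)
    show "fm_params ?\<phi> \<subseteq> \<iota> ` vf_coeff f g ` vf_index d"
      using fm_params_vf_fm[of d "\<iota> \<circ> vf_coeff f g"] by (simp add: image_comp)
    fix \<sigma> :: "'w \<Rightarrow> 'w" and e A B
    assume e: "elementary_embedding \<delta> \<sigma> e" and A: "A \<subseteq> defset \<sigma> 2 (map_fm e ?\<phi>)" "A \<noteq> {}"
      and B: "e ` \<iota> ` vf_coeff f g ` vf_index d \<subseteq> B"
    have "(e \<circ> \<iota> \<circ> vf_coeff f g) ` vf_index d \<subseteq> B" using B by (simp add: image_comp o_assoc)
    from ultra_vf.acl_solutions[OF vf(1)[OF e] A[unfolded vf(2)[OF e]] this]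
    show "acl \<sigma> 2 ((\<Union>a\<in>A. set a) \<union> B) \<inter> defset \<sigma> 2 (map_fm e ?\<phi>) =
        (\<Union>a\<in>A. acl \<sigma> 2 (set a \<union> B) \<inter> defset \<sigma> 2 (map_fm e ?\<phi>))"
      unfolding vf(2)[OF e] .
  qed
  ultimately show ?thesis ..
qed

end
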